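(* Let $\lambda=\log\frac{3+\sqrt5}{2}$ and let $G$ be the simply connected 6-dimensional solvable Lie group whose left-invariant coframe $e^1,\dots,e^6$ satisfies $de^1=-\lambda e^{15}$, $de^2=\lambda e^{25}$, $de^3=-\lambda e^{36}$, $de^4=\lambda e^{46}$, $de^5=de^6=0$, equipped with the left-invariant symplectic form $\omega=e^{12}+e^{34}+e^{56}$. Consider left-invariant closed primitive 3-forms $$\varphi=\alpha(e^{135}+e^{136})+\beta(e^{145}-e^{146})+\gamma(e^{235}-e^{236})-\delta(e^{245}+e^{246})+(Me^5+Ne^6)\wedge(e^{12}-e^{34}),$$ for which the Type IIA flow $\partial_t\varphi=d\Lambda_\omega dF(\varphi)$ reduces to the ODE system in which $M,N$ are constant and $$\partial_t\alpha=4\lambda^2\alpha(4\beta\gamma-(M-N)^2),\quad \partial_t\beta=4\lambda^2\beta(4\alpha\delta-(M+N)^2),$$ $$\partial_t\gamma=4\lambda^2\gamma(4\alpha\delta-(M+N)^2),\quad \partial_t\delta=4\lambda^2\delta(4\beta\gamma-(M-N)^2).$$ Suppose that the initial form $\varphi(0)$ lies in the orbit $\mathcal{O}_-^+(\mu)$ for some $\mu>0$. Then, for any value of $M$ and $N$, this ODE system has a finite time singularity. Let $T<\infty$ be its maximal existence time. Then the limit $$\lim_{t\to T}\alpha(t)^{-1}\varphi(t)=\varphi_\infty$$ exists smoothly. Moreover, $\varphi_\infty$ defines a harmonic almost complex structure.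
   Context: Notation: $e^{ij}=e^i\wedge e^j$, $e^{ijk}=e^i\wedge e^j\wedge e^k$; $\Lambda_\omega$ is the Lefschetz operator of contraction with $\omega$. A 3-form is primitive if $\omega\wedge\varphi=0$. For a primitive 3-form $\varphi$ on a symplectic 6-manifold, $K=K(\varphi)\in\mathrm{End}\,TM$ is defined by $\iota_{KX}\frac{\omega^3}{3!}=-\iota_X\varphi\wedge\varphi$, $F(\varphi)(X,Y,Z)=-2\varphi(KX,Y,Z)$, and $Q(\varphi)$ by $\varphi\wedge F(\varphi)=-Q(\varphi)\frac{\omega^3}{3!}$. A primitive $\varphi$ lies in $\mathcal{O}_-^+(\mu)$ ($\mu>0$) if pointwise there is a basis $f^1,\dots,f^6$ of the cotangent space with $\omega=f^{12}+f^{34}+f^{56}$ and $\varphi=\mu(f^{135}-f^{146}-f^{236}-f^{245})$. In the present setting the condition that $\varphi$ lies in some $\mathcal{O}_-^+(\mu)$ is equivalent to: $\alpha,\beta,\gamma,\delta$ are all positive or all negative, $\alpha\delta+\beta\gamma>M^2$, $\alpha\delta+\beta\gamma>N^2$, and $-4\alpha\beta\gamma\delta+\alpha\delta(M-N)^2+\beta\gamma(M+N)^2<0$; this is preserved by the flow. For $\varphi$ in $\mathcal{O}_-^+(\mu)$, $K(\varphi)^2=\frac{Q(\varphi)}{4}\mathrm{id}$ with $Q(\varphi)<0$, and the associated almost complex structure is $J(\varphi)=K(\varphi)/\sqrt{-Q(\varphi)/4}$, which is compatible with $\omega$, with Riemannian metric $g(\varphi)(\cdot,\cdot)=\omega(\cdot,J(\varphi)\cdot)$.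 An almost complex structure $J$ orthogonal for a Riemannian metric $g$ with Levi-Civita connection $\nabla$ is called harmonic if it satisfies the Euler-Lagrange equation $[J,\nabla^*\nabla J]=0$ of the Dirichlet energy $\int|\nabla J|^2$ on $g$-orthogonal almost complex structures; here this is applied to $J(\varphi_\infty)$ and $g(\varphi_\infty)$. *)

theory Defs
  imports "HOL-Analysis.Analysis"
begin

section \<open>Exterior algebra of a vector space\<close>

text \<open>A form is evaluated on the list of its arguments, with the determinant convention
  \<open>(a \<and> b)(X,Y) = a(X) b(Y) - b(X) a(Y)\<close> for 1-forms. A \<open>k\<close>-form vanishes on all lists whose length
  is not \<open>k\<close>, so degrees need not be carried along.\<close>

type_synonym 'v form = "'v list \<Rightarrow> real"

definition wedge :: "'v form \<Rightarrow> 'v form \<Rightarrow> 'v form"  (infixr "\<and>\<^sub>\<Lambda>" 70) where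
  "(a \<and>\<^sub>\<Lambda> b) vs =
     (\<Sum>I\<in>Pow {..<length vs}.
        (-1) ^ card {(i, j). i \<in> I \<and> j \<in> {..<length vs} - I \<and> j < i} * a (nths vs I) * b (nths vs (- I)))"

definition contract :: "'v \<Rightarrow> 'v form \<Rightarrow> 'v form" where
  "contract X a vs = a (X # vs)"

text \<open>Covectors on \<open>\<real>\<^sup>6\<close> are represented by vectors through the standard inner product.\<close>

definition one_form :: "real^6 \<Rightarrow> (real^6) form" where
  "one_form w vs = (case vs of [v] \<Rightarrow> w \<bullet> v | _ \<Rightarrow> 0)"

text \<open>\<open>wedges f [i, j, k]\<close> is \<open>f\<^sup>i \<and> f\<^sup>j \<and> f\<^sup>k\<close>.\<close>

primrec wedges :: "(6 \<Rightarrow> real^6) \<Rightarrow> 6 list \<Rightarrow> (real^6) form" where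
  "wedges f [] = (\<lambda>vs. if vs = [] then 1 else 0)"
| "wedges f (i # is) = one_form (f i) \<and>\<^sub>\<Lambda> wedges f is"


section \<open>The tensors attached to a primitive 3-form at a point\<close>

definition sympl_vol :: "(real^6) form \<Rightarrow> (real^6) form" where
  "sympl_vol \<omega> vs = (\<omega> \<and>\<^sub>\<Lambda> \<omega> \<and>\<^sub>\<Lambda> \<omega>) vs / fact 3"

definition K_endo :: "(real^6) form \<Rightarrow> (real^6) form \<Rightarrow> real^6^6" where
  "K_endo \<omega> \<phi> =
     (THE A. \<forall>X vs. contract (A *v X) (sympl_vol \<omega>) vs = - (contract X \<phi> \<and>\<^sub>\<Lambda> \<phi>) vs)"

definition F_form :: "(real^6) form \<Rightarrow> (real^6) form \<Rightarrow> (real^6) form" where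
  "F_form \<omega> \<phi> vs = (case vs of [X, Y, Z] \<Rightarrow> - 2 * \<phi> [K_endo \<omega> \<phi> *v X, Y, Z] | _ \<Rightarrow> 0)"

definition Q_inv :: "(real^6) form \<Rightarrow> (real^6) form \<Rightarrow> real" where
  "Q_inv \<omega> \<phi> = (THE q. \<forall>vs. (\<phi> \<and>\<^sub>\<Lambda> F_form \<omega> \<phi>) vs = - q * sympl_vol \<omega> vs)"

definition J_endo :: "(real^6) form \<Rightarrow> (real^6) form \<Rightarrow> real^6^6" where
  "J_endo \<omega> \<phi> = (1 / sqrt (- Q_inv \<omega> \<phi> / 4)) *\<^sub>R K_endo \<omega> \<phi>"

definition g_metric :: "(real^6) form \<Rightarrow> (real^6) form \<Rightarrow> real^6^6" where
  "g_metric \<omega> \<phi> = (\<chi> i j. \<omega> [axis i 1, J_endo \<omega> \<phi> *v axis j 1])"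

definition orbit_minus_plus :: "real \<Rightarrow> (real^6) form \<Rightarrow> (real^6) form \<Rightarrow> bool" where
  "orbit_minus_plus \<mu> \<omega> \<phi> \<longleftrightarrow>
     (\<exists>f :: 6 \<Rightarrow> real^6. inj f \<and> independent (range f) \<and>
        \<omega> = (\<lambda>vs. wedges f [1,2] vs + wedges f [3,4] vs + wedges f [5,6] vs) \<and>
        \<phi> = (\<lambda>vs. \<mu> * (wedges f [1,3,5] vs - wedges f [1,4,6] vs - wedges f [2,3,6] vs - wedges f [2,4,5] vs)))"


section \<open>Calculus and Riemannian geometry in a global chart\<close>

text \<open>Tensor fields on a manifold with global chart \<open>\<real>\<^sup>6\<close>: the tangent space at each point is
  \<open>\<real>\<^sup>6\<close> with the coordinate frame, and endomorphisms and metrics are given by their matrices.\<close>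

definition partial :: "6 \<Rightarrow> (real^6 \<Rightarrow> real) \<Rightarrow> real^6 \<Rightarrow> real" where
  "partial i f p = deriv (\<lambda>h. f (p + h *\<^sub>R axis i 1)) 0"

primrec partials :: "6 list \<Rightarrow> (real^6 \<Rightarrow> real) \<Rightarrow> real^6 \<Rightarrow> real" where
  "partials [] f = f"
| "partials (i # is) f = partial i (partials is f)"

definition smooth_fun :: "(real^6 \<Rightarrow> real) \<Rightarrow> bool" where
  "smooth_fun f \<longleftrightarrow> (\<forall>is p. partials is f differentiable (at p))"

definition smooth_mat :: "(real^6 \<Rightarrow> real^6^6) \<Rightarrow> bool" where
  "smooth_mat A \<longleftrightarrow> (\<forall>i j. smooth_fun (\<lambda>p. A p $ i $ j))"

definition smooth_form :: "(real^6 \<Rightarrow> (real^6) form) \<Rightarrow> bool" where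
  "smooth_form \<alpha> \<longleftrightarrow> (\<forall>vs. smooth_fun (\<lambda>p. \<alpha> p vs))"

text \<open>Convergence in \<open>C\<^sup>\<infinity>\<close> on compact sets; it is enough to evaluate on constant vector fields.\<close>

definition smooth_limit ::
  "('t \<Rightarrow> real^6 \<Rightarrow> (real^6) form) \<Rightarrow> (real^6 \<Rightarrow> (real^6) form) \<Rightarrow> 't filter \<Rightarrow> bool" where
  "smooth_limit \<Phi> \<Psi> Fl \<longleftrightarrow> smooth_form \<Psi> \<and>
     (\<forall>vs is C. compact C \<longrightarrow>
        uniform_limit C (\<lambda>t. partials is (\<lambda>p. \<Phi> t p vs)) (partials is (\<lambda>p. \<Psi> p vs)) Fl)"

text \<open>Exterior derivative, evaluated on constant (hence commuting) vector fields.\<close>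

definition ext_deriv :: "(real^6 \<Rightarrow> (real^6) form) \<Rightarrow> real^6 \<Rightarrow> (real^6) form" where
  "ext_deriv \<alpha> p vs =
     (\<Sum>i<length vs. (-1) ^ i *
        deriv (\<lambda>h. \<alpha> (p + h *\<^sub>R (vs ! i)) (take i vs @ drop (Suc i) vs)) 0)"

definition partial_mat :: "6 \<Rightarrow> (real^6 \<Rightarrow> real^6^6) \<Rightarrow> real^6 \<Rightarrow> real^6^6" where
  "partial_mat i A p = (\<chi> k j. partial i (\<lambda>q. A q $ k $ j) p)"

text \<open>\<open>christoffel g i p $ k $ j\<close> is the Christoffel symbol \<open>\<Gamma>\<^sup>k\<^sub>i\<^sub>j\<close> of the Levi-Civita connection.\<close>

definition christoffel :: "(real^6 \<Rightarrow> real^6^6) \<Rightarrow> 6 \<Rightarrow> real^6 \<Rightarrow> real^6^6" where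
  "christoffel g i p = (\<chi> k j. (1/2) * (\<Sum>l\<in>UNIV. matrix_inv (g p) $ k $ l *
     (partial i (\<lambda>q. g q $ j $ l) p + partial j (\<lambda>q. g q $ i $ l) p - partial l (\<lambda>q. g q $ i $ j) p)))"

text \<open>\<open>cov g A i\<close> is \<open>\<nabla>\<^sub>i A\<close> for an endomorphism field \<open>A\<close>, and \<open>cov2 g A l i\<close> is
  \<open>(\<nabla>\<^sup>2A)(\<partial>\<^sub>l, \<partial>\<^sub>i) = \<nabla>\<^sub>l(\<nabla>\<^sub>i A) - \<Gamma>\<^sup>m\<^sub>l\<^sub>i \<nabla>\<^sub>m A\<close>.\<close>

definition cov :: "(real^6 \<Rightarrow> real^6^6) \<Rightarrow> (real^6 \<Rightarrow> real^6^6) \<Rightarrow> 6 \<Rightarrow> real^6 \<Rightarrow> real^6^6" where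
  "cov g A i p = partial_mat i A p + christoffel g i p ** A p - A p ** christoffel g i p"

definition cov2 :: "(real^6 \<Rightarrow> real^6^6) \<Rightarrow> (real^6 \<Rightarrow> real^6^6) \<Rightarrow> 6 \<Rightarrow> 6 \<Rightarrow> real^6 \<Rightarrow> real^6^6" where
  "cov2 g A l i p =
     partial_mat l (cov g A i) p + christoffel g l p ** cov g A i p - cov g A i p ** christoffel g l p
     - (\<Sum>m\<in>UNIV. christoffel g l p $ m $ i *\<^sub>R cov g A m p)"

text \<open>\<open>\<nabla>\<^sup>*\<nabla> A = - tr\<^sub>g \<nabla>\<^sup>2A\<close>.\<close>

definition rough_laplacian :: "(real^6 \<Rightarrow> real^6^6) \<Rightarrow> (real^6 \<Rightarrow> real^6^6) \<Rightarrow> real^6 \<Rightarrow> real^6^6" where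
  "rough_laplacian g A p = - (\<Sum>l\<in>UNIV. \<Sum>i\<in>UNIV. matrix_inv (g p) $ l $ i *\<^sub>R cov2 g A l i p)"

definition riemannian_metric :: "(real^6 \<Rightarrow> real^6^6) \<Rightarrow> bool" where
  "riemannian_metric g \<longleftrightarrow> smooth_mat g \<and>
     (\<forall>p. transpose (g p) = g p \<and> (\<forall>v. v \<noteq> 0 \<longrightarrow> v \<bullet> (g p *v v) > 0))"

definition orthogonal_acs :: "(real^6 \<Rightarrow> real^6^6) \<Rightarrow> (real^6 \<Rightarrow> real^6^6) \<Rightarrow> bool" where
  "orthogonal_acs g J \<longleftrightarrow> smooth_mat J \<and>
     (\<forall>p. J p ** J p = - mat 1 \<and> transpose (J p) ** g p ** J p = g p)"

definition harmonic_acs :: "(real^6 \<Rightarrow> real^6^6) \<Rightarrow> (real^6 \<Rightarrow> real^6^6) \<Rightarrow> bool" where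
  "harmonic_acs g J \<longleftrightarrow> riemannian_metric g \<and> orthogonal_acs g J \<and>
     (\<forall>p. J p ** rough_laplacian g J p - rough_laplacian g J p ** J p = 0)"


section \<open>The solvable Lie group\<close>

text \<open>The simply connected group \<open>G\<close> in global coordinates: it is \<open>\<real>\<^sup>6\<close> with the multiplication
  \<open>gmult\<close>, and its left-invariant coframe consists of
  \<open>e\<^sup>1 = exp(\<lambda>x\<^sub>5) dx\<^sub>1\<close>, \<open>e\<^sup>2 = exp(-\<lambda>x\<^sub>5) dx\<^sub>2\<close>, \<open>e\<^sup>3 = exp(\<lambda>x\<^sub>6) dx\<^sub>3\<close>, \<open>e\<^sup>4 = exp(-\<lambda>x\<^sub>6) dx\<^sub>4\<close>,
  \<open>e\<^sup>5 = dx\<^sub>5\<close>, \<open>e\<^sup>6 = dx\<^sub>6\<close>. The lemmas below verify the group laws, left-invariance, and the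
  structure equations.\<close>

definition lam :: real where
  "lam = ln ((3 + sqrt 5) / 2)"

definition weight :: "6 \<Rightarrow> real^6 \<Rightarrow> real" where
  "weight i p =
     (if i = 1 then lam * p $ 5 else if i = 2 then - lam * p $ 5
      else if i = 3 then lam * p $ 6 else if i = 4 then - lam * p $ 6 else 0)"

definition coframe :: "real^6 \<Rightarrow> 6 \<Rightarrow> real^6" where
  "coframe p i = exp (weight i p) *\<^sub>R axis i 1"

definition gmult :: "real^6 \<Rightarrow> real^6 \<Rightarrow> real^6" where
  "gmult p q = (\<chi> i. p $ i + exp (- weight i p) * q $ i)"

definition ginv :: "real^6 \<Rightarrow> real^6" where
  "ginv p = (\<chi> i. - exp (weight i p) * p $ i)"

lemma weight_gmult: "weight i (gmult p q) = weight i p + weight i q"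
  by (simp add: weight_def gmult_def algebra_simps)

lemma weight_ginv: "weight i (ginv p) = - weight i p"
  by (simp add: weight_def ginv_def)

lemma weight_zero: "weight i 0 = 0"
  by (simp add: weight_def)

lemma gmult_assoc: "gmult (gmult p q) r = gmult p (gmult q r)"
proof -
  have "gmult (gmult p q) r $ i = gmult p (gmult q r) $ i" for i
    unfolding gmult_def[of "gmult p q"] weight_gmult
    by (simp add: gmult_def exp_add[symmetric] algebra_simps flip: exp_add)
  then show ?thesis by (simp add: vec_eq_iff)
qed

lemma gmult_zero: "gmult 0 p = p" "gmult p 0 = p"
  by (simp_all add: gmult_def weight_zero vec_eq_iff)

lemma gmult_ginv: "gmult p (ginv p) = 0" "gmult (ginv p) p = 0"
  by (simp_all add: gmult_def weight_ginv vec_eq_iff) (simp_all add: ginv_def flip: mult.assoc exp_add)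

lemma gmult_has_derivative:
  "(gmult p has_derivative (\<lambda>v. \<chi> i. exp (- weight i p) * v $ i)) (at q)"
proof -
  have lin: "linear (\<lambda>v. \<chi> i. exp (- weight i p) * (v :: real^6) $ i)"
    by (rule linearI) (simp_all add: vec_eq_iff algebra_simps)
  have "((\<lambda>v. p + (\<chi> i. exp (- weight i p) * v $ i)) has_derivative
         (\<lambda>v. \<chi> i. exp (- weight i p) * v $ i)) (at q)"
    using linear_imp_has_derivative[OF lin] has_derivative_add[OF has_derivative_const] by fastforce
  moreover have "(\<lambda>v. p + (\<chi> i. exp (- weight i p) * v $ i)) = gmult p"
    by (simp add: fun_eq_iff gmult_def vec_eq_iff)
  ultimately show ?thesis by simp
qed

lemma coframe_left_invariant:
  "coframe (gmult p q) i \<bullet> frechet_derivative (gmult p) (at q) v = coframe q i \<bullet> v"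
  unfolding frechet_derivative_at[OF gmult_has_derivative, symmetric]
  by (simp add: coframe_def weight_gmult inner_axis' flip: exp_add mult.assoc)

lemma nths_singleton: "i < length vs \<Longrightarrow> nths vs {i} = [vs ! i]"
proof (induction vs arbitrary: i)
  case (Cons v vs)
  show ?case
  proof (cases i)
    case (Suc k)
    have "{j. Suc j = i} = {k}" using Suc by auto
    then show ?thesis using Cons Suc by (simp add: nths_Cons)
  qed (simp add: nths_Cons)
qed simp

lemma nths_Compl_singleton: "nths vs (- {i}) = take i vs @ drop (Suc i) vs"
proof (induction vs arbitrary: i)
  case (Cons v vs)
  show ?case
  proof (cases i)
    case 0
    have "{j. Suc j \<in> - {0}} = UNIV" by auto
    then show ?thesis using 0 by (simp add: nths_Cons nths_all)
  next
    case (Suc k)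
    have "{j. Suc j \<in> - {Suc k}} = - {k}" by auto
    then show ?thesis using Cons Suc by (simp add: nths_Cons)
  qed
qed simp

lemma one_form_eq_0: "length us \<noteq> 1 \<Longrightarrow> one_form w us = 0"
  by (auto simp: one_form_def split: list.split)

lemma wedge_one_form:
  "(one_form w \<and>\<^sub>\<Lambda> b) vs =
     (\<Sum>i<length vs. (-1) ^ i * (w \<bullet> vs ! i) * b (take i vs @ drop (Suc i) vs))"
proof -
  let ?n = "length vs"
  let ?g = "\<lambda>I. (-1) ^ card {(i, j). i \<in> I \<and> j \<in> {..<?n} - I \<and> j < i} *
                one_form w (nths vs I) * b (nths vs (- I))"
  have "(one_form w \<and>\<^sub>\<Lambda> b) vs = sum ?g ((\<lambda>i. {i}) ` {..<?n})"
    unfolding wedge_def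
  proof (rule sum.mono_neutral_right)
    show "\<forall>I\<in>Pow {..<?n} - (\<lambda>i. {i}) ` {..<?n}. ?g I = 0"
    proof
      fix I assume I: "I \<in> Pow {..<?n} - (\<lambda>i. {i}) ` {..<?n}"
      then have "card I \<noteq> 1" by (auto simp: card_1_singleton_iff)
      moreover have "{i. i < ?n \<and> i \<in> I} = I" using I by auto
      ultimately show "?g I = 0" by (simp add: one_form_eq_0 length_nths)
    qed
  qed auto
  also have "\<dots> = (\<Sum>i<?n. ?g {i})"
    by (subst sum.reindex) auto
  also have "\<dots> = (\<Sum>i<?n. (-1) ^ i * (w \<bullet> vs ! i) * b (take i vs @ drop (Suc i) vs))"
  proof (rule sum.cong[OF refl])
    fix i assume i: "i \<in> {..<?n}"
    then have "{(i', j). i' \<in> {i} \<and> j \<in> {..<?n} - {i} \<and> j < i'} = Pair i ` {..<i}" by auto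
    then have "card {(i', j). i' \<in> {i} \<and> j \<in> {..<?n} - {i} \<and> j < i'} = i"
      by (simp add: card_image inj_on_def)
    then show "?g {i} = (-1) ^ i * (w \<bullet> vs ! i) * b (take i vs @ drop (Suc i) vs)"
      using i by (simp add: nths_singleton nths_Compl_singleton one_form_def)
  qed
  finally show ?thesis .
qed

lemma wedges_single: "wedges f [i] = one_form (f i)"
proof
  fix vs :: "(real^6) list"
  consider "vs = []" | x where "vs = [x]" | x y zs where "vs = x # y # zs"
    by (metis list.exhaust)
  then show "wedges f [i] vs = one_form (f i) vs"
    by cases (auto simp: wedge_one_form one_form_def intro!: sum.neutral)
qed

lemma wedges_pair:
  "wedges f [i, j] vs = (case vs of [x, y] \<Rightarrow> (f i \<bullet> x) * (f j \<bullet> y) - (f i \<bullet> y) * (f j \<bullet> x) | _ \<Rightarrow> 0)"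
proof (cases "length vs = 2")
  case True
  then obtain x y where "vs = [x, y]" by (auto simp: length_Suc_conv numeral_2_eq_2)
  then show ?thesis
    unfolding wedges.simps(2)[of f i] wedges_single
    by (simp add: wedge_one_form one_form_def lessThan_Suc)
next
  case False
  then have "wedges f [i, j] vs = 0"
    unfolding wedges.simps(2)[of f i] wedges_single wedge_one_form
    by (intro sum.neutral) (auto simp: one_form_eq_0)
  with False show ?thesis by (auto split: list.split)
qed

lemma ext_deriv_one_form:
   "ext_deriv (\<lambda>q. one_form (coframe q i)) p =
      (\<lambda>vs. case vs of [x,y] \<Rightarrow> exp (weight i p) * (weight i x * y$i - weight i y * x $ i) | _ \<Rightarrow> 0)"
proof -
  have *: "deriv (\<lambda>h. one_form (coframe (p + h *\<^sub>R x) i) [y]) 0 = exp (weight i p) * weight i x * y $ i" for x y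
  proof -
    have "weight i (p + h *\<^sub>R x) = weight i p + h * weight i x" for h
      by (simp add: weight_def algebra_simps)
    then show ?thesis
      by (intro DERIV_imp_deriv) (auto simp: one_form_def coframe_def inner_axis' intro!: derivative_eq_intros)
  qed
  show ?thesis
  proof
    fix vs :: "(real^6) list"
    show "ext_deriv (\<lambda>q. one_form (coframe q i)) p vs = (case vs of [x,y] \<Rightarrow> exp (weight i p) * (weight i x * y$i - weight i y * x $ i) | _ \<Rightarrow> 0)"
    proof (cases "length vs = 2")
      case True
      then obtain x y where "vs = [x, y]" by (auto simp: length_Suc_conv numeral_2_eq_2)
      then show ?thesis by (simp add: ext_deriv_def lessThan_Suc * algebra_simps)
    next
      case False
      then have "ext_deriv (\<lambda>q. one_form (coframe q i)) p vs = 0"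
        unfolding ext_deriv_def
        by (intro sum.neutral ballI) (auto simp: one_form_eq_0)
      with False show ?thesis by (auto split: list.split)
    qed
  qed
qed

lemma structure_equations:
  "ext_deriv (\<lambda>q. one_form (coframe q 1)) p = (\<lambda>vs. - lam * wedges (coframe p) [1,5] vs)"
  "ext_deriv (\<lambda>q. one_form (coframe q 2)) p = (\<lambda>vs. lam * wedges (coframe p) [2,5] vs)"
  "ext_deriv (\<lambda>q. one_form (coframe q 3)) p = (\<lambda>vs. - lam * wedges (coframe p) [3,6] vs)"
  "ext_deriv (\<lambda>q. one_form (coframe q 4)) p = (\<lambda>vs. lam * wedges (coframe p) [4,6] vs)"
  "ext_deriv (\<lambda>q. one_form (coframe q 5)) p = (\<lambda>vs. 0)"
  "ext_deriv (\<lambda>q. one_form (coframe q 6)) p = (\<lambda>vs. 0)"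
  unfolding ext_deriv_one_form wedges_pair
  by (auto simp: fun_eq_iff coframe_def inner_axis' weight_def algebra_simps split: list.split)

definition omega :: "real^6 \<Rightarrow> (real^6) form" where
  "omega p = (\<lambda>vs. wedges (coframe p) [1,2] vs + wedges (coframe p) [3,4] vs + wedges (coframe p) [5,6] vs)"

definition phi :: "real \<Rightarrow> real \<Rightarrow> real \<Rightarrow> real \<Rightarrow> real \<Rightarrow> real \<Rightarrow> real^6 \<Rightarrow> (real^6) form" where
  "phi M N \<alpha> \<beta> \<gamma> \<delta> p = (let e = coframe p in (\<lambda>vs.
       \<alpha> * (wedges e [1,3,5] vs + wedges e [1,3,6] vs)
     + \<beta> * (wedges e [1,4,5] vs - wedges e [1,4,6] vs)
     + \<gamma> * (wedges e [2,3,5] vs - wedges e [2,3,6] vs)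
     - \<delta> * (wedges e [2,4,5] vs + wedges e [2,4,6] vs)
     + (one_form (M *\<^sub>R e 5 + N *\<^sub>R e 6) \<and>\<^sub>\<Lambda> (\<lambda>us. wedges e [1,2] us - wedges e [3,4] us)) vs))"


section \<open>The Type IIA flow on the ansatz \<open>phi\<close>, reduced to an ODE system\<close>

text \<open>\<open>flow_solution M N T\<close> asks for a solution on \<open>[0, T)\<close>; the derivative at \<open>0\<close> is one-sided.\<close>

definition flow_solution ::
  "real \<Rightarrow> real \<Rightarrow> real \<Rightarrow> (real \<Rightarrow> real) \<Rightarrow> (real \<Rightarrow> real) \<Rightarrow> (real \<Rightarrow> real) \<Rightarrow> (real \<Rightarrow> real) \<Rightarrow> bool" where
  "flow_solution M N T \<alpha> \<beta> \<gamma> \<delta> \<longleftrightarrow> (\<forall>t\<in>{0..<T}.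
     (\<alpha> has_real_derivative 4 * lam\<^sup>2 * \<alpha> t * (4 * \<beta> t * \<gamma> t - (M - N)\<^sup>2)) (at t within {0..<T}) \<and>
     (\<beta> has_real_derivative 4 * lam\<^sup>2 * \<beta> t * (4 * \<alpha> t * \<delta> t - (M + N)\<^sup>2)) (at t within {0..<T}) \<and>
     (\<gamma> has_real_derivative 4 * lam\<^sup>2 * \<gamma> t * (4 * \<alpha> t * \<delta> t - (M + N)\<^sup>2)) (at t within {0..<T}) \<and>
     (\<delta> has_real_derivative 4 * lam\<^sup>2 * \<delta> t * (4 * \<beta> t * \<gamma> t - (M - N)\<^sup>2)) (at t within {0..<T}))"

definition flow_solution_from ::
  "real \<Rightarrow> real \<Rightarrow> real \<Rightarrow> real \<Rightarrow> real \<Rightarrow> real \<Rightarrow> real \<Rightarrow>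
   (real \<Rightarrow> real) \<Rightarrow> (real \<Rightarrow> real) \<Rightarrow> (real \<Rightarrow> real) \<Rightarrow> (real \<Rightarrow> real) \<Rightarrow> bool" where
  "flow_solution_from M N \<alpha>0 \<beta>0 \<gamma>0 \<delta>0 T \<alpha> \<beta> \<gamma> \<delta> \<longleftrightarrow>
     flow_solution M N T \<alpha> \<beta> \<gamma> \<delta> \<and> \<alpha> 0 = \<alpha>0 \<and> \<beta> 0 = \<beta>0 \<and> \<gamma> 0 = \<gamma>0 \<and> \<delta> 0 = \<delta>0"

definition max_existence_time ::
  "real \<Rightarrow> real \<Rightarrow> real \<Rightarrow> real \<Rightarrow> real \<Rightarrow> real \<Rightarrow> real \<Rightarrow> bool" where
  "max_existence_time M N \<alpha>0 \<beta>0 \<gamma>0 \<delta>0 T \<longleftrightarrow> T > 0 \<and>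
     (\<exists>\<alpha> \<beta> \<gamma> \<delta>. flow_solution_from M N \<alpha>0 \<beta>0 \<gamma>0 \<delta>0 T \<alpha> \<beta> \<gamma> \<delta>) \<and>
     (\<forall>T'>T. \<not> (\<exists>\<alpha> \<beta> \<gamma> \<delta>. flow_solution_from M N \<alpha>0 \<beta>0 \<gamma>0 \<delta>0 T' \<alpha> \<beta> \<gamma> \<delta>))"

end

theory Submission
  imports Defs
begin

text \<open>On the ansatz the ratios \<open>\<alpha>/\<delta>\<close> and \<open>\<beta>/\<gamma>\<close> are constant along the flow, so with \<open>x = 4\<alpha>\<delta>\<close>, \<open>y = 4\<beta>\<gamma>\<close>,
  \<open>R = (M + N)\<^sup>2\<close>, \<open>P = (M - N)\<^sup>2\<close> and \<open>c = 8\<lambda>\<^sup>2\<close> the flow is equivalent to the planar system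
  \<open>x' = c x (y - P)\<close>, \<open>y' = c y (x - R)\<close>. The orbit condition places the initial point in the quadrant
  \<open>x > R\<close>, \<open>y > P\<close> (\<open>orbit_constraints\<close>, \<open>above_thresholds\<close>), where both variables increase. The functions
  \<open>x - R ln x\<close> and \<open>y - P ln y\<close> have the same time derivative \<open>c (x - R) (y - P)\<close>; both have therefore grown by
  the same amount \<open>s\<close>, and \<open>s\<close> parametrizes the trajectory explicitly. In this parameter \<open>x\<close> and \<open>y\<close> exist
  for all \<open>s \<ge> 0\<close> and grow at least linearly, while time is \<open>t = \<tau>(s) = \<integral> ds / (c (x - R) (y - P))\<close>, which
  stays bounded because the integrand decays like \<open>1/s\<^sup>2\<close>. So \<open>T = lim \<tau>(s)\<close> is finite, the trajectory
  blows up there, and every solution with the same initial value reads off the same clock \<open>\<tau>\<close>: this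
  gives existence and uniqueness without a general theorem on ordinary differential equations
  (\<open>planar_blowup\<close>). At the singularity the logarithms are negligible, so \<open>y/x\<close> tends to \<open>1\<close>
  (\<open>blowup_ratio\<close>), and \<open>\<alpha>\<^sup>-\<^sup>1\<phi>\<close> converges to the ansatz with \<open>M = N = 0\<close>, \<open>\<alpha> = 1\<close>, positive \<open>\<beta>\<close>, \<open>\<gamma>\<close>, and
  \<open>\<delta> = \<beta>\<gamma>\<close> (\<open>flow_blowup\<close>). The convergence is smooth because in the global coordinates all forms involved are
  fixed exponential functions with converging coefficients (\<open>smooth_limit_lincomb\<close>).

  The relation \<open>\<delta> = \<beta>\<gamma>\<close> is what makes the limit explicit: after rescaling \<open>e\<^sup>1, ..., e\<^sup>4\<close> and rotating
  \<open>e\<^sup>5, e\<^sup>6\<close> by 45 degrees it is a multiple of the real part of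
  \<open>(f\<^sup>1 + i f\<^sup>2) \<and> (f\<^sup>3 + i f\<^sup>4) \<and> (f\<^sup>5 + i f\<^sup>6)\<close> (\<open>ansatz_diag_frame\<close>). Its complex structure \<open>J\<close> couples the
  coordinates in the pairs \<open>12\<close>, \<open>34\<close>, \<open>56\<close>, and its metric is diagonal (\<open>limit_tensors\<close>). A direct
  computation gives \<open>\<nabla>\<^sup>*\<nabla>J = 2\<lambda>\<^sup>2 D J\<close> with \<open>D = diag(1,1,1,1,2,2)\<close> (\<open>limit_rough_laplacian\<close>). The matrix \<open>D\<close>
  is constant on the blocks of \<open>J\<close>, so it commutes with \<open>J\<close>, and \<open>J\<close> is harmonic.

  All exterior algebra rests on one identity, that contraction is an antiderivation of the wedge product
  (\<open>wedge_Cons\<close>). It turns associativity and anticommutation into inductions on the list of arguments, after which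
  products of forms reduce to sorting lists of indices.\<close>

section \<open>Contraction and associativity of the wedge product\<close>

lemma wedge_Nil: "(a \<and>\<^sub>\<Lambda> b) [] = a [] * b []"
  by (simp add: wedge_def)

text \<open>Contraction is an antiderivation. The subsets \<open>I\<close> in the definition of the wedge product either contain
  the position of \<open>v\<close> or not. In the first case \<open>v\<close> creates no inversion; in the second it creates one inversion
  with each element of \<open>I\<close>, which is the sign \<open>(-1)\<^sup>k\<close> for the degree \<open>k\<close> of the first factor.\<close>

lemma wedge_Cons:
  "(a \<and>\<^sub>\<Lambda> b) (v # vs) =
     (contract v a \<and>\<^sub>\<Lambda> b) vs + ((\<lambda>us. (-1) ^ length us * a us) \<and>\<^sub>\<Lambda> contract v b) vs"
proof -
  define n where "n = length vs"
  define inv :: "nat \<Rightarrow> nat set \<Rightarrow> (nat \<times> nat) set" where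
    "inv m I = {(i, j). i \<in> I \<and> j \<in> {..<m} - I \<and> j < i}" for m I
  define h where "h I = (-1) ^ card (inv (Suc n) I) * a (nths (v # vs) I) * b (nths (v # vs) (- I))" for I
  have fin: "finite (inv n I)" if "I \<subseteq> {..<n}" for I
    by (rule finite_subset[of _ "{..<n} \<times> {..<n}"]) (use that in \<open>auto simp: inv_def\<close>)
  have injm: "inj (map_prod Suc Suc)" by (simp add: prod.inj_map)
  have h0: "h (insert 0 (Suc ` I)) = (-1) ^ card (inv n I) * contract v a (nths vs I) * b (nths vs (- I))"
    if I: "I \<subseteq> {..<n}" for I
  proof -
    have "inv (Suc n) (insert 0 (Suc ` I)) = map_prod Suc Suc ` inv n I"
    proof (intro equalityI subsetI)
      fix x assume "x \<in> inv (Suc n) (insert 0 (Suc ` I))"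
      then obtain i j where "x = (Suc i, Suc j)" "(i, j) \<in> inv n I"
        by (cases x; cases "fst x"; cases "snd x") (auto simp: inv_def)
      then show "x \<in> map_prod Suc Suc ` inv n I" by force
    qed (auto simp: inv_def)
    then have "card (inv (Suc n) (insert 0 (Suc ` I))) = card (inv n I)"
      using card_image[OF inj_on_subset[OF injm]] by simp
    moreover have "{j. Suc j \<in> insert 0 (Suc ` I)} = I" "{j. Suc j \<in> - insert 0 (Suc ` I)} = - I"
      by auto
    ultimately show ?thesis by (simp add: h_def nths_Cons contract_def)
  qed
  have h1: "h (Suc ` I) = (-1) ^ card (inv n I) * ((-1) ^ length (nths vs I) * a (nths vs I)) *
      contract v b (nths vs (- I))" if I: "I \<subseteq> {..<n}" for I
  proof -
    have "inv (Suc n) (Suc ` I) = map_prod Suc Suc ` inv n I \<union> (\<lambda>i. (Suc i, 0)) ` I" (is "_ = ?A \<union> ?B")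
    proof (intro equalityI subsetI)
      fix x assume x: "x \<in> inv (Suc n) (Suc ` I)"
      then obtain i j where ij: "x = (Suc i, j)" "i \<in> I" by (auto simp: inv_def)
      show "x \<in> ?A \<union> ?B"
      proof (cases j)
        case (Suc k)
        then have "(i, k) \<in> inv n I" using x ij by (auto simp: inv_def)
        then show ?thesis using ij Suc by force
      qed (use ij in auto)
    qed (auto simp: inv_def)
    moreover have "finite ?A" "finite ?B" "?A \<inter> ?B = {}"
      using fin[OF I] I finite_subset by auto
    moreover have "card ?A = card (inv n I)" using card_image[OF inj_on_subset[OF injm]] by simp
    moreover have "card ?B = card I" by (simp add: card_image inj_on_def)
    ultimately have "card (inv (Suc n) (Suc ` I)) = card (inv n I) + card I"
      by (simp add: card_Un_disjoint)
    moreover have "{i. i < n \<and> i \<in> I} = I" using I by auto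
    then have "length (nths vs I) = card I" by (simp add: length_nths n_def)
    moreover have "{j. Suc j \<in> Suc ` I} = I" "{j. Suc j \<in> - Suc ` I} = - I" by auto
    ultimately show ?thesis by (simp add: h_def nths_Cons contract_def power_add)
  qed
  have "(a \<and>\<^sub>\<Lambda> b) (v # vs) = sum h (Pow {..<Suc n})"
    by (simp add: wedge_def h_def inv_def n_def)
  also have "Pow {..<Suc n} = image Suc ` Pow {..<n} \<union> (\<lambda>I. insert 0 (Suc ` I)) ` Pow {..<n}"
    by (simp add: lessThan_Suc_eq_insert_0 Pow_insert image_Pow_surj image_image)
       (metis image_Pow_surj image_image)
  also have "sum h \<dots> = sum h (image Suc ` Pow {..<n}) + sum h ((\<lambda>I. insert 0 (Suc ` I)) ` Pow {..<n})"
    by (intro sum.union_disjoint) auto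
  also have "sum h (image Suc ` Pow {..<n}) = (\<Sum>I\<in>Pow {..<n}. h (Suc ` I))"
    by (subst sum.reindex) (auto simp: inj_on_def inj_image_eq_iff)
  also have "sum h ((\<lambda>I. insert 0 (Suc ` I)) ` Pow {..<n}) = (\<Sum>I\<in>Pow {..<n}. h (insert 0 (Suc ` I)))"
  proof (subst sum.reindex)
    have "Suc ` I = insert 0 (Suc ` I) - {0}" for I by auto
    then show "inj_on (\<lambda>I. insert 0 (Suc ` I)) (Pow {..<n})"
      by (metis (no_types, lifting) inj_Suc inj_image_eq_iff inj_onI)
  qed simp
  finally show ?thesis
    by (simp add: h0 h1 wedge_def inv_def n_def)
qed

lemma contract_wedge:
  "contract v (a \<and>\<^sub>\<Lambda> b) =
     (\<lambda>vs. (contract v a \<and>\<^sub>\<Lambda> b) vs + ((\<lambda>us. (-1) ^ length us * a us) \<and>\<^sub>\<Lambda> contract v b) vs)"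
  by (simp add: fun_eq_iff contract_def[of v "a \<and>\<^sub>\<Lambda> b"] wedge_Cons)

lemma wedge_add_left: "((\<lambda>us. a us + b us) \<and>\<^sub>\<Lambda> c) vs = (a \<and>\<^sub>\<Lambda> c) vs + (b \<and>\<^sub>\<Lambda> c) vs"
  by (simp add: wedge_def algebra_simps sum.distrib)

lemma wedge_add_right: "(c \<and>\<^sub>\<Lambda> (\<lambda>us. a us + b us)) vs = (c \<and>\<^sub>\<Lambda> a) vs + (c \<and>\<^sub>\<Lambda> b) vs"
  by (simp add: wedge_def algebra_simps sum.distrib)

lemma wedge_scale_left: "((\<lambda>us. k * a us) \<and>\<^sub>\<Lambda> c) vs = k * (a \<and>\<^sub>\<Lambda> c) vs"
  by (simp add: wedge_def algebra_simps sum_distrib_left)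

lemma wedge_scale_right: "(c \<and>\<^sub>\<Lambda> (\<lambda>us. k * a us)) vs = k * (c \<and>\<^sub>\<Lambda> a) vs"
  by (simp add: wedge_def algebra_simps sum_distrib_left)

lemma wedge_minus_left: "((\<lambda>us. - a us) \<and>\<^sub>\<Lambda> c) vs = - (a \<and>\<^sub>\<Lambda> c) vs"
  by (simp add: wedge_def sum_negf)

lemma wedge_minus_right: "(c \<and>\<^sub>\<Lambda> (\<lambda>us. - a us)) vs = - (c \<and>\<^sub>\<Lambda> a) vs"
  by (simp add: wedge_def sum_negf)

lemma wedge_zero_left: "((\<lambda>us. 0) \<and>\<^sub>\<Lambda> c) = (\<lambda>vs. 0)"
  by (simp add: wedge_def fun_eq_iff)

lemma wedge_zero_right: "(c \<and>\<^sub>\<Lambda> (\<lambda>us. 0)) = (\<lambda>vs. 0)"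
  by (simp add: wedge_def fun_eq_iff)

text \<open>The degree involution is an algebra automorphism; it takes care of the signs in inductions that use
  \<open>wedge_Cons\<close>.\<close>

lemma parity_wedge:
  "(-1) ^ length vs * (a \<and>\<^sub>\<Lambda> b) vs =
     ((\<lambda>us. (-1) ^ length us * a us) \<and>\<^sub>\<Lambda> (\<lambda>us. (-1) ^ length us * b us)) vs"
proof (induction vs arbitrary: a b)
  case (Cons v vs)
  have c: "contract v (\<lambda>us. (-1) ^ length us * a us) = (\<lambda>us. - ((-1) ^ length us * contract v a us))"
    for a :: "'a form" by (simp add: contract_def fun_eq_iff)
  show ?case
    using Cons[of "contract v a" b] Cons[of "\<lambda>us. (-1) ^ length us * a us" "contract v b"]
    by (simp add: wedge_Cons c wedge_minus_left wedge_minus_right distrib_left)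
qed (simp add: wedge_Nil)

text \<open>Contracting either side with the first argument gives the same three terms with one argument fewer.\<close>

lemma wedge_assoc: "((a \<and>\<^sub>\<Lambda> b) \<and>\<^sub>\<Lambda> c) = (a \<and>\<^sub>\<Lambda> b \<and>\<^sub>\<Lambda> c)"
proof
  show "((a \<and>\<^sub>\<Lambda> b) \<and>\<^sub>\<Lambda> c) vs = (a \<and>\<^sub>\<Lambda> b \<and>\<^sub>\<Lambda> c) vs" for vs
  proof (induction vs arbitrary: a b c)
    case (Cons v vs)
    show ?case
      by (simp add: wedge_Cons contract_wedge wedge_add_left wedge_add_right parity_wedge Cons)
  qed (simp add: wedge_Nil)
qed

lemma wedge_unit_left:
  fixes b :: "'a form"
  shows "((\<lambda>us. if us = [] then k else 0) \<and>\<^sub>\<Lambda> b) vs = k * b vs"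
proof (induction vs arbitrary: b)
  case (Cons v vs)
  have "contract v (\<lambda>us. if us = [] then k else 0) = (\<lambda>us. 0)"
    by (simp add: contract_def fun_eq_iff)
  moreover have "(\<lambda>us :: 'a list. (-1) ^ length us * (if us = [] then k else 0)) = (\<lambda>us. if us = [] then k else 0)"
    by auto
  ultimately show ?case using Cons[of "contract v b"] by (simp only: wedge_Cons wedge_zero_left) (simp add: contract_def)
qed (simp add: wedge_Nil)

lemma contract_one_form_wedge:
  "contract v (one_form w \<and>\<^sub>\<Lambda> b) = (\<lambda>vs. (w \<bullet> v) * b vs - (one_form w \<and>\<^sub>\<Lambda> contract v b) vs)"
proof -
  have "contract v (one_form w) = (\<lambda>us. if us = [] then w \<bullet> v else 0)"
    by (auto simp: contract_def one_form_def fun_eq_iff split: list.split)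
  moreover have "(\<lambda>us. (-1) ^ length us * one_form w us) = (\<lambda>us. - one_form w us)"
    by (auto simp: one_form_def fun_eq_iff split: list.split)
  ultimately show ?thesis
    by (simp add: contract_wedge wedge_unit_left wedge_minus_left)
qed

lemma wedge_one_form_Cons:
  "(one_form w \<and>\<^sub>\<Lambda> b) (v # vs) = (w \<bullet> v) * b vs - (one_form w \<and>\<^sub>\<Lambda> contract v b) vs"
  using fun_cong[OF contract_one_form_wedge[of v w b], of vs] by (simp add: contract_def[of v "one_form w \<and>\<^sub>\<Lambda> b"])

text \<open>Contracting both 1-forms with the first argument gives expressions that are visibly antisymmetric, up to a
  term of the same shape with one argument fewer.\<close>

lemma one_form_anticommute:
  "(one_form x \<and>\<^sub>\<Lambda> one_form y \<and>\<^sub>\<Lambda> c) vs = - (one_form y \<and>\<^sub>\<Lambda> one_form x \<and>\<^sub>\<Lambda> c) vs"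
proof (induction vs arbitrary: c)
  case Nil
  show ?case by (simp add: wedge_Nil one_form_def)
next
  case (Cons v vs)
  have "(one_form x \<and>\<^sub>\<Lambda> (\<lambda>vs. k * c vs - (one_form y \<and>\<^sub>\<Lambda> d) vs)) us =
      k * (one_form x \<and>\<^sub>\<Lambda> c) us - (one_form x \<and>\<^sub>\<Lambda> one_form y \<and>\<^sub>\<Lambda> d) us" for k x y d us
    using wedge_add_right[of "one_form x" "\<lambda>vs. k * c vs" "\<lambda>vs. - (one_form y \<and>\<^sub>\<Lambda> d) vs"]
    by (simp add: wedge_scale_right wedge_minus_right)
  then show ?case by (simp add: wedge_one_form_Cons contract_one_form_wedge Cons[of "contract v c"])
qed

lemma wedges_swap: "wedges f (xs @ i # j # ys) vs = - wedges f (xs @ j # i # ys) vs"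
proof (induction xs arbitrary: vs)
  case Nil
  show ?case by (simp add: one_form_anticommute[of "f i"])
next
  case (Cons x xs)
  have "wedges f (xs @ i # j # ys) = (\<lambda>vs. - wedges f (xs @ j # i # ys) vs)"
    using Cons by blast
  then show ?case by (simp add: wedge_minus_right)
qed

lemma wedges_not_distinct: "\<not> distinct is \<Longrightarrow> wedges f is vs = 0"
proof -
  assume "\<not> distinct is"
  then obtain xs y ys zs where eq: "is = xs @ [y] @ ys @ [y] @ zs"
    using not_distinct_decomp by blast
  have "wedges f (xs @ y # ys @ y # zs) vs = 0" for vs
  proof (induction ys arbitrary: xs vs)
    case Nil
    show ?case using wedges_swap[of f xs y y zs vs] by simp
  next
    case (Cons w ys)
    show ?case using Cons[of "xs @ [w]"] wedges_swap[of f xs y w "ys @ y # zs" vs] by simp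
  qed
  then show ?thesis using eq by simp
qed

lemma wedges_append: "(wedges f is \<and>\<^sub>\<Lambda> wedges f js) = wedges f (is @ js)"
proof (induction "is")
  case Nil
  show ?case using wedge_unit_left[of 1 "wedges f js"] by (simp add: fun_eq_iff)
qed (simp add: wedge_assoc)

text \<open>A linear combination of basis monomials is given by the list of its coefficients and index lists. Wedge
  products and contractions then become list operations, which simplification can carry out.\<close>

definition lincomb :: "(6 \<Rightarrow> real^6) \<Rightarrow> (real \<times> 6 list) list \<Rightarrow> (real^6) form" where
  "lincomb f L vs = (\<Sum>(c, is)\<leftarrow>L. c * wedges f is vs)"

lemma lincomb_Nil: "lincomb f [] = (\<lambda>vs. 0)"
  and lincomb_Cons: "lincomb f ((c, is) # L) = (\<lambda>vs. c * wedges f is vs + lincomb f L vs)"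
  by (simp_all add: lincomb_def fun_eq_iff)

lemma lincomb_append: "lincomb f (L @ L') vs = lincomb f L vs + lincomb f L' vs"
  by (simp add: lincomb_def)

fun lincomb_wedge :: "(real \<times> 6 list) list \<Rightarrow> (real \<times> 6 list) list \<Rightarrow> (real \<times> 6 list) list" where
  "lincomb_wedge [] L' = []"
| "lincomb_wedge ((c, is) # L) L' = map (\<lambda>(d, js). (c * d, is @ js)) L' @ lincomb_wedge L L'"

lemma wedge_lincomb: "(lincomb f L \<and>\<^sub>\<Lambda> lincomb f L') = lincomb f (lincomb_wedge L L')"
proof (induction L L' rule: lincomb_wedge.induct)
  case (1 L')
  show ?case by (simp add: lincomb_Nil wedge_zero_left)
next
  case (2 c "is" L L')
  have "(wedges f is \<and>\<^sub>\<Lambda> lincomb f L') vs * c = lincomb f (map (\<lambda>(d, js). (c * d, is @ js)) L') vs" for vs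
  proof (induction L')
    case Nil
    show ?case by (simp add: lincomb_Nil wedge_zero_right)
  next
    case (Cons a L')
    then show ?case
      by (cases a) (simp add: lincomb_Cons wedge_add_right wedge_scale_right wedges_append algebra_simps)
  qed
  then show ?case using 2
    by (simp add: fun_eq_iff lincomb_Cons wedge_add_left wedge_scale_left lincomb_append mult.commute)
qed

fun monomial_contract :: "(6 \<Rightarrow> real) \<Rightarrow> 6 list \<Rightarrow> (real \<times> 6 list) list" where
  "monomial_contract x [] = []"
| "monomial_contract x (i # is) = (x i, is) # map (\<lambda>(c, js). (- c, i # js)) (monomial_contract x is)"

fun lincomb_contract :: "(6 \<Rightarrow> real) \<Rightarrow> (real \<times> 6 list) list \<Rightarrow> (real \<times> 6 list) list" where
  "lincomb_contract x [] = []"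
| "lincomb_contract x ((c, is) # L) = map (\<lambda>(d, js). (c * d, js)) (monomial_contract x is) @ lincomb_contract x L"

lemma lincomb_map_scale: "lincomb f (map (\<lambda>(d, js). (c * d, js)) L) vs = c * lincomb f L vs"
  by (induction L) (auto simp: lincomb_Nil lincomb_Cons algebra_simps)

lemma contract_wedges: "contract X (wedges f is) = lincomb f (monomial_contract (\<lambda>i. f i \<bullet> X) is)"
proof (induction "is")
  case Nil
  show ?case by (simp add: contract_def lincomb_Nil fun_eq_iff)
next
  case (Cons i "is")
  have "lincomb f (map (\<lambda>(c, js). (- c, i # js)) L) vs = - (one_form (f i) \<and>\<^sub>\<Lambda> lincomb f L) vs" for L vs
    by (induction L)
       (auto simp: lincomb_Nil lincomb_Cons wedge_zero_right wedge_add_right wedge_scale_right algebra_simps)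
  then show ?case by (simp add: fun_eq_iff contract_one_form_wedge lincomb_Cons Cons)
qed

lemma contract_lincomb: "contract X (lincomb f L) = lincomb f (lincomb_contract (\<lambda>i. f i \<bullet> X) L)"
proof (induction L)
  case Nil
  show ?case by (simp add: lincomb_Nil contract_def fun_eq_iff)
next
  case (Cons a L)
  obtain c "is" where a: "a = (c, is)" by (cases a)
  have "contract X (lincomb f (a # L)) vs = c * contract X (wedges f is) vs + contract X (lincomb f L) vs" for vs
    by (simp add: a lincomb_Cons contract_def)
  then show ?case
    by (simp add: fun_eq_iff a Cons contract_wedges lincomb_append lincomb_map_scale)
qed

definition std_omega :: "(6 \<Rightarrow> real^6) \<Rightarrow> (real^6) form" where
  "std_omega f = lincomb f [(1, [1,2]), (1, [3,4]), (1, [5,6])]"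

definition index_rank :: "6 \<Rightarrow> nat" where
  "index_rank i = (if i = 1 then 1 else if i = 2 then 2 else if i = 3 then 3 else if i = 4 then 4 else if i = 5 then 5 else 6)"

lemma index_rank_simps: "index_rank 1 = 1" "index_rank 2 = 2" "index_rank 3 = 3" "index_rank 4 = 4" "index_rank 5 = 5" "index_rank 6 = 6"
  by (simp_all add: index_rank_def)

lemmas wedges_sort = wedges_swap[of _ "[]", unfolded append.simps]
  wedges_swap[of _ "[a]" for a, unfolded append.simps]
  wedges_swap[of _ "[a,b]" for a b, unfolded append.simps]
  wedges_swap[of _ "[a,b,c]" for a b c, unfolded append.simps]
  wedges_swap[of _ "[a,b,c,d]" for a b c d, unfolded append.simps]

text \<open>Conditional rewriting with these rules is bubble sort of the index list. Sorting goes by \<open>index_rank\<close>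
  because the index \<open>6\<close> is \<open>0\<close> in its type, so that the order of the type is not the intended one.\<close>

lemma wedges_sort_simps:
  "index_rank j < index_rank i \<Longrightarrow> wedges f (i # j # ys) vs = - wedges f (j # i # ys) vs"
  "index_rank j < index_rank i \<Longrightarrow> wedges f (a # i # j # ys) vs = - wedges f (a # j # i # ys) vs"
  "index_rank j < index_rank i \<Longrightarrow> wedges f (a # b # i # j # ys) vs = - wedges f (a # b # j # i # ys) vs"
  "index_rank j < index_rank i \<Longrightarrow> wedges f (a # b # c # i # j # ys) vs = - wedges f (a # b # c # j # i # ys) vs"
  "index_rank j < index_rank i \<Longrightarrow> wedges f (a # b # c # d # i # j # ys) vs = - wedges f (a # b # c # d # j # i # ys) vs"
  by (rule wedges_sort)+

lemma lincomb_eval: "lincomb f [] vs = 0" "lincomb f ((c, is) # L) vs = c * wedges f is vs + lincomb f L vs"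
  by (simp_all add: lincomb_Nil lincomb_Cons)

lemmas lincomb_norm = lincomb_eval wedges_not_distinct wedges_sort_simps index_rank_simps

lemma sympl_vol_std: "sympl_vol (std_omega f) = lincomb f [(1, [1,2,3,4,5,6])]"
  by (rule ext) (simp add: sympl_vol_def std_omega_def wedge_lincomb lincomb_norm fact_numeral del: wedges.simps)

section \<open>Coframes and their dual frames\<close>

lemma UNIV_6: "(UNIV :: 6 set) = {1, 2, 3, 4, 5, 6}"
proof -
  have "card {1, 2, 3, 4, 5, 6 :: 6} = CARD(6)" by simp
  then show ?thesis by (metis card_subset_eq finite subset_UNIV)
qed

lemma forall_6: "(\<forall>i::6. P i) \<longleftrightarrow> P 1 \<and> P 2 \<and> P 3 \<and> P 4 \<and> P 5 \<and> P 6"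
proof -
  have "(\<forall>i. P i) \<longleftrightarrow> (\<forall>i\<in>UNIV. P i)" by simp
  then show ?thesis by (simp only: UNIV_6 ball_simps simp_thms)
qed

lemma sum_6: "sum f (UNIV :: 6 set) = f 1 + f 2 + f 3 + f 4 + f 5 + f 6"
  unfolding UNIV_6 by (simp add: ac_simps)

text \<open>The condition says that the six covectors span the dual space, and hence form a basis of it.\<close>

definition coframe_basis :: "(6 \<Rightarrow> real^6) \<Rightarrow> bool" where
  "coframe_basis f \<longleftrightarrow> (\<forall>Y. (\<forall>i. f i \<bullet> Y = 0) \<longrightarrow> Y = 0)"

definition dual_to :: "(6 \<Rightarrow> real^6) \<Rightarrow> (6 \<Rightarrow> real^6) \<Rightarrow> bool" where
  "dual_to f F \<longleftrightarrow> (\<forall>i j. f i \<bullet> F j = (if i = j then 1 else 0))"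

lemma coframe_basisI_independent:
  assumes "inj f" "independent (range f)"
  shows "coframe_basis f"
  unfolding coframe_basis_def
proof (intro allI impI)
  fix Y assume Y: "\<forall>i. f i \<bullet> Y = 0"
  have "card (range f) = DIM(real^6)"
    using assms(1) by (simp add: card_image)
  then have "span (range f) = UNIV"
    using assms(2) by (metis card_eq_dim dim_UNIV dim_eq_full dim_span finiteI_independent independent_imp_finite subset_UNIV span_superset top.extremum_uniqueI)
  then have "Y \<in> span (range f)" by simp
  moreover have "orthogonal Y x" if "x \<in> range f" for x
    using that Y by (auto simp: orthogonal_def inner_commute)
  ultimately have "orthogonal Y Y" using orthogonal_to_span by blast
  then show "Y = 0" by (simp add: orthogonal_def)
qed

lemma coframe_basis_dual:
  assumes "coframe_basis f"
  obtains F where "dual_to f F"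
proof -
  define L :: "real^6 \<Rightarrow> real^6" where "L X = (\<chi> i. f i \<bullet> X)" for X
  have lin: "linear L" by (rule linearI) (simp_all add: L_def vec_eq_iff inner_add_right)
  have "inj L"
    unfolding linear_injective_0[OF lin] using assms by (auto simp: L_def coframe_basis_def vec_eq_iff)
  then have "surj L" using lin linear_injective_imp_surjective by blast
  then have "L (inv L (axis j 1)) $ i = (axis j 1 :: real^6) $ i" for i j by (simp add: surj_f_inv_f)
  then have "dual_to f (\<lambda>j. inv L (axis j 1))" by (auto simp: dual_to_def L_def axis_def)
  then show thesis by (rule that)
qed

text \<open>Expansion along the first argument: with \<open>wedges_Nil_eval\<close> it evaluates a monomial on a list of vectors.\<close>

lemma wedges_Cons_eval: "wedges f is (v # vs) = lincomb f (monomial_contract (\<lambda>i. f i \<bullet> v) is) vs"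
  using fun_cong[OF contract_wedges[of v f "is"]] by (simp add: contract_def)

lemma wedges_Nil_eval: "wedges f [] [] = 1" "wedges f (i # is) [] = 0"
  by (simp_all add: wedge_Nil one_form_def)

text \<open>The values on lists of other lengths are needed because the tensors of a 3-form are characterized by
  identities over all lists of arguments.\<close>

lemma wedges_length: "length vs \<noteq> length is \<Longrightarrow> wedges f is vs = 0"
proof (induction "is" arbitrary: vs)
  case (Cons i "is")
  then show ?case by (auto simp: wedge_one_form intro!: sum.neutral)
qed auto

lemmas wedges_eval = wedges_Cons_eval wedges_Nil_eval lincomb_eval

lemma dual_to_simps:
  assumes "dual_to f F"
  shows "f i \<bullet> F i = 1" "i \<noteq> j \<Longrightarrow> f i \<bullet> F j = 0"
  using assms by (auto simp: dual_to_def)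

lemma wedge_one_form_kills: "(\<And>v. v \<in> set vs \<Longrightarrow> w \<bullet> v = 0) \<Longrightarrow> (one_form w \<and>\<^sub>\<Lambda> b) vs = 0"
  by (auto simp: wedge_one_form intro!: sum.neutral)

lemma wedges_dual_kill: "\<forall>v\<in>set vs. f i \<bullet> v = 0 \<Longrightarrow> wedges f (i # is) vs = 0"
  by (simp add: wedge_one_form_kills)

lemma contract_dual_notin:
  assumes "dual_to f F" "i \<notin> set is"
  shows "contract (F i) (wedges f is) = (\<lambda>vs. 0)"
  using assms(2)
proof (induction "is")
  case Nil
  then show ?case by (simp add: contract_def)
next
  case (Cons j "is")
  show ?case
  proof -
    have "f j \<bullet> F i = 0" using Cons.prems by (intro dual_to_simps(2)[OF assms(1)]) auto
    then show ?thesis using Cons by (simp add: contract_one_form_wedge wedge_zero_right)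
  qed
qed

lemma wedges_dual_notin: "dual_to f F \<Longrightarrow> i \<notin> set is \<Longrightarrow> wedges f is (F i # vs) = 0"
  using contract_dual_notin[of f F i "is"] by (simp add: contract_def fun_eq_iff)

lemma wedges_dual_same:
  assumes "dual_to f F" "i \<notin> set is"
  shows "wedges f (i # is) (F i # vs) = wedges f is vs"
  using contract_dual_notin[OF assms]
  by (simp add: wedge_one_form_Cons dual_to_simps[OF assms(1)] wedge_zero_right)

lemma vol_dual:
  assumes "dual_to f F"
  shows "sympl_vol (std_omega f) [F 1, F 2, F 3, F 4, F 5, F 6] = 1"
  by (simp add: sympl_vol_std lincomb_eval wedges_dual_same[OF assms] del: wedges.simps(2))

text \<open>Omitting one vector of the dual frame isolates one component of \<open>Y\<close>. Hence the volume form is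
  nondegenerate, and an endomorphism is determined by its contraction into it.\<close>

lemma vol_component:
  assumes "dual_to f F"
  shows
    "contract Y (sympl_vol (std_omega f)) [F 2, F 3, F 4, F 5, F 6] = f 1 \<bullet> Y"
    "contract Y (sympl_vol (std_omega f)) [F 1, F 3, F 4, F 5, F 6] = - (f 2 \<bullet> Y)"
    "contract Y (sympl_vol (std_omega f)) [F 1, F 2, F 4, F 5, F 6] = f 3 \<bullet> Y"
    "contract Y (sympl_vol (std_omega f)) [F 1, F 2, F 3, F 5, F 6] = - (f 4 \<bullet> Y)"
    "contract Y (sympl_vol (std_omega f)) [F 1, F 2, F 3, F 4, F 6] = f 5 \<bullet> Y"
    "contract Y (sympl_vol (std_omega f)) [F 1, F 2, F 3, F 4, F 5] = - (f 6 \<bullet> Y)"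
  by (simp_all add: sympl_vol_std contract_lincomb lincomb_eval wedges_dual_same[OF assms] wedges_dual_notin[OF assms] wedges_dual_kill dual_to_simps[OF assms] del: wedges.simps(2))

text \<open>The defining relation of \<open>K\<close> for a candidate \<open>A\<close>; it allows the computation of \<open>K\<close> without the description
  operator.\<close>

definition K_rel :: "(real^6) form \<Rightarrow> (real^6) form \<Rightarrow> real^6^6 \<Rightarrow> bool" where
  "K_rel \<omega> \<phi> A \<longleftrightarrow> (\<forall>X vs. contract (A *v X) (sympl_vol \<omega>) vs = - (contract X \<phi> \<and>\<^sub>\<Lambda> \<phi>) vs)"

lemma K_endo_eqI:
  assumes "coframe_basis f" "K_rel (std_omega f) \<phi> A"
  shows "K_endo (std_omega f) \<phi> = A"
proof -
  obtain F where F: "dual_to f F" using coframe_basis_dual[OF assms(1)] by blast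
  show ?thesis unfolding K_endo_def
  proof (rule the_equality)
    fix B
    assume B: "\<forall>X vs. contract (B *v X) (sympl_vol (std_omega f)) vs = - (contract X \<phi> \<and>\<^sub>\<Lambda> \<phi>) vs"
    have eq: "contract (B *v X) (sympl_vol (std_omega f)) vs = contract (A *v X) (sympl_vol (std_omega f)) vs" for X vs
      using B assms(2) by (simp add: K_rel_def)
    have "f i \<bullet> (B *v X) = f i \<bullet> (A *v X)" for i X
    proof -
      have "\<forall>i. f i \<bullet> (B *v X) = f i \<bullet> (A *v X)"
        unfolding forall_6 by (metis eq vol_component[OF F] neg_equal_iff_equal)
      then show ?thesis by blast
    qed
    then have "\<forall>i. f i \<bullet> (B *v X - A *v X) = 0" for X by (simp add: inner_diff_right)
    then have "B *v X - A *v X = 0" for X using assms(1) unfolding coframe_basis_def by blast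
    then show "B = A" by (simp add: matrix_eq)
  qed (use assms(2) in \<open>simp add: K_rel_def\<close>)
qed

section \<open>The tensors of the model form and of the ansatz\<close>

text \<open>This is \<open>\<mu>\<close> times the real part of \<open>(f\<^sup>1 + i f\<^sup>2) \<and> (f\<^sup>3 + i f\<^sup>4) \<and> (f\<^sup>5 + i f\<^sup>6)\<close>.\<close>

definition model_form :: "real \<Rightarrow> (6 \<Rightarrow> real^6) \<Rightarrow> (real^6) form" where
  "model_form \<mu> f = lincomb f [(\<mu>, [1,3,5]), (- \<mu>, [1,4,6]), (- \<mu>, [2,3,6]), (- \<mu>, [2,4,5])]"

definition ansatz :: "real \<Rightarrow> real \<Rightarrow> real \<Rightarrow> real \<Rightarrow> real \<Rightarrow> real \<Rightarrow> (6 \<Rightarrow> real^6) \<Rightarrow> (real^6) form" where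
  "ansatz M N \<alpha> \<beta> \<gamma> \<delta> f = lincomb f [(\<alpha>, [1,3,5]), (\<alpha>, [1,3,6]), (\<beta>, [1,4,5]), (- \<beta>, [1,4,6]),
     (\<gamma>, [2,3,5]), (- \<gamma>, [2,3,6]), (- \<delta>, [2,4,5]), (- \<delta>, [2,4,6]),
     (M, [5,1,2]), (- M, [5,3,4]), (N, [6,1,2]), (- N, [6,3,4])]"

text \<open>The matrix \<open>A\<close> acts on the frame dual to \<open>f\<close> as multiplication by the imaginary unit on each of the three
  planes.\<close>

definition std_J :: "(6 \<Rightarrow> real^6) \<Rightarrow> real^6^6 \<Rightarrow> bool" where
  "std_J f A \<longleftrightarrow> (\<forall>X. f 1 \<bullet> (A *v X) = - (f 2 \<bullet> X) \<and> f 2 \<bullet> (A *v X) = f 1 \<bullet> X \<and>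
     f 3 \<bullet> (A *v X) = - (f 4 \<bullet> X) \<and> f 4 \<bullet> (A *v X) = f 3 \<bullet> X \<and>
     f 5 \<bullet> (A *v X) = - (f 6 \<bullet> X) \<and> f 6 \<bullet> (A *v X) = f 5 \<bullet> X)"

lemma K_rel_model:
  assumes "std_J f A"
  shows "K_rel (std_omega f) (model_form \<mu> f) ((2 * \<mu>\<^sup>2) *\<^sub>R A)"
proof -
  have 1: "contract X (model_form \<mu> f) = lincomb f [(\<mu> * (f 1 \<bullet> X), [3,5]), (- \<mu> * (f 1 \<bullet> X), [4,6]),
    (- \<mu> * (f 2 \<bullet> X), [3,6]), (- \<mu> * (f 2 \<bullet> X), [4,5]), (- \<mu> * (f 3 \<bullet> X), [1,5]), (\<mu> * (f 3 \<bullet> X), [2,6]),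
    (\<mu> * (f 4 \<bullet> X), [1,6]), (\<mu> * (f 4 \<bullet> X), [2,5]), (\<mu> * (f 5 \<bullet> X), [1,3]), (- \<mu> * (f 5 \<bullet> X), [2,4]),
    (- \<mu> * (f 6 \<bullet> X), [1,4]), (- \<mu> * (f 6 \<bullet> X), [2,3])]" for X
    by (rule ext) (simp add: model_form_def contract_lincomb lincomb_eval algebra_simps del: wedges.simps)
  have 2: "(contract X (model_form \<mu> f) \<and>\<^sub>\<Lambda> model_form \<mu> f) vs = 
     2 * \<mu>\<^sup>2 * ((f 1 \<bullet> X) * wedges f [1,3,4,5,6] vs + (f 2 \<bullet> X) * wedges f [2,3,4,5,6] vs
      + (f 3 \<bullet> X) * wedges f [1,2,3,5,6] vs + (f 4 \<bullet> X) * wedges f [1,2,4,5,6] vs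
      + (f 5 \<bullet> X) * wedges f [1,2,3,4,5] vs + (f 6 \<bullet> X) * wedges f [1,2,3,4,6] vs)" for X vs
    unfolding 1 unfolding model_form_def wedge_lincomb
    by (simp add: lincomb_norm power2_eq_square del: wedges.simps) (simp add: distrib_left)
  have 3: "contract (((2 * \<mu>\<^sup>2) *\<^sub>R A) *v X) (sympl_vol (std_omega f)) vs = 
   - (2 * \<mu>\<^sup>2 * ((f 1 \<bullet> X) * wedges f [1,3,4,5,6] vs + (f 2 \<bullet> X) * wedges f [2,3,4,5,6] vs
      + (f 3 \<bullet> X) * wedges f [1,2,3,5,6] vs + (f 4 \<bullet> X) * wedges f [1,2,4,5,6] vs
      + (f 5 \<bullet> X) * wedges f [1,2,3,4,5] vs + (f 6 \<bullet> X) * wedges f [1,2,3,4,6] vs))" for X vs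
    using assms unfolding sympl_vol_std contract_lincomb std_J_def
    by (simp only: scaleR_matrix_vector_assoc[symmetric] inner_scaleR_right) (simp add: lincomb_eval distrib_left del: wedges.simps)
  show ?thesis unfolding K_rel_def 2 3 by simp
qed

lemma std_J_exists:
  assumes "coframe_basis f"
  obtains A where "std_J f A"
proof -
  obtain F where F: "dual_to f F" using coframe_basis_dual[OF assms] by blast
  define J where "J X = - (f 2 \<bullet> X) *\<^sub>R F 1 + (f 1 \<bullet> X) *\<^sub>R F 2 - (f 4 \<bullet> X) *\<^sub>R F 3 + (f 3 \<bullet> X) *\<^sub>R F 4
     - (f 6 \<bullet> X) *\<^sub>R F 5 + (f 5 \<bullet> X) *\<^sub>R F 6" for X
  have "linear J"
    by (rule linearI) (simp_all add: J_def inner_add_right algebra_simps)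
  then have "matrix J *v X = J X" for X by (simp add: matrix_works)
  then have "std_J f (matrix J)"
    by (simp add: std_J_def J_def inner_add_right inner_diff_right dual_to_simps[OF F])
  then show thesis by (rule that)
qed

text \<open>Applying \<open>J\<close> to one argument multiplies a complex volume form by \<open>i\<close>, so \<open>F\<close> is \<open>4 \<mu>\<^sup>3\<close> times its imaginary
  part.\<close>

lemma F_form_model:
  assumes "coframe_basis f" "std_J f A"
  shows "F_form (std_omega f) (model_form \<mu> f) =
    lincomb f [(4 * \<mu> ^ 3, [1,3,6]), (4 * \<mu> ^ 3, [1,4,5]), (4 * \<mu> ^ 3, [2,3,5]), (- 4 * \<mu> ^ 3, [2,4,6])]"
    (is "?F = ?G")
proof
  fix vs
  have K: "K_endo (std_omega f) (model_form \<mu> f) *v X = (2 * \<mu>\<^sup>2) *\<^sub>R (A *v X)" for X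
    using K_endo_eqI[OF assms(1) K_rel_model[OF assms(2)]] by (simp flip: scaleR_matrix_vector_assoc)
  show "?F vs = ?G vs"
  proof (cases "length vs = 3")
    case True
    then obtain X Y Z where vs: "vs = [X, Y, Z]" by (auto simp: length_Suc_conv numeral_3_eq_3)
    have "?F vs = - 2 * contract ((2 * \<mu>\<^sup>2) *\<^sub>R (A *v X)) (model_form \<mu> f) [Y, Z]"
      by (simp add: vs F_form_def K contract_def)
    also have "\<dots> = contract X ?G [Y, Z]"
      using assms(2) unfolding model_form_def contract_lincomb std_J_def inner_scaleR_right
      by (simp add: lincomb_eval del: wedges.simps) (simp add: power2_eq_square power3_eq_cube algebra_simps del: wedges.simps)
    finally show ?thesis by (simp add: vs contract_def)
  next
    case False
    then have "?G vs = 0" by (simp add: lincomb_eval wedges_length del: wedges.simps)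
    moreover have "?F vs = 0" using False by (auto simp: F_form_def split: list.split)
    ultimately show ?thesis by simp
  qed
qed

lemma Q_inv_model:
  assumes "coframe_basis f"
  shows "Q_inv (std_omega f) (model_form \<mu> f) = - 16 * \<mu> ^ 4"
proof -
  obtain A where A: "std_J f A" using std_J_exists[OF assms] by blast
  obtain F where F: "dual_to f F" using coframe_basis_dual[OF assms] by blast
  have *: "(model_form \<mu> f \<and>\<^sub>\<Lambda> F_form (std_omega f) (model_form \<mu> f)) vs = 16 * \<mu> ^ 4 * sympl_vol (std_omega f) vs" for vs
    unfolding F_form_model[OF assms A] sympl_vol_std
    by (simp add: model_form_def wedge_lincomb lincomb_norm algebra_simps eval_nat_numeral del: wedges.simps)
  show ?thesis unfolding Q_inv_def
  proof (rule the_equality)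
    fix q
    assume "\<forall>vs. (model_form \<mu> f \<and>\<^sub>\<Lambda> F_form (std_omega f) (model_form \<mu> f)) vs = - q * sympl_vol (std_omega f) vs"
    from this[rule_format, of "[F 1, F 2, F 3, F 4, F 5, F 6]"] show "q = - 16 * \<mu> ^ 4"
      unfolding * vol_dual[OF F] by simp
  qed (simp add: *)
qed

lemma J_endo_model:
  assumes "coframe_basis f" "\<mu> \<noteq> 0" "std_J f A"
  shows "J_endo (std_omega f) (model_form \<mu> f) = A"
proof -
  have "- (- 16 * \<mu> ^ 4) / 4 = (2 * \<mu>\<^sup>2)\<^sup>2" by (simp add: power_mult_distrib flip: power_mult)
  then have "sqrt (- Q_inv (std_omega f) (model_form \<mu> f) / 4) = 2 * \<mu>\<^sup>2"
    unfolding Q_inv_model[OF assms(1)] by (simp only: real_sqrt_abs) simp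
  moreover have "K_endo (std_omega f) (model_form \<mu> f) = (2 * \<mu>\<^sup>2) *\<^sub>R A"
    using K_endo_eqI[OF assms(1) K_rel_model[OF assms(3)]] .
  ultimately show ?thesis using assms(2) by (simp add: J_endo_def)
qed

lemma std_omega_pair:
  "std_omega f [X, Y] = (f 1 \<bullet> X) * (f 2 \<bullet> Y) - (f 2 \<bullet> X) * (f 1 \<bullet> Y)
     + (f 3 \<bullet> X) * (f 4 \<bullet> Y) - (f 4 \<bullet> X) * (f 3 \<bullet> Y) + (f 5 \<bullet> X) * (f 6 \<bullet> Y) - (f 6 \<bullet> X) * (f 5 \<bullet> Y)"
  by (simp add: std_omega_def wedges_eval algebra_simps del: wedges.simps)

text \<open>This is the information that the orbit condition provides for the ansatz. In the model frame \<open>K = 2 \<mu>\<^sup>2 J\<close>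
  and \<open>\<omega>(X, KX)\<close> is a multiple of the sum of the squared components of \<open>X\<close>. The statement does not mention the model
  frame any more and can be evaluated in another coframe.\<close>

lemma orbit_K_positive:
  assumes "\<mu> > 0" "orbit_minus_plus \<mu> \<omega> \<phi>"
  obtains A where "K_rel \<omega> \<phi> A" "\<And>X. X \<noteq> 0 \<Longrightarrow> \<omega> [X, A *v X] > 0"
proof -
  obtain f where f: "inj f" "independent (range f)" "\<omega> = std_omega f" "\<phi> = model_form \<mu> f"
    using assms(2) unfolding orbit_minus_plus_def std_omega_def model_form_def
    by (auto simp: lincomb_eval fun_eq_iff algebra_simps simp del: wedges.simps)
  then have b: "coframe_basis f" by (simp add: coframe_basisI_independent)
  obtain A where A: "std_J f A" using std_J_exists[OF b] by blast
  show thesis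
  proof (rule that[of "(2 * \<mu>\<^sup>2) *\<^sub>R A"])
    show "K_rel \<omega> \<phi> ((2 * \<mu>\<^sup>2) *\<^sub>R A)" using K_rel_model[OF A] f by simp
    fix X :: "real^6" assume "X \<noteq> 0"
    then obtain i where i: "f i \<bullet> X \<noteq> 0" using b unfolding coframe_basis_def by blast
    have "\<omega> [X, ((2 * \<mu>\<^sup>2) *\<^sub>R A) *v X] = 2 * \<mu>\<^sup>2 * (\<Sum>i\<in>UNIV. (f i \<bullet> X)\<^sup>2)"
      using A by (simp add: f std_omega_pair std_J_def sum_6 power2_eq_square algebra_simps flip: scaleR_matrix_vector_assoc)
    moreover have "(\<Sum>i\<in>UNIV. (f i \<bullet> X)\<^sup>2) > 0"
      by (rule sum_pos2[of _ i]) (use i in auto)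
    ultimately show "\<omega> [X, ((2 * \<mu>\<^sup>2) *\<^sub>R A) *v X] > 0" using assms(1) by simp
  qed
qed

text \<open>Only the entries of \<open>K\<close> are listed whose positivity properties give the constraints on the coefficients.
  Each of them is one value of the 5-form \<open>\<iota>\<^sub>X\<phi> \<and> \<phi>\<close> on five vectors of the dual frame.\<close>

lemma K_components_ansatz:
  assumes F: "dual_to f F" and K: "K_rel (std_omega f) (ansatz M N \<alpha> \<beta> \<gamma> \<delta> f) A"
  shows "f 2 \<bullet> (A *v F 1) = 4 * \<alpha> * \<beta>" "f 1 \<bullet> (A *v F 2) = - 4 * \<gamma> * \<delta>" "f 4 \<bullet> (A *v F 3) = 4 * \<alpha> * \<gamma>"
    "f 5 \<bullet> (A *v F 5) = 2 * (\<beta> * \<gamma> - \<alpha> * \<delta> + M * N)" "f 6 \<bullet> (A *v F 5) = 2 * (\<alpha> * \<delta> + \<beta> * \<gamma> - M\<^sup>2)"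
    "f 5 \<bullet> (A *v F 6) = 2 * (N\<^sup>2 - \<alpha> * \<delta> - \<beta> * \<gamma>)" "f 6 \<bullet> (A *v F 6) = 2 * (\<alpha> * \<delta> - \<beta> * \<gamma> - M * N)"
proof -
  have *: "contract (A *v X) (sympl_vol (std_omega f)) vs =
      - lincomb f (lincomb_wedge L [(\<alpha>, [1,3,5]), (\<alpha>, [1,3,6]), (\<beta>, [1,4,5]), (- \<beta>, [1,4,6]),
     (\<gamma>, [2,3,5]), (- \<gamma>, [2,3,6]), (- \<delta>, [2,4,5]), (- \<delta>, [2,4,6]),
     (M, [5,1,2]), (- M, [5,3,4]), (N, [6,1,2]), (- N, [6,3,4])]) vs"
    if "contract X (ansatz M N \<alpha> \<beta> \<gamma> \<delta> f) = lincomb f L" for X L vs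
  proof -
    have "contract (A *v X) (sympl_vol (std_omega f)) vs = - (lincomb f L \<and>\<^sub>\<Lambda> ansatz M N \<alpha> \<beta> \<gamma> \<delta> f) vs"
      using K that by (simp add: K_rel_def)
    then show ?thesis by (simp only: ansatz_def wedge_lincomb)
  qed
  note dual = wedges_dual_same[OF F] wedges_dual_notin[OF F] wedges_dual_kill dual_to_simps[OF F]
  note comps = vol_component[OF F]
  have "contract (F 1) (ansatz M N \<alpha> \<beta> \<gamma> \<delta> f) = lincomb f [(\<alpha>, [3,5]), (\<alpha>, [3,6]), (\<beta>, [4,5]), (- \<beta>, [4,6]), (M, [2,5]), (N, [2,6])]"
    by (rule ext) (simp add: ansatz_def contract_lincomb lincomb_norm dual_to_simps[OF F] del: wedges.simps)
  note E1 = *[OF this]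
  have "contract (F 2) (ansatz M N \<alpha> \<beta> \<gamma> \<delta> f) = lincomb f [(\<gamma>, [3,5]), (- \<gamma>, [3,6]), (- \<delta>, [4,5]), (- \<delta>, [4,6]), (- M, [1,5]), (- N, [1,6])]"
    by (rule ext) (simp add: ansatz_def contract_lincomb lincomb_norm dual_to_simps[OF F] del: wedges.simps)
  note E2 = *[OF this]
  have "contract (F 3) (ansatz M N \<alpha> \<beta> \<gamma> \<delta> f) = lincomb f [(- \<alpha>, [1,5]), (- \<alpha>, [1,6]), (- \<gamma>, [2,5]), (\<gamma>, [2,6]), (- M, [4,5]), (- N, [4,6])]"
    by (rule ext) (simp add: ansatz_def contract_lincomb lincomb_norm dual_to_simps[OF F] del: wedges.simps)
  note E3 = *[OF this]
  have "contract (F 5) (ansatz M N \<alpha> \<beta> \<gamma> \<delta> f) = lincomb f [(\<alpha>, [1,3]), (\<beta>, [1,4]), (\<gamma>, [2,3]), (- \<delta>, [2,4]), (M, [1,2]), (- M, [3,4])]"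
    by (rule ext) (simp add: ansatz_def contract_lincomb lincomb_norm dual_to_simps[OF F] del: wedges.simps)
  note E5 = *[OF this]
  have "contract (F 6) (ansatz M N \<alpha> \<beta> \<gamma> \<delta> f) = lincomb f [(\<alpha>, [1,3]), (- \<beta>, [1,4]), (- \<gamma>, [2,3]), (- \<delta>, [2,4]), (N, [1,2]), (- N, [3,4])]"
    by (rule ext) (simp add: ansatz_def contract_lincomb lincomb_norm dual_to_simps[OF F] del: wedges.simps)
  note E6 = *[OF this]
  show "f 2 \<bullet> (A *v F 1) = 4 * \<alpha> * \<beta>"
    using comps(2)[of "A *v F 1"] E1[of "[F 1, F 3, F 4, F 5, F 6]"]
    by (simp add: lincomb_norm dual power2_eq_square algebra_simps del: wedges.simps(2))
  show "f 1 \<bullet> (A *v F 2) = - 4 * \<gamma> * \<delta>"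
    using comps(1)[of "A *v F 2"] E2[of "[F 2, F 3, F 4, F 5, F 6]"]
    by (simp add: lincomb_norm dual power2_eq_square algebra_simps del: wedges.simps(2))
  show "f 4 \<bullet> (A *v F 3) = 4 * \<alpha> * \<gamma>"
    using comps(4)[of "A *v F 3"] E3[of "[F 1, F 2, F 3, F 5, F 6]"]
    by (simp add: lincomb_norm dual power2_eq_square algebra_simps del: wedges.simps(2))
  show "f 5 \<bullet> (A *v F 5) = 2 * (\<beta> * \<gamma> - \<alpha> * \<delta> + M * N)"
    using comps(5)[of "A *v F 5"] E5[of "[F 1, F 2, F 3, F 4, F 6]"]
    by (simp add: lincomb_norm dual power2_eq_square algebra_simps del: wedges.simps(2))
  show "f 6 \<bullet> (A *v F 5) = 2 * (\<alpha> * \<delta> + \<beta> * \<gamma> - M\<^sup>2)"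
    using comps(6)[of "A *v F 5"] E5[of "[F 1, F 2, F 3, F 4, F 5]"]
    by (simp add: lincomb_norm dual power2_eq_square algebra_simps del: wedges.simps(2))
  show "f 5 \<bullet> (A *v F 6) = 2 * (N\<^sup>2 - \<alpha> * \<delta> - \<beta> * \<gamma>)"
    using comps(5)[of "A *v F 6"] E6[of "[F 1, F 2, F 3, F 4, F 6]"]
    by (simp add: lincomb_norm dual power2_eq_square algebra_simps del: wedges.simps(2))
  show "f 6 \<bullet> (A *v F 6) = 2 * (\<alpha> * \<delta> - \<beta> * \<gamma> - M * N)"
    using comps(6)[of "A *v F 6"] E6[of "[F 1, F 2, F 3, F 4, F 5]"]
    by (simp add: lincomb_norm dual power2_eq_square algebra_simps del: wedges.simps(2))
qed

lemma omega_eq: "omega p = std_omega (coframe p)"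
  by (simp add: omega_def std_omega_def lincomb_eval fun_eq_iff del: wedges.simps)

lemma one_form_linear: "one_form (a *\<^sub>R v + b *\<^sub>R w) = (\<lambda>vs. a * one_form v vs + b * one_form w vs)"
  by (auto simp: one_form_def fun_eq_iff inner_add_left split: list.split)

lemma phi_eq: "phi M N \<alpha> \<beta> \<gamma> \<delta> p = ansatz M N \<alpha> \<beta> \<gamma> \<delta> (coframe p)"
proof
  fix vs
  let ?e = "coframe p"
  have wk: "(one_form (?e k) \<and>\<^sub>\<Lambda> (\<lambda>us. wedges ?e [1,2] us - wedges ?e [3,4] us)) vs = wedges ?e [k,1,2] vs - wedges ?e [k,3,4] vs" for k
    using wedge_add_right[of "one_form (?e k)" "wedges ?e [1,2]" "\<lambda>us. - wedges ?e [3,4] us"]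
    by (simp add: wedge_minus_right)
  show "phi M N \<alpha> \<beta> \<gamma> \<delta> p vs = ansatz M N \<alpha> \<beta> \<gamma> \<delta> ?e vs"
    by (simp add: phi_def Let_def ansatz_def lincomb_eval one_form_linear wedge_add_left wedge_scale_left wk
        del: wedges.simps) (simp add: algebra_simps del: wedges.simps)
qed

lemma coframe_basis_coframe: "coframe_basis (coframe p)"
  by (auto simp: coframe_basis_def coframe_def inner_axis' vec_eq_iff)

text \<open>The quadratic form \<open>\<omega>(X, KX)\<close> is positive definite. Its first three diagonal entries are \<open>4\<alpha>\<beta>\<close>, \<open>4\<gamma>\<delta>\<close>,
  \<open>4\<alpha>\<gamma>\<close>, and the last inequality is the positivity of the determinant of its block in the directions \<open>5\<close>, \<open>6\<close>.\<close>

lemma orbit_constraints: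
  assumes b: "coframe_basis f" and \<mu>: "\<mu> > 0"
    and orbit: "orbit_minus_plus \<mu> (std_omega f) (ansatz M N \<alpha> \<beta> \<gamma> \<delta> f)"
  shows "\<alpha> * \<beta> > 0" "\<gamma> * \<delta> > 0" "\<alpha> * \<gamma> > 0"
    "4 * \<alpha> * \<beta> * \<gamma> * \<delta> > \<alpha> * \<delta> * (M - N)\<^sup>2 + \<beta> * \<gamma> * (M + N)\<^sup>2"
proof -
  obtain A where K: "K_rel (std_omega f) (ansatz M N \<alpha> \<beta> \<gamma> \<delta> f) A"
    and pos: "\<And>X. X \<noteq> 0 \<Longrightarrow> std_omega f [X, A *v X] > 0"
    using orbit_K_positive[OF \<mu> orbit] by blast
  obtain F where F: "dual_to f F" using coframe_basis_dual[OF b] by blast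
  note d = dual_to_simps[OF F] and k = K_components_ansatz[OF F K]
  have ne: "F i \<noteq> 0" for i using d(1)[of i] by auto
  show "\<alpha> * \<beta> > 0" using pos[OF ne[of 1]] by (simp add: std_omega_pair d k)
  show "\<gamma> * \<delta> > 0" using pos[OF ne[of 2]] by (simp add: std_omega_pair d k mult.commute)
  show "\<alpha> * \<gamma> > 0" using pos[OF ne[of 3]] by (simp add: std_omega_pair d k)
  define p q r where "p = 2 * (\<alpha> * \<delta> + \<beta> * \<gamma> - M\<^sup>2)" and "q = 2 * (\<beta> * \<gamma> - \<alpha> * \<delta> + M * N)"
    and "r = 2 * (\<alpha> * \<delta> + \<beta> * \<gamma> - N\<^sup>2)"
  have k': "f 6 \<bullet> (A *v F 5) = p" "f 5 \<bullet> (A *v F 5) = q" "f 5 \<bullet> (A *v F 6) = - r" "f 6 \<bullet> (A *v F 6) = - q"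
    by (simp_all add: k p_def q_def r_def)
  have p: "p > 0" using pos[OF ne[of 5]] by (simp add: std_omega_pair d k')
  \<comment> \<open>This vector makes the quadratic form equal to \<open>p\<close> times the determinant of the block.\<close>
  define X where "X = q *\<^sub>R F 5 + p *\<^sub>R F 6"
  have "f 6 \<bullet> X = p" by (simp add: X_def inner_add_right d)
  then have "X \<noteq> 0" using p by auto
  moreover have "std_omega f [X, A *v X] = p * (p * r - q\<^sup>2)"
    by (simp add: std_omega_pair X_def inner_add_right matrix_vector_right_distrib matrix_vector_mult_scaleR d k'
        power2_eq_square algebra_simps)
  ultimately have "p * (p * r - q\<^sup>2) > 0" using pos[of X] by simp
  then have "p * r - q\<^sup>2 > 0" using p by (simp add: zero_less_mult_iff)
  moreover have "p * r - q\<^sup>2 = 4 * (4 * \<alpha> * \<beta> * \<gamma> * \<delta> - \<alpha> * \<delta> * (M - N)\<^sup>2 - \<beta> * \<gamma> * (M + N)\<^sup>2)"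
    by (simp add: p_def q_def r_def power2_eq_square algebra_simps)
  ultimately show "4 * \<alpha> * \<beta> * \<gamma> * \<delta> > \<alpha> * \<delta> * (M - N)\<^sup>2 + \<beta> * \<gamma> * (M + N)\<^sup>2" by simp
qed

section \<open>The planar system\<close>

lemma increasing_if_deriv_pos:
  fixes f f' :: "real \<Rightarrow> real"
  assumes "\<And>x. x > l \<Longrightarrow> (f has_real_derivative f' x) (at x)" "\<And>x. x > l \<Longrightarrow> f' x > 0"
    and "l < x" "x < y"
  shows "f x < f y"
proof (rule DERIV_pos_imp_increasing[OF assms(4)])
  fix z assume "x \<le> z" "z \<le> y"
  then have "l < z" using assms(3) by simp
  then show "\<exists>d. (f has_real_derivative d) (at z) \<and> 0 < d" using assms(1,2) by blast
qed

text \<open>Every inverse function of the section arises from this lemma. Half-lines that are open at the left end make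
  the derivative of the inverse two-sided also at the initial value.\<close>

lemma increasing_inverse:
  fixes f f' :: "real \<Rightarrow> real"
  assumes deriv: "\<And>x. x > l \<Longrightarrow> (f has_real_derivative f' x) (at x)"
    and pos: "\<And>x. x > l \<Longrightarrow> f' x > 0"
  obtains g where "\<And>x. x > l \<Longrightarrow> g (f x) = x"
    "\<And>x. x > l \<Longrightarrow> (g has_real_derivative inverse (f' x)) (at (f x))"
proof -
  have mono: "f x < f y" if "l < x" "x < y" for x y
    using deriv pos that by (rule increasing_if_deriv_pos)
  have "inj_on f {l<..}"
  proof (rule inj_onI)
    fix x y assume "x \<in> {l<..}" "y \<in> {l<..}" "f x = f y"
    then show "x = y" using mono[of x y] mono[of y x] by (cases x y rule: linorder_cases) auto
  qed
  then have inv: "inv_into {l<..} f (f x) = x" if "x > l" for x using that by simp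
  have cont: "continuous_on {l<..} f"
    by (intro continuous_at_imp_continuous_on ballI DERIV_isCont[OF deriv]) simp
  have "(inv_into {l<..} f has_real_derivative inverse (f' x)) (at (f x))" if "x > l" for x
    unfolding has_field_derivative_def
    by (rule has_derivative_inverse_strong[OF open_greaterThan _ cont _ deriv[OF that, unfolded has_field_derivative_def]])
       (use that pos[OF that] inv in auto)
  with inv show thesis by (rule that)
qed

lemma antiderivative_exists:
  fixes f :: "real \<Rightarrow> real"
  assumes "continuous_on {l..} f"
  obtains F where "\<And>x. x > l \<Longrightarrow> (F has_real_derivative f x) (at x)"
proof
  fix x assume x: "x > l"
  have "((\<lambda>u. integral {l..u} f) has_real_derivative f x) (at x within {l..x + 1})"
    by (rule integral_has_real_derivative) (use x assms in \<open>auto intro: continuous_on_subset\<close>)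
  then show "((\<lambda>u. integral {l..u} f) has_real_derivative f x) (at x)"
    using x by (simp add: at_within_Icc_at)
qed

lemma zero_derivative_constant:
  fixes f :: "real \<Rightarrow> real"
  assumes "\<And>t. t \<in> {0..<T} \<Longrightarrow> (f has_real_derivative 0) (at t within {0..<T})" "t \<in> {0..<T}"
  shows "f t = f 0"
proof -
  have "\<exists>c. \<forall>x\<in>{0..<T}. f x = c"
    by (rule has_field_derivative_zero_constant) (use assms in auto)
  then show ?thesis using assms(2) by force
qed

text \<open>For a trajectory \<open>(x, y)\<close> of the planar system below, \<open>energy R x - energy P y\<close> is a first integral.\<close>

definition energy :: "real \<Rightarrow> real \<Rightarrow> real" where "energy R x = x - R * ln x"

lemma energy_deriv:
  assumes "x > 0"
  shows "(energy R has_real_derivative (x - R) / x) (at x)"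
  unfolding energy_def using assms by (auto intro!: derivative_eq_intros simp: field_simps)

text \<open>The inverse \<open>g\<close> solves \<open>g' = g / (g - R)\<close> with \<open>g 0 = x0\<close>. It is defined slightly to the left of \<open>0\<close>, and it
  grows at least linearly because \<open>x\<close> exceeds \<open>energy R x\<close> by \<open>R ln x\<close>, which increases.\<close>

lemma energy_inverse:
  assumes "R \<ge> 0" "x0 > R"
  obtains g \<epsilon> where "\<epsilon> > 0" "\<And>x. x > R \<Longrightarrow> g (energy R x - energy R x0) = x"
    "\<And>s. s > -\<epsilon> \<Longrightarrow> g s > R" "\<And>s. s > -\<epsilon> \<Longrightarrow> energy R (g s) = energy R x0 + s"
    "\<And>s. s > -\<epsilon> \<Longrightarrow> (g has_real_derivative g s / (g s - R)) (at s)"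
    "\<And>s. s \<ge> 0 \<Longrightarrow> g s \<ge> x0 + s"
proof -
  have d: "(energy R has_real_derivative (x - R) / x) (at x)" if "x > R" for x
    using energy_deriv that assms(1) by simp
  have pos: "(x - R) / x > 0" if "x > R" for x using that assms(1) by simp
  obtain h where h: "\<And>x. x > R \<Longrightarrow> h (energy R x) = x"
    "\<And>x. x > R \<Longrightarrow> (h has_real_derivative inverse ((x - R) / x)) (at (energy R x))"
    using increasing_inverse[OF d pos] by blast
  define x1 where "x1 = (R + x0) / 2"
  have x1: "R < x1" "x1 < x0" using assms(2) by (auto simp: x1_def)
  have mono: "energy R x < energy R y" if "R < x" "x < y" for x y
    using d pos that by (rule increasing_if_deriv_pos)
  have onto: "\<exists>x>R. energy R x = y" if "y \<ge> energy R x1" for y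
  proof -
    \<comment> \<open>At \<open>b = q\<^sup>2\<close> the bound \<open>ln b \<le> 2 q\<close> gives \<open>energy R b \<ge> q (q - 2 R) \<ge> q\<close>.\<close>
    define q where "q = Max {2 * R + 1, y, x1}"
    define b where "b = q\<^sup>2"
    have q: "q \<ge> 2 * R + 1" "q \<ge> y" "q \<ge> x1" by (auto simp: q_def)
    then have q1: "q \<ge> 1" using assms(1) by linarith
    then have "b \<ge> q" by (simp add: b_def power2_eq_square)
    have "ln b = 2 * ln q" using q1 by (simp add: b_def ln_realpow)
    also have "\<dots> \<le> 2 * q" using ln_bound[of q] q1 by simp
    finally have "R * ln b \<le> R * (2 * q)" using assms(1) by (rule mult_left_mono)
    moreover have "q * 1 \<le> q * (q - 2 * R)" using q q1 by (intro mult_left_mono) auto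
    ultimately have b: "energy R b \<ge> y" "b \<ge> x1"
      using q \<open>b \<ge> q\<close> by (auto simp: energy_def b_def power2_eq_square algebra_simps)
    have "continuous_on {x1..b} (energy R)"
      using x1 by (intro continuous_at_imp_continuous_on ballI DERIV_isCont[OF d]) simp
    then have "\<exists>x\<ge>x1. x \<le> b \<and> energy R x = y"
      using b that by (intro IVT') auto
    then obtain x where "x1 \<le> x" "energy R x = y" by blast
    then show ?thesis using x1 by (intro exI[of _ x]) auto
  qed
  define \<epsilon> where "\<epsilon> = energy R x0 - energy R x1"
  define g where "g s = h (energy R x0 + s)" for s
  have g: "g s > R \<and> energy R (g s) = energy R x0 + s \<and> (g has_real_derivative g s / (g s - R)) (at s)" if "s > - \<epsilon>" for s
  proof -
    have "energy R x0 + s \<ge> energy R x1" using that by (simp add: \<epsilon>_def)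
    from onto[OF this] obtain x where x: "x > R" "energy R x = energy R x0 + s" by blast
    then have gs: "g s = x" using h(1)[of x] by (simp add: g_def)
    have "(h has_real_derivative x / (x - R)) (at (energy R x0 + s))" using h(2)[of x] x by simp
    then have "(g has_real_derivative x / (x - R)) (at s)"
      using DERIV_shift[of h "x / (x - R)" s "energy R x0"] by (simp add: g_def[abs_def] add.commute)
    then show ?thesis using x gs by simp
  qed
  show thesis
  proof (rule that[of \<epsilon> g])
    show eps: "\<epsilon> > 0" using mono[OF x1] by (simp add: \<epsilon>_def)
    show "g (energy R x - energy R x0) = x" if "x > R" for x using h(1)[OF that] by (simp add: g_def)
    fix s :: real assume s: "s \<ge> 0"
    then have gs: "g s > R" "energy R (g s) = energy R x0 + s" using g[of s] eps by auto
    have "g s \<ge> x0"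
    proof (rule ccontr)
      assume "\<not> g s \<ge> x0"
      then show False using mono[of "g s" x0] gs s by simp
    qed
    then have "R * ln (g s) \<ge> R * ln x0" using assms by (intro mult_left_mono) auto
    then show "g s \<ge> x0 + s" using gs(2) by (simp add: energy_def)
  qed (use g in auto)
qed

definition planar_solution :: "real \<Rightarrow> real \<Rightarrow> real \<Rightarrow> real \<Rightarrow> (real \<Rightarrow> real) \<Rightarrow> (real \<Rightarrow> real) \<Rightarrow> bool" where
  "planar_solution c R P T x y \<longleftrightarrow> (\<forall>t\<in>{0..<T}.
     (x has_real_derivative c * x t * (y t - P)) (at t within {0..<T}) \<and>
     (y has_real_derivative c * y t * (x t - R)) (at t within {0..<T}))"

text \<open>As long as a trajectory lies in the open quadrant, both variables are nondecreasing, so it cannot reach the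
  boundary. A first exit time would contradict this.\<close>

lemma planar_solution_stays:
  assumes c: "c > 0" and RP: "R \<ge> 0" "P \<ge> 0" and sol: "planar_solution c R P T x y"
    and pos: "\<And>t. t \<in> {0..<T} \<Longrightarrow> x t > 0 \<and> y t > 0"
    and init: "x 0 > R" "y 0 > P" and t: "t \<in> {0..<T}"
  shows "x t > R \<and> y t > P"
proof (rule ccontr)
  assume neg: "\<not> (x t > R \<and> y t > P)"
  define Z where "Z = {s \<in> {0..t}. x s \<le> R} \<union> {s \<in> {0..t}. y s \<le> P}"
  have sub: "{0..t} \<subseteq> {0..<T}" using t by auto
  have cx: "continuous_on {0..<T} x"
    by (rule DERIV_continuous_on[of _ _ "\<lambda>t. c * x t * (y t - P)"]) (use sol in \<open>simp add: planar_solution_def\<close>)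
  have cy: "continuous_on {0..<T} y"
    by (rule DERIV_continuous_on[of _ _ "\<lambda>t. c * y t * (x t - R)"]) (use sol in \<open>simp add: planar_solution_def\<close>)
  have "closed {s \<in> {0..t}. x s \<le> R}" "closed {s \<in> {0..t}. y s \<le> P}"
    by (intro continuous_on_closed_Collect_le continuous_on_subset[OF cx sub] continuous_on_subset[OF cy sub]
        continuous_on_const closed_atLeastAtMost)+
  then have "closed Z" unfolding Z_def by (rule closed_Un)
  moreover have "bounded Z"
    by (rule bounded_subset[OF compact_imp_bounded[OF compact_Icc[of 0 t]]]) (auto simp: Z_def)
  ultimately have "compact Z" by (simp add: compact_eq_bounded_closed)
  moreover have "t \<in> Z" using neg t by (auto simp: Z_def)
  ultimately obtain u where u: "u \<in> Z" "\<And>s. s \<in> Z \<Longrightarrow> u \<le> s"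
    using compact_attains_inf[of Z] by blast
  have "u \<in> {0..t}" using u(1) by (auto simp: Z_def)
  then have u0: "0 \<le> u" "u < T" using t by auto
  have before: "x s > R \<and> y s > P" if "0 \<le> s" "s < u" for s
  proof (rule ccontr)
    assume "\<not> (x s > R \<and> y s > P)"
    then have "s \<in> Z" using that u(1) by (auto simp: Z_def)
    then show False using u(2)[of s] that(2) by simp
  qed
  have d: "(x has_real_derivative c * x s * (y s - P)) (at s)" "(y has_real_derivative c * y s * (x s - R)) (at s)"
    if "0 < s" "s < u" for s
  proof -
    have "at s within {0..<T} = at s"
      using that u0 by (intro at_within_interior) (simp add: interior_atLeastLessThan)
    moreover have "s \<in> {0..<T}" using that u0 by simp
    then have "(x has_real_derivative c * x s * (y s - P)) (at s within {0..<T})"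
      "(y has_real_derivative c * y s * (x s - R)) (at s within {0..<T})"
      using sol by (simp_all add: planar_solution_def)
    ultimately show "(x has_real_derivative c * x s * (y s - P)) (at s)" "(y has_real_derivative c * y s * (x s - R)) (at s)"
      by simp_all
  qed
  have "x 0 \<le> x u"
  proof (rule DERIV_nonneg_imp_increasing_open[OF u0(1)])
    fix s assume s: "0 < s" "s < u"
    then have "0 \<le> c * x s * (y s - P)" using before[of s] pos[of s] c u0 by simp
    then show "\<exists>y. (x has_real_derivative y) (at s) \<and> 0 \<le> y" using d(1)[OF s] by blast
  qed (use u0 in \<open>auto intro!: continuous_on_subset[OF cx]\<close>)
  moreover have "y 0 \<le> y u"
  proof (rule DERIV_nonneg_imp_increasing_open[OF u0(1)])
    fix s assume s: "0 < s" "s < u"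
    then have "0 \<le> c * y s * (x s - R)" using before[of s] pos[of s] c u0 by simp
    then show "\<exists>z. (y has_real_derivative z) (at s) \<and> 0 \<le> z" using d(2)[OF s] by blast
  qed (use u0 in \<open>auto intro!: continuous_on_subset[OF cy]\<close>)
  ultimately show False using u(1) init by (auto simp: Z_def)
qed

text \<open>The curve \<open>(g, h)\<close> with \<open>energy R (g s) = energy R x0 + s\<close> and \<open>energy P (h s) = energy P y0 + s\<close> is the
  trajectory, run with speed \<open>1\<close> in the parameter \<open>s\<close>. True time is the clock \<open>\<tau>\<close> with
  \<open>\<tau>'(s) = 1 / (c (g s - R) (h s - P))\<close>, and \<open>T\<close> is its supremum. The last clause says that every solution in the quadrant
  runs along this curve by the same clock; since \<open>\<tau>\<close> stays below \<open>T\<close>, no solution outlives \<open>T\<close>, and a solution on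
  \<open>[0, T)\<close> has \<open>s\<close> tending to infinity.\<close>

lemma planar_blowup:
  assumes c: "c > 0" and RP: "R \<ge> 0" "P \<ge> 0" and init: "x0 > R" "y0 > P"
  obtains T \<tau> x y where "T > 0" "\<And>s. s \<ge> 0 \<Longrightarrow> 0 \<le> \<tau> s \<and> \<tau> s < T"
    "\<And>s s'. 0 \<le> s \<Longrightarrow> s < s' \<Longrightarrow> \<tau> s < \<tau> s'"
    "planar_solution c R P T x y" "x 0 = x0" "y 0 = y0" "\<And>t. t \<in> {0..<T} \<Longrightarrow> x t > R \<and> y t > P"
    "\<forall>T' x y. planar_solution c R P T' x y \<longrightarrow> x 0 = x0 \<longrightarrow> y 0 = y0 \<longrightarrow>
      (\<forall>t\<in>{0..<T'}. x t > R \<and> y t > P) \<longrightarrow>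
      (\<forall>t\<in>{0..<T'}. \<exists>s\<ge>0. energy R (x t) = energy R x0 + s \<and> energy P (y t) = energy P y0 + s \<and> \<tau> s = t)"
proof -
  obtain g \<epsilon>1 where g: "\<epsilon>1 > 0" "\<And>x. x > R \<Longrightarrow> g (energy R x - energy R x0) = x"
    "\<And>s. s > -\<epsilon>1 \<Longrightarrow> g s > R" "\<And>s. s > -\<epsilon>1 \<Longrightarrow> energy R (g s) = energy R x0 + s"
    "\<And>s. s > -\<epsilon>1 \<Longrightarrow> (g has_real_derivative g s / (g s - R)) (at s)"
    "\<And>s. s \<ge> 0 \<Longrightarrow> g s \<ge> x0 + s"
    by (rule energy_inverse[OF RP(1) init(1)]) (rule that; assumption)
  obtain h \<epsilon>2 where h: "\<epsilon>2 > 0" "\<And>x. x > P \<Longrightarrow> h (energy P x - energy P y0) = x"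
    "\<And>s. s > -\<epsilon>2 \<Longrightarrow> h s > P" "\<And>s. s > -\<epsilon>2 \<Longrightarrow> energy P (h s) = energy P y0 + s"
    "\<And>s. s > -\<epsilon>2 \<Longrightarrow> (h has_real_derivative h s / (h s - P)) (at s)"
    "\<And>s. s \<ge> 0 \<Longrightarrow> h s \<ge> y0 + s"
    by (rule energy_inverse[OF RP(2) init(2)]) (rule that; assumption)
  \<comment> \<open>The half leaves room for an antiderivative that starts at \<open>-\<epsilon>\<close>, where the speed is still positive.\<close>
  define \<epsilon> where "\<epsilon> = min \<epsilon>1 \<epsilon>2 / 2"
  have "\<epsilon> > 0" "\<epsilon> < \<epsilon>1" "\<epsilon> < \<epsilon>2" using g(1) h(1) by (auto simp: \<epsilon>_def min_def)
  then have eps: "\<epsilon> > 0" "\<And>s. s \<ge> -\<epsilon> \<Longrightarrow> s > -\<epsilon>1 \<and> s > -\<epsilon>2" by auto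
  define v where "v s = c * (g s - R) * (h s - P)" for s
  have vpos: "v s > 0" if "s \<ge> -\<epsilon>" for s using eps(2)[OF that] g(3) h(3) c by (simp add: v_def)
  have "continuous_on {-\<epsilon>..} g" "continuous_on {-\<epsilon>..} h"
    using eps(2)
    by (intro continuous_at_imp_continuous_on ballI DERIV_isCont[OF g(5)] DERIV_isCont[OF h(5)]; simp)+
  then have "continuous_on {-\<epsilon>..} (\<lambda>s. 1 / v s)"
    using vpos unfolding v_def by (intro continuous_intros) (auto simp: less_le v_def)
  then obtain F where F: "\<And>s. s > -\<epsilon> \<Longrightarrow> (F has_real_derivative 1 / v s) (at s)"
    using antiderivative_exists by blast
  define \<tau> where "\<tau> s = F s - F 0" for s
  have tau: "(\<tau> has_real_derivative 1 / v s) (at s)" if "s > -\<epsilon>" for s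
    unfolding \<tau>_def using F[OF that] by (auto intro!: derivative_eq_intros)
  have tau0: "\<tau> 0 = 0" by (simp add: \<tau>_def)
  have ivpos: "1 / v s > 0" if "s > -\<epsilon>" for s using vpos that by simp
  have mono: "\<tau> s < \<tau> s'" if "-\<epsilon> < s" "s < s'" for s s'
    using tau ivpos that by (rule increasing_if_deriv_pos)
  \<comment> \<open>By linear growth the speed is at least \<open>c (m + s)\<^sup>2\<close>, so \<open>\<tau> s + 1 / (c (m + s))\<close> does not increase.\<close>
  define m where "m = min (x0 - R) (y0 - P)"
  have m: "m > 0" using init by (simp add: m_def)
  have bound: "\<tau> s \<le> 1 / (c * m)" if s: "s \<ge> 0" for s
  proof -
    have "\<tau> s + 1 / (c * (m + s)) \<le> \<tau> 0 + 1 / (c * (m + 0))"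
    proof (rule DERIV_nonpos_imp_nonincreasing[OF s])
      fix u assume u: "0 \<le> u" "u \<le> s"
      have "(m + u) * (m + u) \<le> (g u - R) * (h u - P)"
        using g(6)[of u] h(6)[of u] m u by (intro mult_mono) (auto simp: m_def)
      then have "c * (m + u)\<^sup>2 \<le> v u" using c by (simp add: v_def power2_eq_square mult.assoc)
      moreover have "c * (m + u)\<^sup>2 > 0" using c m u by simp
      ultimately have "1 / v u \<le> 1 / (c * (m + u)\<^sup>2)" by (intro divide_left_mono) auto
      moreover have "c * (m + u) \<noteq> 0" using c m u by auto
      then have "((\<lambda>s. 1 / (c * (m + s))) has_real_derivative - (c / (c * (m + u))\<^sup>2)) (at u)"
        by (auto intro!: derivative_eq_intros simp: power2_eq_square)
      then have "((\<lambda>s. 1 / (c * (m + s))) has_real_derivative - (1 / (c * (m + u)\<^sup>2))) (at u)"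
        using c by (simp add: power_mult_distrib power2_eq_square mult_ac)
      then have "((\<lambda>s. \<tau> s + 1 / (c * (m + s))) has_real_derivative 1 / v u - 1 / (c * (m + u)\<^sup>2)) (at u)"
        using DERIV_add[OF tau[of u]] eps u by fastforce
      ultimately show "\<exists>z. ((\<lambda>s. \<tau> s + 1 / (c * (m + s))) has_real_derivative z) (at u) \<and> z \<le> 0"
        by (intro exI conjI) auto
    qed
    moreover have "1 / (c * (m + s)) \<ge> 0" using c m s by simp
    ultimately show ?thesis unfolding tau0 add_0_right by linarith
  qed
  define T where "T = (SUP s\<in>{0..}. \<tau> s)"
  have bdd: "bdd_above (\<tau> ` {0..})" using bound by (intro bdd_aboveI[of _ "1 / (c * m)"]) auto
  have tauT: "0 \<le> \<tau> s \<and> \<tau> s < T" if "s \<ge> 0" for s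
  proof
    show "0 \<le> \<tau> s" using mono[of 0 s] tau0 eps that by (cases "s = 0") auto
    have "\<tau> s < \<tau> (s + 1)" using mono that eps by simp
    also have "\<dots> \<le> T" unfolding T_def using that by (intro cSUP_upper bdd) auto
    finally show "\<tau> s < T" .
  qed
  have T: "T > 0" using tauT[of 0] by linarith
  have onto: "\<exists>s\<ge>0. \<tau> s = t" if t: "t \<in> {0..<T}" for t
  proof -
    have "\<exists>b\<in>{0..}. t < \<tau> b" using t less_cSUP_iff[OF _ bdd] unfolding T_def by auto
    then obtain b where b: "b \<ge> 0" "t < \<tau> b" by auto
    have "continuous_on {0..b} \<tau>"
      using eps by (intro continuous_at_imp_continuous_on ballI DERIV_isCont[OF tau]) simp
    then have "\<exists>s\<ge>0. s \<le> b \<and> \<tau> s = t" using tau0 t b by (intro IVT') auto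
    then show ?thesis by blast
  qed
  obtain \<sigma> where sig: "\<And>s. s > -\<epsilon> \<Longrightarrow> \<sigma> (\<tau> s) = s"
    "\<And>s. s > -\<epsilon> \<Longrightarrow> (\<sigma> has_real_derivative inverse (1 / v s)) (at (\<tau> s))"
    using increasing_inverse[OF tau ivpos] by blast
  show thesis
  proof (rule that[of T \<tau> "\<lambda>t. g (\<sigma> t)" "\<lambda>t. h (\<sigma> t)"])
    show "\<tau> s < \<tau> s'" if "0 \<le> s" "s < s'" for s s' using mono eps that by simp
    have s0: "\<sigma> 0 = 0" using sig(1)[of 0] tau0 eps by simp
    show "g (\<sigma> 0) = x0" "h (\<sigma> 0) = y0"
      using s0 g(2)[OF init(1)] h(2)[OF init(2)] by simp_all
    show "g (\<sigma> t) > R \<and> h (\<sigma> t) > P" if t: "t \<in> {0..<T}" for t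
    proof -
      obtain s where s: "s \<ge> 0" "\<tau> s = t" using onto[OF t] by blast
      then have "s > -\<epsilon>1" "s > -\<epsilon>2" "\<sigma> t = s" using eps sig(1)[of s] by auto
      then show ?thesis using g(3) h(3) by auto
    qed
    show "planar_solution c R P T (\<lambda>t. g (\<sigma> t)) (\<lambda>t. h (\<sigma> t))"
      unfolding planar_solution_def
    proof (intro ballI conjI)
      fix t assume t: "t \<in> {0..<T}"
      obtain s where s: "s \<ge> 0" "\<tau> s = t" using onto[OF t] by blast
      then have s': "s > -\<epsilon>" "s > -\<epsilon>1" "s > -\<epsilon>2" "\<sigma> t = s" using eps sig(1)[of s] by auto
      have ds: "(\<sigma> has_real_derivative v s) (at t)" using sig(2)[OF s'(1)] s by simp
      have "((\<lambda>t. g (\<sigma> t)) has_real_derivative (g s / (g s - R)) * v s) (at t)"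
        by (rule DERIV_chain2[OF _ ds]) (simp add: s'(4) g(5)[OF s'(2)])
      moreover have "(g s / (g s - R)) * v s = c * g s * (h s - P)" using g(3)[OF s'(2)] by (simp add: v_def)
      ultimately show "((\<lambda>t. g (\<sigma> t)) has_real_derivative c * g (\<sigma> t) * (h (\<sigma> t) - P)) (at t within {0..<T})"
        using s'(4) by (simp add: has_field_derivative_at_within)
      have "((\<lambda>t. h (\<sigma> t)) has_real_derivative (h s / (h s - P)) * v s) (at t)"
        by (rule DERIV_chain2[OF _ ds]) (simp add: s'(4) h(5)[OF s'(3)])
      moreover have "(h s / (h s - P)) * v s = c * h s * (g s - R)" using h(3)[OF s'(3)] by (simp add: v_def)
      ultimately show "((\<lambda>t. h (\<sigma> t)) has_real_derivative c * h (\<sigma> t) * (g (\<sigma> t) - R)) (at t within {0..<T})"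
        using s'(4) by (simp add: has_field_derivative_at_within)
    qed
    show "\<forall>T' x y. planar_solution c R P T' x y \<longrightarrow> x 0 = x0 \<longrightarrow> y 0 = y0 \<longrightarrow>
      (\<forall>t\<in>{0..<T'}. x t > R \<and> y t > P) \<longrightarrow>
      (\<forall>t\<in>{0..<T'}. \<exists>s\<ge>0. energy R (x t) = energy R x0 + s \<and> energy P (y t) = energy P y0 + s \<and> \<tau> s = t)"
    proof (intro allI impI ballI)
      fix T' x y t
      assume sol: "planar_solution c R P T' x y" and i: "x 0 = x0" "y 0 = y0"
        and stay': "\<forall>t\<in>{0..<T'}. x t > R \<and> y t > P" and t: "t \<in> {0..<T'}"
      have stay: "x t > R \<and> y t > P" if "t \<in> {0..<T'}" for t using stay' that by blast
      define s where "s t = energy R (x t) - energy R x0" for t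
      have chain: "((\<lambda>t. energy r (z t)) has_real_derivative (z t - r) / z t * z') (at t within S)"
        if "(z has_real_derivative z') (at t within S)" "z t > 0" for r z z' t S
        using DERIV_chain2[OF energy_deriv that(1)] that(2) by simp
      have gx: "((\<lambda>t. energy R (x t)) has_real_derivative c * (x t - R) * (y t - P)) (at t within {0..<T'})"
        and gy: "((\<lambda>t. energy P (y t)) has_real_derivative c * (x t - R) * (y t - P)) (at t within {0..<T'})"
        if t: "t \<in> {0..<T'}" for t
      proof -
        have p: "x t > 0" "y t > 0" using stay[OF t] RP by auto
        have "(x has_real_derivative c * x t * (y t - P)) (at t within {0..<T'})"
          "(y has_real_derivative c * y t * (x t - R)) (at t within {0..<T'})"
          using sol t by (auto simp: planar_solution_def)
        from chain[OF this(1) p(1), of R] chain[OF this(2) p(2), of P]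
        show "((\<lambda>t. energy R (x t)) has_real_derivative c * (x t - R) * (y t - P)) (at t within {0..<T'})"
          "((\<lambda>t. energy P (y t)) has_real_derivative c * (x t - R) * (y t - P)) (at t within {0..<T'})"
          using p by (simp_all add: mult_ac)
      qed
      have eqG: "energy P (y t) = energy P y0 + s t" if t: "t \<in> {0..<T'}" for t
      proof -
        have "((\<lambda>t. energy R (x t) - energy P (y t)) has_real_derivative 0) (at t within {0..<T'})" if "t \<in> {0..<T'}" for t
          using DERIV_diff[OF gx[OF that] gy[OF that]] by simp
        from zero_derivative_constant[OF this t] show ?thesis by (simp add: s_def i)
      qed
      have spos: "s t \<ge> 0" if t: "t \<in> {0..<T'}" for t
      proof -
        have "s 0 \<le> s t"
        proof (rule DERIV_nonneg_imp_increasing_open[where f = s and a = 0 and b = t])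
          fix u assume u: "0 < u" "u < t"
          then have "at u within {0..<T'} = at u"
            using t by (intro at_within_interior) (simp add: interior_atLeastLessThan)
          then have "(s has_real_derivative c * (x u - R) * (y u - P)) (at u)"
            unfolding s_def using gx[of u] u t by (auto intro!: derivative_eq_intros)
          moreover have "0 \<le> c * (x u - R) * (y u - P)" using stay[of u] u t c by simp
          ultimately show "\<exists>z. (s has_real_derivative z) (at u) \<and> 0 \<le> z" by blast
        next
          have "continuous_on {0..<T'} s" unfolding s_def using gx
            by (intro DERIV_continuous_on[of _ _ "\<lambda>t. c * (x t - R) * (y t - P)"]) (auto intro!: derivative_eq_intros)
          then show "continuous_on {0..t} s" using t by (auto intro: continuous_on_subset)
        qed (use t in auto)
        then show ?thesis by (simp add: s_def i)
      qed
      have gs: "g (s t) = x t" "h (s t) = y t" if t: "t \<in> {0..<T'}" for t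
        using g(2)[of "x t"] h(2)[of "y t"] stay[OF t] eqG[OF t] by (simp_all add: s_def)
      have "((\<lambda>t. \<tau> (s t) - t) has_real_derivative 0) (at t within {0..<T'})" if t: "t \<in> {0..<T'}" for t
      proof -
        have "s t > -\<epsilon>" using spos[OF t] eps by simp
        from tau[OF this] have "(\<tau> has_real_derivative 1 / v (s t)) (at (s t))" .
        moreover have ds: "(s has_real_derivative c * (x t - R) * (y t - P)) (at t within {0..<T'})"
          unfolding s_def using gx[OF t] by (auto intro!: derivative_eq_intros)
        ultimately have "((\<lambda>t. \<tau> (s t)) has_real_derivative 1 / v (s t) * (c * (x t - R) * (y t - P))) (at t within {0..<T'})"
          by (rule DERIV_chain2)
        moreover have "1 / v (s t) * (c * (x t - R) * (y t - P)) = 1"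
          using stay[OF t] c by (simp add: v_def gs[OF t])
        ultimately show ?thesis by (auto intro!: derivative_eq_intros)
      qed
      from zero_derivative_constant[OF this t] have "\<tau> (s t) = t" using tau0 by (simp add: s_def i)
      then show "\<exists>s\<ge>0. energy R (x t) = energy R x0 + s \<and> energy P (y t) = energy P y0 + s \<and> \<tau> s = t"
        using spos[OF t] eqG[OF t] by (intro exI[of _ "s t"]) (simp add: s_def)
    qed
  qed (use T tauT in auto)
qed

section \<open>The flow on the ansatz\<close>

text \<open>Read as \<open>x (y - P) > y R \<ge> 0\<close> and \<open>y (x - R) > x P \<ge> 0\<close>.\<close>

lemma above_thresholds:
  fixes x y R P :: real
  assumes "x > 0" "y > 0" "R \<ge> 0" "P \<ge> 0" "x * y > x * P + y * R"
  shows "x > R" "y > P"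
proof -
  have "x * (y - P) > y * R" using assms(5) by (simp add: algebra_simps)
  moreover have "y * R \<ge> 0" using assms by simp
  ultimately show "y > P" using assms(1) by (metis diff_gt_0_iff_gt less_le_trans not_less order_less_le_trans zero_less_mult_pos le_less_trans)
  have "y * (x - R) > x * P" using assms(5) by (simp add: algebra_simps)
  moreover have "x * P \<ge> 0" using assms by simp
  ultimately show "x > R" using assms(2) by (metis diff_gt_0_iff_gt le_less_trans zero_less_mult_pos)
qed

text \<open>All solutions of one scalar linear equation are multiples of a single positive one, so they keep their
  signs and mutual ratios.\<close>

lemma common_growth_factor:
  fixes k :: "real \<Rightarrow> real"
  assumes "continuous_on {0..<T} k"
  obtains E where "\<And>t. E t > 0"
    "\<And>f t. (\<And>t. t \<in> {0..<T} \<Longrightarrow> (f has_real_derivative k t * f t) (at t within {0..<T})) \<Longrightarrow>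
       t \<in> {0..<T} \<Longrightarrow> f t = f 0 * E t"
proof -
  define L where "L t = integral {0..t} k" for t
  have L: "(L has_real_derivative k t) (at t within {0..<T})" if t: "t \<in> {0..<T}" for t
  proof -
    \<comment> \<open>The fundamental theorem needs a compact interval; nothing changes near \<open>t\<close>.\<close>
    define b where "b = (t + T) / 2"
    have b: "t < b" "b < T" using t by (auto simp: b_def)
    have "(L has_real_derivative k t) (at t within {0..b})"
      unfolding L_def by (rule integral_has_real_derivative) (use t b assms in \<open>auto intro: continuous_on_subset\<close>)
    moreover have "at t within {0..b} = at t within {0..<T}"
      by (rule at_within_nhd[of _ "{..<b}"]) (use b in auto)
    ultimately show ?thesis by simp
  qed
  show thesis
  proof (rule that[of "\<lambda>t. exp (L t)"])
    fix f t assume f: "\<And>t. t \<in> {0..<T} \<Longrightarrow> (f has_real_derivative k t * f t) (at t within {0..<T})"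
      and t: "t \<in> {0..<T}"
    have "((\<lambda>t. f t * exp (- L t)) has_real_derivative 0) (at t within {0..<T})" if "t \<in> {0..<T}" for t
      using f[OF that] L[OF that] by (auto intro!: derivative_eq_intros)
    from zero_derivative_constant[OF this t] have "f t * exp (- L t) = f 0" by (simp add: L_def)
    then have "f t * exp (- L t) * exp (L t) = f 0 * exp (L t)" by simp
    then show "f t = f 0 * exp (L t)" by (simp add: mult.assoc flip: exp_add)
  qed simp
qed

lemma lam_pos: "lam > 0"
proof -
  have "(3 + q) / 2 > 1" if "q > 0" for q :: real using that by simp
  from this[of "sqrt 5"] have "(3 + sqrt 5) / 2 > 1" by simp
  then show ?thesis unfolding lam_def by (rule ln_gt_zero)
qed

text \<open>The functions \<open>\<alpha>\<close>, \<open>\<delta>\<close> solve one linear equation and \<open>\<beta>\<close>, \<open>\<gamma>\<close> another; each function is therefore recovered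
  from \<open>x\<close> or \<open>y\<close> and its initial value.\<close>

lemma flow_solution_planar:
  assumes sol: "flow_solution M N T \<alpha> \<beta> \<gamma> \<delta>"
    and init: "\<alpha> 0 * \<delta> 0 > 0" "\<beta> 0 * \<gamma> 0 > 0" "4 * \<alpha> 0 * \<delta> 0 > (M + N)\<^sup>2" "4 * \<beta> 0 * \<gamma> 0 > (M - N)\<^sup>2"
  defines "x \<equiv> \<lambda>t. 4 * \<alpha> t * \<delta> t" and "y \<equiv> \<lambda>t. 4 * \<beta> t * \<gamma> t"
  shows "planar_solution (8 * lam\<^sup>2) ((M + N)\<^sup>2) ((M - N)\<^sup>2) T x y"
    "\<And>t. t \<in> {0..<T} \<Longrightarrow> x t > (M + N)\<^sup>2 \<and> y t > (M - N)\<^sup>2"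
    "\<And>t. t \<in> {0..<T} \<Longrightarrow> \<alpha> t = \<alpha> 0 * sqrt (x t / x 0) \<and> \<beta> t = \<beta> 0 * sqrt (y t / y 0) \<and>
        \<gamma> t = \<gamma> 0 * sqrt (y t / y 0) \<and> \<delta> t = \<delta> 0 * sqrt (x t / x 0)"
proof -
  define k l where "k t = 4 * lam\<^sup>2 * (y t - (M - N)\<^sup>2)" and "l t = 4 * lam\<^sup>2 * (x t - (M + N)\<^sup>2)" for t
  have d: "(\<alpha> has_real_derivative k t * \<alpha> t) (at t within {0..<T})" "(\<delta> has_real_derivative k t * \<delta> t) (at t within {0..<T})"
    "(\<beta> has_real_derivative l t * \<beta> t) (at t within {0..<T})" "(\<gamma> has_real_derivative l t * \<gamma> t) (at t within {0..<T})"
    if "t \<in> {0..<T}" for t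
    using sol that by (auto simp: flow_solution_def k_def l_def x_def y_def mult_ac)
  have c: "continuous_on {0..<T} \<alpha>" "continuous_on {0..<T} \<beta>" "continuous_on {0..<T} \<gamma>" "continuous_on {0..<T} \<delta>"
    by (rule DERIV_continuous_on, rule d, simp)+
  have "continuous_on {0..<T} k" "continuous_on {0..<T} l"
    unfolding k_def l_def x_def y_def by (intro continuous_intros c)+
  then obtain D E where D: "\<And>t. D t > 0" and E: "\<And>t. E t > 0" and
    Df: "\<And>f t. (\<And>t. t \<in> {0..<T} \<Longrightarrow> (f has_real_derivative k t * f t) (at t within {0..<T})) \<Longrightarrow>
       t \<in> {0..<T} \<Longrightarrow> f t = f 0 * D t" and
    Ef: "\<And>f t. (\<And>t. t \<in> {0..<T} \<Longrightarrow> (f has_real_derivative l t * f t) (at t within {0..<T})) \<Longrightarrow>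
       t \<in> {0..<T} \<Longrightarrow> f t = f 0 * E t"
    using common_growth_factor by metis
  have a: "\<alpha> t = \<alpha> 0 * D t" "\<delta> t = \<delta> 0 * D t" "\<beta> t = \<beta> 0 * E t" "\<gamma> t = \<gamma> 0 * E t" if "t \<in> {0..<T}" for t
    using Df[of \<alpha>, OF d(1) that] Df[of \<delta>, OF d(2) that] Ef[of \<beta>, OF d(3) that] Ef[of \<gamma>, OF d(4) that] by auto
  have x0: "x 0 > 0" "y 0 > 0" using init(1,2) by (simp_all add: x_def y_def)
  have xy: "x t = x 0 * (D t)\<^sup>2" "y t = y 0 * (E t)\<^sup>2" if "t \<in> {0..<T}" for t
    using a[OF that] by (simp_all add: x_def y_def power2_eq_square)
  show planar: "planar_solution (8 * lam\<^sup>2) ((M + N)\<^sup>2) ((M - N)\<^sup>2) T x y"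
    unfolding planar_solution_def
  proof (intro ballI conjI)
    fix t assume t: "t \<in> {0..<T}"
    show "(x has_real_derivative 8 * lam\<^sup>2 * x t * (y t - (M - N)\<^sup>2)) (at t within {0..<T})"
      unfolding x_def by (rule derivative_eq_intros d[OF t] refl)+ (simp add: k_def algebra_simps)
    show "(y has_real_derivative 8 * lam\<^sup>2 * y t * (x t - (M + N)\<^sup>2)) (at t within {0..<T})"
      unfolding y_def by (rule derivative_eq_intros d[OF t] refl)+ (simp add: l_def algebra_simps)
  qed
  show "x t > (M + N)\<^sup>2 \<and> y t > (M - N)\<^sup>2" if "t \<in> {0..<T}" for t
  proof (rule planar_solution_stays[OF _ _ _ planar _ _ _ that])
    show "x t > 0 \<and> y t > 0" if "t \<in> {0..<T}" for t
      unfolding xy[OF that] by (intro conjI mult_pos_pos zero_less_power x0 D E)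
  qed (use lam_pos init in \<open>auto simp: x_def y_def\<close>)
  show "\<alpha> t = \<alpha> 0 * sqrt (x t / x 0) \<and> \<beta> t = \<beta> 0 * sqrt (y t / y 0) \<and>
        \<gamma> t = \<gamma> 0 * sqrt (y t / y 0) \<and> \<delta> t = \<delta> 0 * sqrt (x t / x 0)" if t: "t \<in> {0..<T}" for t
  proof -
    have "sqrt (x t / x 0) = D t" "sqrt (y t / y 0) = E t"
      using xy[OF t] x0 D[of t] E[of t] by simp_all
    then show ?thesis using a[OF t] by simp
  qed
qed

text \<open>The converse of \<open>flow_solution_planar\<close>: taking square roots halves the logarithmic derivative.\<close>

lemma planar_flow_solution:
  assumes sol: "planar_solution (8 * lam\<^sup>2) ((M + N)\<^sup>2) ((M - N)\<^sup>2) T x y"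
    and pos: "\<And>t. t \<in> {0..<T} \<Longrightarrow> x t > 0 \<and> y t > 0"
    and init: "x 0 = 4 * \<alpha>0 * \<delta>0" "y 0 = 4 * \<beta>0 * \<gamma>0" "x 0 > 0" "y 0 > 0"
  shows "flow_solution_from M N \<alpha>0 \<beta>0 \<gamma>0 \<delta>0 T (\<lambda>t. \<alpha>0 * sqrt (x t / x 0)) (\<lambda>t. \<beta>0 * sqrt (y t / y 0))
    (\<lambda>t. \<gamma>0 * sqrt (y t / y 0)) (\<lambda>t. \<delta>0 * sqrt (x t / x 0))"
proof -
  have root: "((\<lambda>t. a * sqrt (z t / z0)) has_real_derivative k / 2 * (a * sqrt (z t / z0))) (at t within S)"
    if z: "(z has_real_derivative k * z t) (at t within S)" "z t > 0" "z0 > 0" for a k z0 z t S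
  proof -
    have q: "z t / z0 > 0" using that by simp
    have "((\<lambda>t. z t / z0) has_real_derivative k * z t / z0) (at t within S)"
      using DERIV_cdivide[OF z(1)] .
    then have "((\<lambda>t. sqrt (z t / z0)) has_real_derivative inverse (sqrt (z t / z0)) / 2 * (k * z t / z0)) (at t within S)"
      by (rule DERIV_chain2[where f = sqrt and g = "\<lambda>t. z t / z0", OF DERIV_real_sqrt[OF q]])
    from DERIV_cmult[OF this, of a] show ?thesis
    proof (rule DERIV_cong)
      have "sqrt (z t / z0) * sqrt (z t / z0) = z t / z0" using q by (simp only: real_sqrt_mult_self abs_of_pos)
      moreover have "sqrt (z t / z0) \<noteq> 0" using q by (simp only: real_sqrt_eq_zero_cancel_iff)
      ultimately have "inverse (sqrt (z t / z0)) * (z t / z0) = sqrt (z t / z0)"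
        by (metis left_inverse mult.assoc mult_1)
      moreover have "a * (r / 2 * (k * z t / z0)) = k / 2 * (a * (r * (z t / z0)))" for r by simp
      ultimately show "a * (inverse (sqrt (z t / z0)) / 2 * (k * z t / z0)) = k / 2 * (a * sqrt (z t / z0))"
        by (simp only:)
    qed
  qed
  have prod: "4 * (\<alpha>0 * sqrt (x t / x 0)) * (\<delta>0 * sqrt (x t / x 0)) = x t"
    "4 * (\<beta>0 * sqrt (y t / y 0)) * (\<gamma>0 * sqrt (y t / y 0)) = y t" if t: "t \<in> {0..<T}" for t
  proof -
    have sq: "4 * (a * sqrt (u / v)) * (b * sqrt (u / v)) = u" if "u > 0" "v > 0" "v = 4 * a * b" for a b u v :: real
    proof -
      have "4 * (a * sqrt (u / v)) * (b * sqrt (u / v)) = (4 * a * b) * (sqrt (u / v) * sqrt (u / v))" by (simp only: mult_ac)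
      also have "sqrt (u / v) * sqrt (u / v) = u / v" using that by (simp only: real_sqrt_mult_self abs_of_pos divide_pos_pos)
      also have "(4 * a * b) * (u / v) = u" unfolding that(3)[symmetric] using that(2) by simp
      finally show ?thesis .
    qed
    show "4 * (\<alpha>0 * sqrt (x t / x 0)) * (\<delta>0 * sqrt (x t / x 0)) = x t"
      "4 * (\<beta>0 * sqrt (y t / y 0)) * (\<gamma>0 * sqrt (y t / y 0)) = y t"
      using pos[OF t] init by (auto intro!: sq)
  qed
  show ?thesis
    unfolding flow_solution_from_def flow_solution_def
  proof (intro conjI ballI)
    fix t assume t: "t \<in> {0..<T}"
    have dx: "(x has_real_derivative (8 * lam\<^sup>2 * (y t - (M - N)\<^sup>2)) * x t) (at t within {0..<T})"
      and dy: "(y has_real_derivative (8 * lam\<^sup>2 * (x t - (M + N)\<^sup>2)) * y t) (at t within {0..<T})"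
      using sol t by (simp_all add: planar_solution_def mult_ac)
    have p: "x t > 0" "y t > 0" using pos[OF t] by auto
    note rx = root[OF dx p(1) init(3)] and ry = root[OF dy p(2) init(4)]
    show "((\<lambda>t. \<alpha>0 * sqrt (x t / x 0)) has_real_derivative 4 * lam\<^sup>2 * (\<alpha>0 * sqrt (x t / x 0)) *
        (4 * (\<beta>0 * sqrt (y t / y 0)) * (\<gamma>0 * sqrt (y t / y 0)) - (M - N)\<^sup>2)) (at t within {0..<T})"
      by (rule DERIV_cong[OF rx]) (simp only: prod[OF t], simp)
    show "((\<lambda>t. \<delta>0 * sqrt (x t / x 0)) has_real_derivative 4 * lam\<^sup>2 * (\<delta>0 * sqrt (x t / x 0)) *
        (4 * (\<beta>0 * sqrt (y t / y 0)) * (\<gamma>0 * sqrt (y t / y 0)) - (M - N)\<^sup>2)) (at t within {0..<T})"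
      by (rule DERIV_cong[OF rx]) (simp only: prod[OF t], simp)
    show "((\<lambda>t. \<beta>0 * sqrt (y t / y 0)) has_real_derivative 4 * lam\<^sup>2 * (\<beta>0 * sqrt (y t / y 0)) *
        (4 * (\<alpha>0 * sqrt (x t / x 0)) * (\<delta>0 * sqrt (x t / x 0)) - (M + N)\<^sup>2)) (at t within {0..<T})"
      by (rule DERIV_cong[OF ry]) (simp only: prod[OF t], simp)
    show "((\<lambda>t. \<gamma>0 * sqrt (y t / y 0)) has_real_derivative 4 * lam\<^sup>2 * (\<gamma>0 * sqrt (y t / y 0)) *
        (4 * (\<alpha>0 * sqrt (x t / x 0)) * (\<delta>0 * sqrt (x t / x 0)) - (M + N)\<^sup>2)) (at t within {0..<T})"
      by (rule DERIV_cong[OF ry]) (simp only: prod[OF t], simp)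
  qed (use init in auto)
qed

lemma energy_less_iff: "R \<ge> 0 \<Longrightarrow> R < a \<Longrightarrow> R < b \<Longrightarrow> energy R a < energy R b \<longleftrightarrow> a < b"
proof -
  assume R: "R \<ge> 0" and ab: "R < a" "R < b"
  have mono: "energy R u < energy R v" if "R < u" "u < v" for u v
    by (rule increasing_if_deriv_pos[of R "energy R" "\<lambda>x. (x - R) / x"]) (use R that in \<open>auto intro!: energy_deriv\<close>)
  show ?thesis using mono[of a b] mono[of b a] ab by (cases a b rule: linorder_cases) auto
qed

text \<open>If \<open>x\<close> stayed below \<open>Z\<close>, the parameter \<open>s\<close> would stay bounded and the clock away from \<open>T\<close>.\<close>

lemma blowup_at_top:
  fixes T R x0 :: real and x \<tau> :: "real \<Rightarrow> real"
  assumes R: "R \<ge> 0" and x0: "x0 > R" and T: "T > 0"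
    and \<tau>: "\<And>s. s \<ge> 0 \<Longrightarrow> \<tau> s < T" "\<And>s s'. 0 \<le> s \<Longrightarrow> s < s' \<Longrightarrow> \<tau> s < \<tau> s'"
    and x: "\<And>t. t \<in> {0..<T} \<Longrightarrow> x t > R \<and> (\<exists>s\<ge>0. energy R (x t) = energy R x0 + s \<and> \<tau> s = t)"
  shows "filterlim x at_top (at_left T)"
  unfolding filterlim_at_top_gt[where c = R]
proof (intro allI impI)
  fix Z assume Z: "Z > R"
  define S where "S = max 0 (energy R Z - energy R x0)"
  have S: "S \<ge> 0" "S \<ge> energy R Z - energy R x0" by (auto simp: S_def)
  show "\<forall>\<^sub>F t in at_left T. Z \<le> x t"
    unfolding eventually_at_left[OF T]
  proof (intro exI[of _ "max 0 (\<tau> S)"] conjI allI impI)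
    show "max 0 (\<tau> S) < T" using T \<tau>(1)[OF S(1)] by simp
    fix t assume t: "max 0 (\<tau> S) < t" "t < T"
    then obtain s where s: "s \<ge> 0" "energy R (x t) = energy R x0 + s" "\<tau> s = t" "x t > R" using x[of t] by auto
    then have "S < s" using \<tau>(2)[of s S] t S by (cases s S rule: linorder_cases) auto
    then have "energy R Z < energy R (x t)" using S s by linarith
    then show "Z \<le> x t" using energy_less_iff[OF R Z s(4)] by simp
  qed
qed

text \<open>After division, the first integral reads \<open>x (1 - R ln x / x) = y (1 - P ln y / y + K / y)\<close>, and both brackets
  tend to \<open>1\<close>.\<close>

lemma blowup_ratio:
  assumes x: "filterlim x at_top F" and y: "filterlim y at_top F"
    and eq: "\<forall>\<^sub>F t in F. energy R (x t) = energy P (y t) + K"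
  shows "((\<lambda>t. y t / x t) \<longlongrightarrow> 1) F"
proof -
  have lx: "((\<lambda>t. ln (x t) / x t) \<longlongrightarrow> 0) F" and ly: "((\<lambda>t. ln (y t) / y t) \<longlongrightarrow> 0) F"
    using filterlim_compose[OF ln_x_over_x_tendsto_0 x] filterlim_compose[OF ln_x_over_x_tendsto_0 y] .
  have iy: "((\<lambda>t. inverse (y t)) \<longlongrightarrow> 0) F"
    using filterlim_compose[OF tendsto_inverse_0_at_top[OF filterlim_ident] y] .
  have A: "((\<lambda>t. 1 - R * (ln (x t) / x t)) \<longlongrightarrow> 1 - R * 0) F" by (intro tendsto_intros lx)
  have B: "((\<lambda>t. 1 - P * (ln (y t) / y t) + K * inverse (y t)) \<longlongrightarrow> 1 - P * 0 + K * 0) F"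
    by (intro tendsto_intros ly iy)
  have lim: "((\<lambda>t. (1 - R * (ln (x t) / x t)) / (1 - P * (ln (y t) / y t) + K * inverse (y t))) \<longlongrightarrow> 1) F"
    using tendsto_divide[OF A B] by simp
  have "\<forall>\<^sub>F t in F. 1 - P * (ln (y t) / y t) + K * inverse (y t) > 0"
    using order_tendstoD(1)[OF B, of 0] by simp
  moreover have "\<forall>\<^sub>F t in F. x t > 0" "\<forall>\<^sub>F t in F. y t > 0"
    using x y by (auto simp: filterlim_at_top_dense)
  ultimately have "\<forall>\<^sub>F t in F. (1 - R * (ln (x t) / x t)) / (1 - P * (ln (y t) / y t) + K * inverse (y t)) = y t / x t"
    using eq
  proof eventually_elim
    case (elim t)
    have "x t * (1 - R * (ln (x t) / x t)) = y t * (1 - P * (ln (y t) / y t) + K * inverse (y t))"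
      using elim by (simp add: energy_def algebra_simps)
    then show ?case using elim(1-3) by (simp add: frac_eq_eq mult_ac)
  qed
  then show ?thesis using lim by (rule Lim_transform_eventually[rotated])
qed

text \<open>The limits follow from \<open>\<alpha> = \<alpha>0 sqrt (x / x0)\<close>, \<open>\<beta> = \<beta>0 sqrt (y / y0)\<close> and the analogous formulas for \<open>\<delta>\<close> and
  \<open>\<gamma>\<close>, together with \<open>y / x \<longlonglongrightarrow> 1\<close>. The limit coefficients satisfy \<open>\<delta> = \<beta>\<gamma>\<close>, since the product of the two
  square roots cancels \<open>\<beta>0 \<gamma>0\<close>.\<close>

lemma flow_blowup:
  assumes sgn: "\<alpha>0 * \<beta>0 > 0" "\<gamma>0 * \<delta>0 > 0" "\<alpha>0 * \<gamma>0 > 0"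
    and disc: "4 * \<alpha>0 * \<beta>0 * \<gamma>0 * \<delta>0 > \<alpha>0 * \<delta>0 * (M - N)\<^sup>2 + \<beta>0 * \<gamma>0 * (M + N)\<^sup>2"
  obtains T where "max_existence_time M N \<alpha>0 \<beta>0 \<gamma>0 \<delta>0 T"
    "\<And>\<alpha> \<beta> \<gamma> \<delta>. flow_solution_from M N \<alpha>0 \<beta>0 \<gamma>0 \<delta>0 T \<alpha> \<beta> \<gamma> \<delta> \<Longrightarrow>
      ((\<lambda>t. inverse (\<alpha> t)) \<longlongrightarrow> 0) (at_left T) \<and>
      ((\<lambda>t. inverse (\<alpha> t) * \<alpha> t) \<longlongrightarrow> 1) (at_left T) \<and>
      ((\<lambda>t. inverse (\<alpha> t) * \<beta> t) \<longlongrightarrow> \<beta>0 / \<alpha>0 * sqrt (\<alpha>0 * \<delta>0 / (\<beta>0 * \<gamma>0))) (at_left T) \<and>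
      ((\<lambda>t. inverse (\<alpha> t) * \<gamma> t) \<longlongrightarrow> \<gamma>0 / \<alpha>0 * sqrt (\<alpha>0 * \<delta>0 / (\<beta>0 * \<gamma>0))) (at_left T) \<and>
      ((\<lambda>t. inverse (\<alpha> t) * \<delta> t) \<longlongrightarrow> \<delta>0 / \<alpha>0) (at_left T)"
proof -
  define c R P where "c = 8 * lam\<^sup>2" and "R = (M + N)\<^sup>2" and "P = (M - N)\<^sup>2"
  define x0 y0 where "x0 = 4 * \<alpha>0 * \<delta>0" and "y0 = 4 * \<beta>0 * \<gamma>0"
  have RP: "R \<ge> 0" "P \<ge> 0" by (simp_all add: R_def P_def)
  have c: "c > 0" using lam_pos by (simp add: c_def)
  have "\<alpha>0 * \<delta>0 > 0" using sgn(2,3) by (auto simp: zero_less_mult_iff)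
  moreover have "\<beta>0 * \<gamma>0 > 0" using sgn(1,3) by (auto simp: zero_less_mult_iff)
  ultimately have pos: "x0 > 0" "y0 > 0" by (simp_all add: x0_def y0_def)
  have "x0 * y0 > x0 * P + y0 * R"
    using disc by (simp add: x0_def y0_def P_def R_def algebra_simps)
  then have init: "x0 > R" "y0 > P" using above_thresholds[OF pos RP] by auto
  have \<alpha>0: "\<alpha>0 \<noteq> 0" using sgn by auto
  obtain T \<tau> X Y where T: "T > 0" and \<tau>: "\<And>s. s \<ge> 0 \<Longrightarrow> 0 \<le> \<tau> s \<and> \<tau> s < T"
    "\<And>s s'. 0 \<le> s \<Longrightarrow> s < s' \<Longrightarrow> \<tau> s < \<tau> s'"
    and XY: "planar_solution c R P T X Y" "X 0 = x0" "Y 0 = y0" "\<And>t. t \<in> {0..<T} \<Longrightarrow> X t > R \<and> Y t > P"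
    and clock: "\<forall>T' x y. planar_solution c R P T' x y \<longrightarrow> x 0 = x0 \<longrightarrow> y 0 = y0 \<longrightarrow>
      (\<forall>t\<in>{0..<T'}. x t > R \<and> y t > P) \<longrightarrow>
      (\<forall>t\<in>{0..<T'}. \<exists>s\<ge>0. energy R (x t) = energy R x0 + s \<and> energy P (y t) = energy P y0 + s \<and> \<tau> s = t)"
    by (rule planar_blowup[OF c RP init]) (rule that; assumption)
  have sol: "flow_solution_from M N \<alpha>0 \<beta>0 \<gamma>0 \<delta>0 T (\<lambda>t. \<alpha>0 * sqrt (X t / X 0)) (\<lambda>t. \<beta>0 * sqrt (Y t / Y 0))
    (\<lambda>t. \<gamma>0 * sqrt (Y t / Y 0)) (\<lambda>t. \<delta>0 * sqrt (X t / X 0))"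
  proof (rule planar_flow_solution)
    show "planar_solution (8 * lam\<^sup>2) ((M + N)\<^sup>2) ((M - N)\<^sup>2) T X Y"
      using XY(1) by (simp add: c_def R_def P_def)
    show "X t > 0 \<and> Y t > 0" if "t \<in> {0..<T}" for t
      using XY(4)[OF that] RP by linarith
  qed (use XY pos in \<open>simp_all add: x0_def y0_def\<close>)
  have planar: "planar_solution c R P T' (\<lambda>t. 4 * \<alpha> t * \<delta> t) (\<lambda>t. 4 * \<beta> t * \<gamma> t)"
    "\<And>t. t \<in> {0..<T'} \<Longrightarrow> 4 * \<alpha> t * \<delta> t > R \<and> 4 * \<beta> t * \<gamma> t > P"
    "\<And>t. t \<in> {0..<T'} \<Longrightarrow> \<alpha> t = \<alpha>0 * sqrt (4 * \<alpha> t * \<delta> t / x0) \<and> \<beta> t = \<beta>0 * sqrt (4 * \<beta> t * \<gamma> t / y0) \<and>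
        \<gamma> t = \<gamma>0 * sqrt (4 * \<beta> t * \<gamma> t / y0) \<and> \<delta> t = \<delta>0 * sqrt (4 * \<alpha> t * \<delta> t / x0)"
    "\<And>t. t \<in> {0..<T'} \<Longrightarrow>
      \<exists>s\<ge>0. energy R (4 * \<alpha> t * \<delta> t) = energy R x0 + s \<and> energy P (4 * \<beta> t * \<gamma> t) = energy P y0 + s \<and> \<tau> s = t"
    if fl: "flow_solution_from M N \<alpha>0 \<beta>0 \<gamma>0 \<delta>0 T' \<alpha> \<beta> \<gamma> \<delta>" for T' \<alpha> \<beta> \<gamma> \<delta>
  proof -
    have f: "flow_solution M N T' \<alpha> \<beta> \<gamma> \<delta>" and z: "\<alpha> 0 = \<alpha>0" "\<beta> 0 = \<beta>0" "\<gamma> 0 = \<gamma>0" "\<delta> 0 = \<delta>0"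
      using fl by (auto simp: flow_solution_from_def)
    have i: "\<alpha> 0 * \<delta> 0 > 0" "\<beta> 0 * \<gamma> 0 > 0" "4 * \<alpha> 0 * \<delta> 0 > (M + N)\<^sup>2" "4 * \<beta> 0 * \<gamma> 0 > (M - N)\<^sup>2"
      using pos init by (simp_all add: z x0_def y0_def R_def P_def)
    note p = flow_solution_planar[OF f i]
    show 1: "planar_solution c R P T' (\<lambda>t. 4 * \<alpha> t * \<delta> t) (\<lambda>t. 4 * \<beta> t * \<gamma> t)"
      using p(1) by (simp add: c_def R_def P_def)
    show 2: "4 * \<alpha> t * \<delta> t > R \<and> 4 * \<beta> t * \<gamma> t > P" if "t \<in> {0..<T'}" for t
      using p(2)[OF that] by (simp add: R_def P_def)
    show "\<alpha> t = \<alpha>0 * sqrt (4 * \<alpha> t * \<delta> t / x0) \<and> \<beta> t = \<beta>0 * sqrt (4 * \<beta> t * \<gamma> t / y0) \<and>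
        \<gamma> t = \<gamma>0 * sqrt (4 * \<beta> t * \<gamma> t / y0) \<and> \<delta> t = \<delta>0 * sqrt (4 * \<alpha> t * \<delta> t / x0)" if "t \<in> {0..<T'}" for t
      using p(3)[OF that] by (simp only: z x0_def y0_def)
    show "\<exists>s\<ge>0. energy R (4 * \<alpha> t * \<delta> t) = energy R x0 + s \<and> energy P (4 * \<beta> t * \<gamma> t) = energy P y0 + s \<and> \<tau> s = t"
      if "t \<in> {0..<T'}" for t
      using clock[rule_format, OF 1 _ _ _ that] 2 by (simp add: z x0_def y0_def)
  qed
  show thesis
  proof (rule that[of T])
    show "max_existence_time M N \<alpha>0 \<beta>0 \<gamma>0 \<delta>0 T"
      unfolding max_existence_time_def
    proof (intro conjI allI impI notI)
      fix T' assume "T < T'" and "\<exists>\<alpha> \<beta> \<gamma> \<delta>. flow_solution_from M N \<alpha>0 \<beta>0 \<gamma>0 \<delta>0 T' \<alpha> \<beta> \<gamma> \<delta>"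
      then obtain \<alpha> \<beta> \<gamma> \<delta> where "flow_solution_from M N \<alpha>0 \<beta>0 \<gamma>0 \<delta>0 T' \<alpha> \<beta> \<gamma> \<delta>" by blast
      from planar(4)[OF this, of T] obtain s where "s \<ge> 0" "\<tau> s = T" using T \<open>T < T'\<close> by auto
      then show False using \<tau>(1) by fastforce
    qed (use T sol in blast)+
    fix \<alpha> \<beta> \<gamma> \<delta> assume fl: "flow_solution_from M N \<alpha>0 \<beta>0 \<gamma>0 \<delta>0 T \<alpha> \<beta> \<gamma> \<delta>"
    define x y where "x t = 4 * \<alpha> t * \<delta> t" and "y t = 4 * \<beta> t * \<gamma> t" for t
    have above: "x t > R" "y t > P" if "t \<in> {0..<T}" for t
      using planar(2)[OF fl that] by (simp_all add: x_def y_def)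
    have s: "\<exists>s\<ge>0. energy R (x t) = energy R x0 + s \<and> energy P (y t) = energy P y0 + s \<and> \<tau> s = t" if "t \<in> {0..<T}" for t
      using planar(4)[OF fl that] by (simp add: x_def y_def)
    have ev: "\<forall>\<^sub>F t in at_left T. t \<in> {0..<T}"
      using T eventually_at_left[of 0 T] by (auto intro!: exI[of _ 0])
    have xtop: "filterlim x at_top (at_left T)"
    proof (rule blowup_at_top[OF RP(1) init(1) T, of \<tau>])
      fix t assume "t \<in> {0..<T}"
      then show "x t > R \<and> (\<exists>s\<ge>0. energy R (x t) = energy R x0 + s \<and> \<tau> s = t)" using above s by blast
    qed (use \<tau> in blast)+
    have ytop: "filterlim y at_top (at_left T)"
    proof (rule blowup_at_top[OF RP(2) init(2) T, of \<tau>])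
      fix t assume "t \<in> {0..<T}"
      then show "y t > P \<and> (\<exists>s\<ge>0. energy P (y t) = energy P y0 + s \<and> \<tau> s = t)" using above s by blast
    qed (use \<tau> in blast)+
    have "\<forall>\<^sub>F t in at_left T. energy R (x t) = energy P (y t) + (energy R x0 - energy P y0)"
      using ev by eventually_elim (use s in force)
    then have ratio: "((\<lambda>t. y t / x t) \<longlongrightarrow> 1) (at_left T)" by (rule blowup_ratio[OF xtop ytop])
    have form: "\<forall>\<^sub>F t in at_left T. x t > 0 \<and> y t > 0 \<and> \<alpha> t = \<alpha>0 * sqrt (x t / x0) \<and>
        \<beta> t = \<beta>0 * sqrt (y t / y0) \<and> \<gamma> t = \<gamma>0 * sqrt (y t / y0) \<and> \<delta> t = \<delta>0 * sqrt (x t / x0)"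
      using ev
    proof eventually_elim
      case (elim t)
      then show ?case using planar(3)[OF fl elim] above[OF elim] RP by (simp add: x_def y_def)
    qed
    have quot: "((\<lambda>t. sqrt (y t / y0) / sqrt (x t / x0)) \<longlongrightarrow> sqrt (x0 / y0)) (at_left T)"
    proof -
      have "((\<lambda>t. sqrt (y t / x t * (x0 / y0))) \<longlongrightarrow> sqrt (1 * (x0 / y0))) (at_left T)"
        by (intro tendsto_intros ratio)
      then show ?thesis by (simp add: real_sqrt_divide[symmetric] mult_ac)
    qed
    have xy0: "sqrt (x0 / y0) = sqrt (\<alpha>0 * \<delta>0 / (\<beta>0 * \<gamma>0))" by (simp add: x0_def y0_def)
    have "((\<lambda>t. inverse \<alpha>0 * sqrt (x0 * inverse (x t))) \<longlongrightarrow> inverse \<alpha>0 * sqrt (x0 * 0)) (at_left T)"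
      by (intro tendsto_intros filterlim_compose[OF tendsto_inverse_0_at_top[OF filterlim_ident] xtop])
    moreover have "\<forall>\<^sub>F t in at_left T. inverse \<alpha>0 * sqrt (x0 * inverse (x t)) = inverse (\<alpha> t)"
      using form
    proof eventually_elim
      case (elim t)
      then have a: "\<alpha> t = \<alpha>0 * sqrt (x t / x0)" by blast
      have "inverse (x t / x0) = x0 * inverse (x t)" by (simp add: divide_inverse)
      then show ?case by (simp only: a inverse_mult_distrib real_sqrt_inverse[symmetric])
    qed
    ultimately have l1: "((\<lambda>t. inverse (\<alpha> t)) \<longlongrightarrow> 0) (at_left T)"
      by (simp add: Lim_transform_eventually)
    have l2: "((\<lambda>t. inverse (\<alpha> t) * \<alpha> t) \<longlongrightarrow> 1) (at_left T)"
    proof (rule Lim_transform_eventually[OF tendsto_const])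
      show "\<forall>\<^sub>F t in at_left T. 1 = inverse (\<alpha> t) * \<alpha> t"
        using form
      proof eventually_elim
        case (elim t)
        then have "sqrt (x t / x0) \<noteq> 0" "\<alpha> t = \<alpha>0 * sqrt (x t / x0)" using pos by auto
        then have "\<alpha> t \<noteq> 0" using \<alpha>0 by simp
        then show ?case by simp
      qed
    qed
    have l3: "((\<lambda>t. inverse (\<alpha> t) * f t) \<longlongrightarrow> f0 / \<alpha>0 * sqrt (x0 / y0)) (at_left T)"
      if "\<forall>\<^sub>F t in at_left T. f t = f0 * sqrt (y t / y0)" for f f0
    proof (rule Lim_transform_eventually)
      show "((\<lambda>t. f0 / \<alpha>0 * (sqrt (y t / y0) / sqrt (x t / x0))) \<longlongrightarrow> f0 / \<alpha>0 * sqrt (x0 / y0)) (at_left T)"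
        by (intro tendsto_intros quot)
      show "\<forall>\<^sub>F t in at_left T. f0 / \<alpha>0 * (sqrt (y t / y0) / sqrt (x t / x0)) = inverse (\<alpha> t) * f t"
        using form that by eventually_elim (simp add: divide_inverse)
    qed
    have l4: "((\<lambda>t. inverse (\<alpha> t) * \<delta> t) \<longlongrightarrow> \<delta>0 / \<alpha>0) (at_left T)"
    proof (rule Lim_transform_eventually[OF tendsto_const])
      show "\<forall>\<^sub>F t in at_left T. \<delta>0 / \<alpha>0 = inverse (\<alpha> t) * \<delta> t"
        using form
      proof eventually_elim
        case (elim t)
        then have "sqrt (x t / x0) \<noteq> 0" using pos by simp
        then show ?case using elim by (simp add: divide_inverse)
      qed
    qed
    have "\<forall>\<^sub>F t in at_left T. \<beta> t = \<beta>0 * sqrt (y t / y0)" "\<forall>\<^sub>F t in at_left T. \<gamma> t = \<gamma>0 * sqrt (y t / y0)"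
      using form by (auto elim: eventually_mono)
    then show "((\<lambda>t. inverse (\<alpha> t)) \<longlongrightarrow> 0) (at_left T) \<and>
      ((\<lambda>t. inverse (\<alpha> t) * \<alpha> t) \<longlongrightarrow> 1) (at_left T) \<and>
      ((\<lambda>t. inverse (\<alpha> t) * \<beta> t) \<longlongrightarrow> \<beta>0 / \<alpha>0 * sqrt (\<alpha>0 * \<delta>0 / (\<beta>0 * \<gamma>0))) (at_left T) \<and>
      ((\<lambda>t. inverse (\<alpha> t) * \<gamma> t) \<longlongrightarrow> \<gamma>0 / \<alpha>0 * sqrt (\<alpha>0 * \<delta>0 / (\<beta>0 * \<gamma>0))) (at_left T) \<and>
      ((\<lambda>t. inverse (\<alpha> t) * \<delta> t) \<longlongrightarrow> \<delta>0 / \<alpha>0) (at_left T)"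
      using l1 l2 l3 l4 unfolding xy0 by blast
  qed
qed

section \<open>Smooth convergence of left-invariant forms\<close>

text \<open>Coefficients of left-invariant tensors in the global coordinates are sums of exponentials of linear functions.
  This class is closed under partial derivatives, which only rescale the coefficients.\<close>

definition expsum :: "(real \<times> (real^6)) list \<Rightarrow> real^6 \<Rightarrow> real" where
  "expsum E p = (\<Sum>(a, l)\<leftarrow>E. a * exp (l \<bullet> p))"

lemma expsum_simps: "expsum [] p = 0" "expsum ((a, l) # E) p = a * exp (l \<bullet> p) + expsum E p"
  by (simp_all add: expsum_def)

lemma partial_expsum: "partial i (expsum E) = expsum (map (\<lambda>(a, l). (a * l $ i, l)) E)"
proof
  fix p
  have "((\<lambda>h. expsum E (p + h *\<^sub>R axis i 1)) has_real_derivative expsum (map (\<lambda>(a, l). (a * l $ i, l)) E) p) (at 0)"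
  proof (induction E)
    case (Cons e E)
    obtain a l where e: "e = (a, l)" by (cases e)
    show ?case unfolding e list.map prod.case expsum_simps
      by (rule DERIV_add[OF _ Cons]) (auto intro!: derivative_eq_intros simp: inner_add_right inner_axis)
  qed (simp add: expsum_simps)
  then show "partial i (expsum E) p = expsum (map (\<lambda>(a, l). (a * l $ i, l)) E) p"
    unfolding partial_def by (rule DERIV_imp_deriv)
qed

lemma partials_expsum: "partials js (expsum E) = expsum (map (\<lambda>(a, l). (a * (\<Prod>j\<leftarrow>js. l $ j), l)) E)"
proof (induction js)
  case (Cons j js)
  have "partials (j # js) (expsum E) = partial j (expsum (map (\<lambda>(a, l). (a * (\<Prod>j\<leftarrow>js. l $ j), l)) E))"
    by (simp add: Cons)
  then show ?case by (simp add: partial_expsum comp_def case_prod_beta mult_ac)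
qed simp

lemma smooth_fun_expsum: "smooth_fun (expsum E)"
proof -
  have "expsum E differentiable (at p)" for E p
  proof (induction E)
    case (Cons e E)
    obtain a l where e: "e = (a, l)" by (cases e)
    have "((\<lambda>p. a * exp (l \<bullet> p)) has_derivative (\<lambda>v. a * (exp (l \<bullet> p) * (l \<bullet> v)))) (at p)"
      by (auto intro!: derivative_eq_intros)
    then have "(\<lambda>p. a * exp (l \<bullet> p) + expsum E p) differentiable (at p)"
      by (intro differentiable_add Cons) (rule differentiableI)
    then show ?case by (simp add: e expsum_simps[abs_def])
  qed (simp add: expsum_def[abs_def])
  then show ?thesis by (simp add: smooth_fun_def partials_expsum)
qed

lemma uniform_limit_expsum:
  assumes "\<forall>(a, b, l)\<in>set L. (a \<longlongrightarrow> b) F" and C: "compact C"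
  shows "uniform_limit C (\<lambda>t. expsum (map (\<lambda>(a, b, l). (a t, l)) L)) (expsum (map (\<lambda>(a, b, l). (b, l)) L)) F"
  using assms(1)
proof (induction L)
  case Nil
  show ?case by (simp add: expsum_def[abs_def] uniform_limit_const)
next
  case (Cons e L)
  obtain a b l where e: "e = (a, b, l)" by (cases e)
  have a: "(a \<longlongrightarrow> b) F" using Cons.prems by (simp add: e)
  have "uniform_limit C (\<lambda>t p. a t) (\<lambda>p. b) F"
    by (rule uniform_limitI) (use tendstoD[OF a] in \<open>auto elim: eventually_mono\<close>)
  moreover have "bounded ((\<lambda>p. exp (l \<bullet> p)) ` C)"
    by (intro compact_imp_bounded compact_continuous_image C continuous_intros)
  moreover have "bounded ((\<lambda>p. b) ` C)" by (rule bounded_subset[of "{b}"]) auto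
  ultimately have "uniform_limit C (\<lambda>t p. a t * exp (l \<bullet> p)) (\<lambda>p. b * exp (l \<bullet> p)) F"
    by (intro uniform_lim_mult uniform_limit_const)
  moreover have "\<forall>(a, b, l)\<in>set L. (a \<longlongrightarrow> b) F" using Cons.prems by simp
  note Cons.IH[OF this]
  ultimately have "uniform_limit C (\<lambda>t p. a t * exp (l \<bullet> p) + expsum (map (\<lambda>(a, b, l). (a t, l)) L) p)
      (\<lambda>p. b * exp (l \<bullet> p) + expsum (map (\<lambda>(a, b, l). (b, l)) L) p) F"
    by (rule uniform_limit_add)
  then show ?case unfolding e list.map prod.case expsum_simps[abs_def] .
qed

text \<open>The linear function \<open>weight i\<close> as a vector, to match the exponents in \<open>expsum\<close>.\<close>

definition weight_vec :: "6 \<Rightarrow> real^6" where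
  "weight_vec i = (\<chi> j. weight i (axis j 1))"

lemma weight_eq: "weight i p = weight_vec i \<bullet> p"
proof -
  have "weight_vec i \<bullet> p = (\<Sum>j\<in>UNIV. weight i (axis j 1) * p $ j)"
    by (simp add: inner_vec_def weight_vec_def)
  then show ?thesis by (simp add: sum_6 weight_def axis_def)
qed

lemma wedges_coframe:
  "wedges (coframe p) is vs = exp ((\<Sum>i\<leftarrow>is. weight_vec i) \<bullet> p) * wedges (\<lambda>i. axis i 1) is vs"
proof (induction "is" arbitrary: vs)
  case (Cons i "is")
  have "one_form (coframe p i) = (\<lambda>vs. exp (weight_vec i \<bullet> p) * one_form (axis i 1) vs)"
    by (auto simp: coframe_def one_form_def weight_eq fun_eq_iff split: list.split)
  moreover have "wedges (coframe p) is = (\<lambda>vs. exp ((\<Sum>i\<leftarrow>is. weight_vec i) \<bullet> p) * wedges (\<lambda>i. axis i 1) is vs)"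
    using Cons by blast
  ultimately show ?case
    by (simp add: wedge_scale_left wedge_scale_right inner_add_left exp_add)
qed simp

lemma lincomb_coframe:
  "lincomb (coframe p) L vs = expsum (map (\<lambda>(c, is). (c * wedges (\<lambda>i. axis i 1) is vs, \<Sum>i\<leftarrow>is. weight_vec i)) L) p"
  by (induction L) (auto simp: lincomb_eval expsum_simps wedges_coframe simp del: wedges.simps)

text \<open>Partial derivatives of any order leave the exponents alone and multiply each coefficient by a constant. The
  exponentials are bounded on compact sets, so convergence of the coefficients is enough.\<close>

lemma smooth_limit_lincomb:
  assumes "\<forall>(a, b, is)\<in>set L. (a \<longlongrightarrow> b) F"
  shows "smooth_limit (\<lambda>t p. lincomb (coframe p) (map (\<lambda>(a, b, is). (a t, is)) L))
    (\<lambda>p. lincomb (coframe p) (map (\<lambda>(a, b, is). (b, is)) L)) F"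
  unfolding smooth_limit_def smooth_form_def
proof (intro conjI allI impI)
  show "smooth_fun (\<lambda>p. lincomb (coframe p) (map (\<lambda>(a, b, is). (b, is)) L) vs)" for vs
    unfolding lincomb_coframe by (rule smooth_fun_expsum)
  fix vs js and C :: "(real^6) set" assume C: "compact C"
  define K where "K = map (\<lambda>(a, b, is). let k = wedges (\<lambda>i. axis i 1) is vs; l = \<Sum>i\<leftarrow>is. weight_vec i;
      m = \<Prod>j\<leftarrow>js. l $ j in (\<lambda>t. a t * k * m, b * k * m, l)) L"
  have "\<forall>(a, b, l)\<in>set K. (a \<longlongrightarrow> b) F"
    using assms by (auto simp: K_def Let_def intro!: tendsto_mult_right)
  from uniform_limit_expsum[OF this C]
  show "uniform_limit C (\<lambda>t. partials js (\<lambda>p. lincomb (coframe p) (map (\<lambda>(a, b, is). (a t, is)) L) vs))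
     (partials js (\<lambda>p. lincomb (coframe p) (map (\<lambda>(a, b, is). (b, is)) L) vs)) F"
    by (simp add: lincomb_coframe partials_expsum K_def Let_def comp_def case_prod_beta del: wedges.simps)
qed

section \<open>The limit form in a rescaled and rotated coframe\<close>

text \<open>With \<open>s\<^sup>2 = \<gamma>\<close> and \<open>r\<^sup>2 = \<beta>\<close>, this coframe brings the limit form to its normal form and stays symplectic.\<close>

definition diag_frame :: "real \<Rightarrow> real \<Rightarrow> real^6 \<Rightarrow> 6 \<Rightarrow> real^6" where
  "diag_frame r s p i = (let e = coframe p in
     if i = 1 then (1 / s) *\<^sub>R e 1 else if i = 2 then s *\<^sub>R e 2
     else if i = 3 then (1 / r) *\<^sub>R e 3 else if i = 4 then r *\<^sub>R e 4
     else if i = 5 then (1 / sqrt 2) *\<^sub>R (e 5 + e 6) else (1 / sqrt 2) *\<^sub>R (e 6 - e 5))"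

lemma diag_frame_simps:
  "diag_frame r s p 1 = (1 / s) *\<^sub>R coframe p 1" "diag_frame r s p 2 = s *\<^sub>R coframe p 2"
  "diag_frame r s p 3 = (1 / r) *\<^sub>R coframe p 3" "diag_frame r s p 4 = r *\<^sub>R coframe p 4"
  "diag_frame r s p 5 = (1 / sqrt 2) *\<^sub>R (coframe p 5 + coframe p 6)"
  "diag_frame r s p 6 = (1 / sqrt 2) *\<^sub>R (coframe p 6 - coframe p 5)"
  by (simp_all add: diag_frame_def Let_def)

lemma coframe_inner: "coframe p i \<bullet> X = exp (weight i p) * X $ i"
  by (simp add: coframe_def inner_axis')

lemma coframe_basis_diag_frame:
  assumes "r > 0" "s > 0"
  shows "coframe_basis (diag_frame r s p)"
  unfolding coframe_basis_def
proof (intro allI impI)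
  fix Y assume h: "\<forall>i. diag_frame r s p i \<bullet> Y = 0"
  have "Y $ 1 = 0" "Y $ 2 = 0" "Y $ 3 = 0" "Y $ 4 = 0"
    using h[rule_format, of 1] h[rule_format, of 2] h[rule_format, of 3] h[rule_format, of 4] assms
    by (simp_all add: diag_frame_simps coframe_inner)
  moreover have "Y $ 5 + Y $ 6 = 0"
    using h[rule_format, of 5] by (simp add: diag_frame_simps coframe_inner inner_add_left weight_def)
  moreover have "Y $ 6 - Y $ 5 = 0"
    using h[rule_format, of 6] by (simp add: diag_frame_simps coframe_inner inner_diff_left weight_def)
  ultimately show "Y = 0" unfolding vec_eq_iff forall_6 by simp
qed

lemma std_omega_diag_frame:
  assumes "r > 0" "s > 0"
  shows "std_omega (diag_frame r s p) = omega p"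
proof
  fix vs :: "(real^6) list"
  have h: "(1 / sqrt 2) * a * ((1 / sqrt 2) * b) = a * b / 2" for a b :: real
    by (simp add: real_sqrt_mult_self field_simps)
  show "std_omega (diag_frame r s p) vs = omega p vs"
  proof (cases "length vs = 2")
    case True
    then obtain X Y where vs: "vs = [X, Y]" by (auto simp: length_Suc_conv numeral_2_eq_2)
    show ?thesis unfolding vs omega_eq std_omega_pair diag_frame_simps inner_scaleR_left h
      using assms by (simp add: inner_add_left inner_diff_left field_simps)
  next
    case False
    then show ?thesis by (simp add: omega_eq std_omega_def lincomb_eval wedges_length del: wedges.simps)
  qed
qed

lemma wedge_one_form_scale: "(one_form (k *\<^sub>R w) \<and>\<^sub>\<Lambda> b) = (\<lambda>vs. k * (one_form w \<and>\<^sub>\<Lambda> b) vs)"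
proof -
  have eq: "one_form (k *\<^sub>R w) = (\<lambda>vs. k * one_form w vs)" using one_form_linear[of k w 0 0] by simp
  show ?thesis by (rule ext) (simp only: eq wedge_scale_left)
qed

text \<open>In terms of \<open>f\<^sup>5\<close> and \<open>f\<^sup>6\<close> the sums are \<open>e\<^sup>5 + e\<^sup>6 = sqrt 2 f\<^sup>5\<close> and \<open>e\<^sup>5 - e\<^sup>6 = - sqrt 2 f\<^sup>6\<close>. The scalings of
  \<open>e\<^sup>1, ..., e\<^sup>4\<close> make the four coefficients equal in absolute value, which is possible exactly because \<open>\<delta> = \<beta>\<gamma>\<close>.\<close>

lemma ansatz_diag_frame:
  assumes "r > 0" "s > 0"
  shows "ansatz 0 0 1 (r\<^sup>2) (s\<^sup>2) (r\<^sup>2 * s\<^sup>2) (coframe p) = model_form (sqrt 2 * r * s) (diag_frame r s p)"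
proof
  fix vs
  let ?e = "coframe p" and ?f = "diag_frame r s p"
  have 5: "wedges ?f [5] = (\<lambda>vs. 1 / sqrt 2 * (wedges ?e [5] vs + wedges ?e [6] vs))"
    and 6: "wedges ?f [6] = (\<lambda>vs. 1 / sqrt 2 * (wedges ?e [6] vs - wedges ?e [5] vs))"
    unfolding wedges_single diag_frame_simps
    by (auto simp: fun_eq_iff one_form_def inner_add_left inner_diff_left split: list.split)
  have pair_factor: "wedges ?f [i, j, k] = (\<lambda>vs. a * (b * (one_form (?e i) \<and>\<^sub>\<Lambda> one_form (?e j) \<and>\<^sub>\<Lambda> wedges ?f [k]) vs))"
    if "?f i = a *\<^sub>R ?e i" "?f j = b *\<^sub>R ?e j" for i j k a b
    using that by (simp add: fun_eq_iff wedge_one_form_scale wedge_scale_right del: wedges.simps(2))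
       (simp add: wedge_one_form_scale wedge_scale_right)
  have e: "wedges ?e [i, j, k] = (one_form (?e i) \<and>\<^sub>\<Lambda> one_form (?e j) \<and>\<^sub>\<Lambda> wedges ?e [k])" for i j k by simp
  have sum: "(a \<and>\<^sub>\<Lambda> (\<lambda>vs. c * (x vs + y vs))) = (\<lambda>vs. c * ((a \<and>\<^sub>\<Lambda> x) vs + (a \<and>\<^sub>\<Lambda> y) vs))"
    "(a \<and>\<^sub>\<Lambda> (\<lambda>vs. c * (x vs - y vs))) = (\<lambda>vs. c * ((a \<and>\<^sub>\<Lambda> x) vs - (a \<and>\<^sub>\<Lambda> y) vs))" for a x y :: "(real^6) form" and c
    using wedge_add_right[of a x "\<lambda>vs. - y vs"]
    by (simp_all add: fun_eq_iff wedge_scale_right wedge_add_right wedge_minus_right)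
  have triples:
    "wedges ?f [1,3,5] vs = 1 / s * (1 / r * (1 / sqrt 2 * (wedges ?e [1,3,5] vs + wedges ?e [1,3,6] vs)))"
    "wedges ?f [1,4,6] vs = 1 / s * (r * (1 / sqrt 2 * (wedges ?e [1,4,6] vs - wedges ?e [1,4,5] vs)))"
    "wedges ?f [2,3,6] vs = s * (1 / r * (1 / sqrt 2 * (wedges ?e [2,3,6] vs - wedges ?e [2,3,5] vs)))"
    "wedges ?f [2,4,5] vs = s * (r * (1 / sqrt 2 * (wedges ?e [2,4,5] vs + wedges ?e [2,4,6] vs)))"
    unfolding pair_factor[OF diag_frame_simps(1) diag_frame_simps(3)] pair_factor[OF diag_frame_simps(1) diag_frame_simps(4)]
      pair_factor[OF diag_frame_simps(2) diag_frame_simps(3)] pair_factor[OF diag_frame_simps(2) diag_frame_simps(4)] 5 6 e sum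
    by (rule refl)+
  have coeff: "sqrt 2 * r * s * (1 / s * (1 / r * (1 / sqrt 2 * W))) = W"
    "sqrt 2 * r * s * (1 / s * (r * (1 / sqrt 2 * W))) = r\<^sup>2 * W"
    "sqrt 2 * r * s * (s * (1 / r * (1 / sqrt 2 * W))) = s\<^sup>2 * W"
    "sqrt 2 * r * s * (s * (r * (1 / sqrt 2 * W))) = r\<^sup>2 * s\<^sup>2 * W" for W
    using assms by (simp_all add: power2_eq_square)
  show "ansatz 0 0 1 (r\<^sup>2) (s\<^sup>2) (r\<^sup>2 * s\<^sup>2) ?e vs = model_form (sqrt 2 * r * s) ?f vs"
    unfolding ansatz_def model_form_def lincomb_eval triples mult_minus_left coeff
    by (simp add: algebra_simps del: wedges.simps)
qed

section \<open>Harmonicity of the limit almost complex structure\<close>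

text \<open>All matrices below are short combinations of matrix units, so products are computed with \<open>unit_mat_mult\<close>
  rather than entry by entry.\<close>

definition unit_mat :: "6 \<Rightarrow> 6 \<Rightarrow> real^6^6" where
  "unit_mat k j = (\<chi> m n. if m = k \<and> n = j then 1 else 0)"

lemma unit_mat_mult: "unit_mat k j ** unit_mat m n = (if j = m then unit_mat k n else 0)"
proof -
  have "(\<Sum>i\<in>UNIV. (if a \<and> i = j then 1 else 0) * (if i = m \<and> b then 1 else 0)) = (if a \<and> b \<and> j = m then 1 else (0 :: real))"
    for a b
    by (rule trans[OF sum.cong[OF refl, of _ _ "\<lambda>i. if i = j then (if a \<and> b \<and> j = m then 1 else 0) else 0"]]) auto
  then show ?thesis by (simp add: vec_eq_iff unit_mat_def matrix_matrix_mult_def)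
qed

lemma unit_mat_vector: "unit_mat k j *v X = X $ j *\<^sub>R axis k 1"
  by (simp add: vec_eq_iff unit_mat_def matrix_vector_mult_def axis_def if_distrib[of "\<lambda>x. x * _"] cong: if_cong)

lemma matrix_mult_bilinear:
  fixes A B :: "real^'n^'m" and C D :: "real^'p^'n"
  shows "(A + B) ** C = A ** C + B ** C" "(A - B) ** C = A ** C - B ** C" "(- A) ** C = - (A ** C)"
    "(k *\<^sub>R A) ** C = k *\<^sub>R (A ** C)"
    "A ** (C + D) = A ** C + A ** D" "A ** (C - D) = A ** C - A ** D" "A ** (- C) = - (A ** C)"
    "A ** (k *\<^sub>R C) = k *\<^sub>R (A ** C)"
  by (simp_all add: vec_eq_iff matrix_matrix_mult_def algebra_simps sum.distrib sum_subtractf sum_negf sum_distrib_left)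

definition limit_J :: "real \<Rightarrow> real \<Rightarrow> real^6^6" where
  "limit_J a b = a *\<^sub>R unit_mat 2 1 - inverse a *\<^sub>R unit_mat 1 2 + b *\<^sub>R unit_mat 4 3 - inverse b *\<^sub>R unit_mat 3 4
     + unit_mat 6 5 - unit_mat 5 6"

definition limit_g :: "real \<Rightarrow> real \<Rightarrow> real^6^6" where
  "limit_g a b = a *\<^sub>R unit_mat 1 1 + inverse a *\<^sub>R unit_mat 2 2 + b *\<^sub>R unit_mat 3 3 + inverse b *\<^sub>R unit_mat 4 4
     + unit_mat 5 5 + unit_mat 6 6"

lemma mat_1_eq: "mat 1 = unit_mat 1 1 + unit_mat 2 2 + unit_mat 3 3 + unit_mat 4 4 + unit_mat 5 5 + unit_mat 6 6"
  by (simp add: vec_eq_iff forall_6 mat_def unit_mat_def)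

lemma limit_g_nth:
  "limit_g a b $ m $ n = (if m = n then
     if m = 1 then a else if m = 2 then inverse a else if m = 3 then b else if m = 4 then inverse b else 1 else 0)"
proof -
  have "\<forall>m n. limit_g a b $ m $ n = (if m = n then
     if m = 1 then a else if m = 2 then inverse a else if m = 3 then b else if m = 4 then inverse b else 1 else 0)"
    unfolding forall_6 by (simp add: limit_g_def unit_mat_def)
  then show ?thesis by blast
qed

lemmas unit_mat_algebra = matrix_mult_bilinear unit_mat_mult

text \<open>In coordinates the diagonal entries of the limit metric are \<open>exp_growth 5 (1 / s\<^sup>2)\<close>, \<open>exp_growth 6 (1 / r\<^sup>2)\<close>,
  their inverses, and two constants \<open>1\<close>.\<close>

definition exp_growth :: "6 \<Rightarrow> real \<Rightarrow> real^6 \<Rightarrow> real" where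
  "exp_growth m k p = k * exp (2 * lam * p $ m)"

lemma exp_growth_pos: "k > 0 \<Longrightarrow> exp_growth m k p > 0"
  by (simp add: exp_growth_def)

lemma limit_J_nth_mult:
  "(limit_J a b *v X) $ 1 = - inverse a * X $ 2" "(limit_J a b *v X) $ 2 = a * X $ 1"
  "(limit_J a b *v X) $ 3 = - inverse b * X $ 4" "(limit_J a b *v X) $ 4 = b * X $ 3"
  "(limit_J a b *v X) $ 5 = - X $ 6" "(limit_J a b *v X) $ 6 = X $ 5"
  by (simp_all add: limit_J_def matrix_vector_mult_add_rdistrib matrix_vector_mult_diff_rdistrib unit_mat_vector axis_def
      flip: scaleR_matrix_vector_assoc)

lemma std_J_diag_frame:
  assumes "r > 0" "s > 0"
  shows "std_J (diag_frame r s p) (limit_J (exp_growth 5 (1 / s\<^sup>2) p) (exp_growth 6 (1 / r\<^sup>2) p))"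
  unfolding std_J_def
  using assms
  by (simp add: limit_J_nth_mult diag_frame_simps coframe_inner inner_add_left inner_diff_left
      weight_def exp_growth_def power2_eq_square exp_minus field_simps flip: exp_add)

lemma limit_tensors:
  fixes p :: "real^6"
  assumes r: "r > 0" and s: "s > 0"
    and \<psi>_def: "\<psi> = ansatz 0 0 1 (r\<^sup>2) (s\<^sup>2) (r\<^sup>2 * s\<^sup>2) (coframe p)"
  shows "Q_inv (omega p) \<psi> < 0"
    "J_endo (omega p) \<psi> = limit_J (exp_growth 5 (1 / s\<^sup>2) p) (exp_growth 6 (1 / r\<^sup>2) p)"
    "g_metric (omega p) \<psi> = limit_g (exp_growth 5 (1 / s\<^sup>2) p) (exp_growth 6 (1 / r\<^sup>2) p)"
proof -
  note b = coframe_basis_diag_frame[OF r s, of p]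
  have \<mu>: "sqrt 2 * r * s \<noteq> 0" using r s by simp
  have \<psi>: "\<psi> = model_form (sqrt 2 * r * s) (diag_frame r s p)"
    unfolding \<psi>_def by (rule ansatz_diag_frame[OF r s])
  have \<omega>: "omega p = std_omega (diag_frame r s p)" using std_omega_diag_frame[OF r s] by simp
  have "(sqrt 2 * r * s) ^ 4 > 0" using r s by simp
  then show "Q_inv (omega p) \<psi> < 0" unfolding \<psi> \<omega> Q_inv_model[OF b] by linarith
  show J: "J_endo (omega p) \<psi> = limit_J (exp_growth 5 (1 / s\<^sup>2) p) (exp_growth 6 (1 / r\<^sup>2) p)"
    unfolding \<psi> \<omega> by (rule J_endo_model[OF b \<mu> std_J_diag_frame[OF r s]])
  have w: "exp (weight 1 p) * exp (weight 2 p) = 1" "exp (weight 3 p) * exp (weight 4 p) = 1" "weight 5 p = 0" "weight 6 p = 0"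
    by (simp_all add: weight_def flip: exp_add)
  have o: "omega p [X, Y] = X $ 1 * Y $ 2 - X $ 2 * Y $ 1 + X $ 3 * Y $ 4 - X $ 4 * Y $ 3 + X $ 5 * Y $ 6 - X $ 6 * Y $ 5" for X Y
  proof -
    have "omega p [X, Y] = exp (weight 1 p) * exp (weight 2 p) * (X $ 1 * Y $ 2 - X $ 2 * Y $ 1)
      + exp (weight 3 p) * exp (weight 4 p) * (X $ 3 * Y $ 4 - X $ 4 * Y $ 3) + (X $ 5 * Y $ 6 - X $ 6 * Y $ 5)"
      unfolding omega_eq std_omega_pair coframe_inner by (simp add: w(3,4) algebra_simps)
    then show ?thesis by (simp add: w)
  qed
  show "g_metric (omega p) \<psi> = limit_g (exp_growth 5 (1 / s\<^sup>2) p) (exp_growth 6 (1 / r\<^sup>2) p)"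
    unfolding g_metric_def J o limit_J_nth_mult vec_eq_iff forall_6
    by (simp add: limit_g_nth) (simp add: axis_def)
qed

lemma partial_const: "partial i (\<lambda>q. c) p = 0"
  by (simp add: partial_def)

lemma smooth_fun_simps:
  "smooth_fun (exp_growth m k)" "smooth_fun (\<lambda>p. inverse (exp_growth m k p))" "smooth_fun (\<lambda>p. - inverse (exp_growth m k p))"
  "smooth_fun (\<lambda>p. c)"
proof -
  have "exp_growth m k = expsum [(k, (2 * lam) *\<^sub>R axis m 1)]"
    "(\<lambda>p. inverse (exp_growth m k p)) = expsum [(inverse k, - (2 * lam) *\<^sub>R axis m 1)]"
    "(\<lambda>p. - inverse (exp_growth m k p)) = expsum [(- inverse k, - (2 * lam) *\<^sub>R axis m 1)]"
    "(\<lambda>p. c) = expsum [(c, 0)]"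
    by (simp_all add: fun_eq_iff exp_growth_def expsum_simps inner_axis' exp_minus)
  then show "smooth_fun (exp_growth m k)" "smooth_fun (\<lambda>p. inverse (exp_growth m k p))"
    "smooth_fun (\<lambda>p. - inverse (exp_growth m k p))" "smooth_fun (\<lambda>p. c)"
    by (simp_all only: smooth_fun_expsum)
qed

lemma DERIV_exp_growth:
  "((\<lambda>h. exp_growth m k (p + h *\<^sub>R axis i 1)) has_real_derivative (if i = m then 2 * lam * exp_growth m k p else 0)) (at 0)"
  by (auto simp: exp_growth_def axis_def intro!: derivative_eq_intros)

lemma partial_exp_growth:
  assumes "k > 0"
  shows "partial i (exp_growth m k) p = (if i = m then 2 * lam * exp_growth m k p else 0)"
    "partial i (\<lambda>q. inverse (exp_growth m k q)) p = (if i = m then - 2 * lam * inverse (exp_growth m k p) else 0)"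
    "partial i (\<lambda>q. - inverse (exp_growth m k q)) p = (if i = m then 2 * lam * inverse (exp_growth m k p) else 0)"
proof -
  have n: "exp_growth m k (p + 0 *\<^sub>R axis i 1) \<noteq> 0" using exp_growth_pos[OF assms, of m p] by simp
  have inv: "((\<lambda>h. inverse (exp_growth m k (p + h *\<^sub>R axis i 1))) has_real_derivative
      (if i = m then - 2 * lam * inverse (exp_growth m k p) else 0)) (at 0)"
    by (rule DERIV_cong[OF DERIV_inverse_fun[OF DERIV_exp_growth n]])
       (use exp_growth_pos[OF assms, of m p] in \<open>simp add: power2_eq_square field_simps\<close>)
  show "partial i (exp_growth m k) p = (if i = m then 2 * lam * exp_growth m k p else 0)"
    unfolding partial_def by (rule DERIV_imp_deriv[OF DERIV_exp_growth])
  show "partial i (\<lambda>q. inverse (exp_growth m k q)) p = (if i = m then - 2 * lam * inverse (exp_growth m k p) else 0)"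
    unfolding partial_def by (rule DERIV_imp_deriv[OF inv])
  show "partial i (\<lambda>q. - inverse (exp_growth m k q)) p = (if i = m then 2 * lam * inverse (exp_growth m k p) else 0)"
    unfolding partial_def using DERIV_imp_deriv[OF DERIV_minus[OF inv]] by simp
qed

lemma matrix_inv_eqI:
  fixes A B :: "real^'n^'n"
  assumes "A ** B = mat 1" "B ** A = mat 1"
  shows "matrix_inv A = B"
  unfolding matrix_inv_def
proof (rule some_equality)
  fix C assume C: "A ** C = mat 1 \<and> C ** A = mat 1"
  have "C = C ** (A ** B)" using assms by simp
  also have "\<dots> = B" using C by (simp add: matrix_mul_assoc)
  finally show "C = B" .
qed (use assms in simp)

lemma matrix_inv_limit_g:
  assumes "a \<noteq> 0" "b \<noteq> 0"
  shows "matrix_inv (limit_g a b) = limit_g (inverse a) (inverse b)"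
  by (rule matrix_inv_eqI) (use assms in \<open>simp_all add: limit_g_def unit_mat_algebra mat_1_eq\<close>)

text \<open>The Christoffel matrices of \<open>diag(a, 1/a, b, 1/b, 1, 1)\<close> when \<open>a\<close> and \<open>b\<close> have logarithmic derivative \<open>2\<lambda>\<close> along
  the coordinates \<open>5\<close> and \<open>6\<close>, respectively.\<close>

definition limit_christoffel :: "real \<Rightarrow> real \<Rightarrow> 6 \<Rightarrow> real^6^6" where
  "limit_christoffel a b i = lam *\<^sub>R (
     if i = 1 then unit_mat 1 5 - a *\<^sub>R unit_mat 5 1
     else if i = 2 then inverse a *\<^sub>R unit_mat 5 2 - unit_mat 2 5
     else if i = 3 then unit_mat 3 6 - b *\<^sub>R unit_mat 6 3
     else if i = 4 then inverse b *\<^sub>R unit_mat 6 4 - unit_mat 4 6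
     else if i = 5 then unit_mat 1 1 - unit_mat 2 2
     else unit_mat 3 3 - unit_mat 4 4)"

text \<open>The covariant derivatives of the limit \<open>J\<close>. In the directions \<open>5\<close> and \<open>6\<close> the derivative of the entries
  cancels the commutator with the Christoffel matrix.\<close>

definition limit_cov :: "real \<Rightarrow> real \<Rightarrow> 6 \<Rightarrow> real^6^6" where
  "limit_cov a b i = lam *\<^sub>R (
     if i = 1 then unit_mat 5 2 - unit_mat 1 6 + a *\<^sub>R (unit_mat 6 1 - unit_mat 2 5)
     else if i = 2 then unit_mat 2 6 + unit_mat 5 1 - inverse a *\<^sub>R (unit_mat 1 5 + unit_mat 6 2)
     else if i = 3 then unit_mat 3 5 + unit_mat 6 4 - b *\<^sub>R (unit_mat 4 6 + unit_mat 5 3)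
     else if i = 4 then unit_mat 6 3 - unit_mat 4 5 + inverse b *\<^sub>R (unit_mat 5 4 - unit_mat 3 6)
     else 0)"

context
  fixes k l :: real
  assumes kl: "k > 0" "l > 0"
begin

lemma partial_limit_g:
  "partial i (\<lambda>q. limit_g (exp_growth 5 k q) (exp_growth 6 l q) $ m $ n) p = (if m = n then
     (if i = 5 \<and> m = 1 then 2 * lam * exp_growth 5 k p else if i = 5 \<and> m = 2 then - 2 * lam * inverse (exp_growth 5 k p)
      else if i = 6 \<and> m = 3 then 2 * lam * exp_growth 6 l p else if i = 6 \<and> m = 4 then - 2 * lam * inverse (exp_growth 6 l p) else 0) else 0)"
proof (cases "m = n")
  case True
  have "\<forall>m. partial i (\<lambda>q. limit_g (exp_growth 5 k q) (exp_growth 6 l q) $ m $ m) p =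
     (if i = 5 \<and> m = 1 then 2 * lam * exp_growth 5 k p else if i = 5 \<and> m = 2 then - 2 * lam * inverse (exp_growth 5 k p)
      else if i = 6 \<and> m = 3 then 2 * lam * exp_growth 6 l p else if i = 6 \<and> m = 4 then - 2 * lam * inverse (exp_growth 6 l p) else 0)"
    unfolding forall_6 by (simp add: limit_g_nth partial_const partial_exp_growth kl)
  with True show ?thesis by simp
next
  case False
  then show ?thesis by (simp add: limit_g_nth partial_const)
qed

lemma christoffel_limit:
  "christoffel (\<lambda>q. limit_g (exp_growth 5 k q) (exp_growth 6 l q)) i p = limit_christoffel (exp_growth 5 k p) (exp_growth 6 l p) i"
proof -
  have nz: "exp_growth 5 k p \<noteq> 0" "exp_growth 6 l p \<noteq> 0" using exp_growth_pos kl by (simp_all add: less_imp_neq[symmetric])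
  let ?a = "exp_growth 5 k p" and ?b = "exp_growth 6 l p"
  define dg where "dg i m = (if i = 5 \<and> m = 1 then 2 * lam * ?a else if i = 5 \<and> m = 2 then - 2 * lam * inverse ?a
      else if i = 6 \<and> m = 3 then 2 * lam * ?b else if i = 6 \<and> m = 4 then - 2 * lam * inverse ?b else 0)" for i m :: 6
  have pg: "partial i (\<lambda>q. limit_g (exp_growth 5 k q) (exp_growth 6 l q) $ m $ n) p = (if m = n then dg i m else 0)" for i m n
    unfolding partial_limit_g dg_def ..
  have diag: "(\<Sum>n\<in>UNIV. limit_g (inverse ?a) (inverse ?b) $ m $ n * f n) = limit_g (inverse ?a) (inverse ?b) $ m $ m * f m" for m f
    by (rule trans[OF sum.cong[OF refl, of _ _ "\<lambda>n. if m = n then limit_g (inverse ?a) (inverse ?b) $ m $ m * f m else 0"]])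
       (auto simp: limit_g_nth)
  have "christoffel (\<lambda>q. limit_g (exp_growth 5 k q) (exp_growth 6 l q)) i p = (\<chi> m j. 1 / 2 * (limit_g (inverse ?a) (inverse ?b) $ m $ m *
     ((if j = m then dg i j else 0) + (if i = m then dg j i else 0) - (if i = j then dg m i else 0))))"
    unfolding christoffel_def matrix_inv_limit_g[OF nz] pg diag ..
  also have "\<dots> = limit_christoffel ?a ?b i"
  proof -
    have "\<forall>i. (\<chi> m j. 1 / 2 * (limit_g (inverse ?a) (inverse ?b) $ m $ m *
       ((if j = m then dg i j else 0) + (if i = m then dg j i else 0) - (if i = j then dg m i else 0)))) = limit_christoffel ?a ?b i"
      unfolding forall_6 vec_eq_iff
      by (simp add: limit_g_nth limit_christoffel_def unit_mat_def dg_def nz)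
    then show ?thesis by blast
  qed
  finally show ?thesis .
qed

lemma cov_limit:
  "cov (\<lambda>q. limit_g (exp_growth 5 k q) (exp_growth 6 l q)) (\<lambda>q. limit_J (exp_growth 5 k q) (exp_growth 6 l q)) i p
     = limit_cov (exp_growth 5 k p) (exp_growth 6 l p) i"
proof -
  have nz: "exp_growth 5 k p \<noteq> 0" "exp_growth 6 l p \<noteq> 0" using exp_growth_pos kl by (simp_all add: less_imp_neq[symmetric])
  define dJ where "dJ i = (if i = 5 then (2 * lam) *\<^sub>R (exp_growth 5 k p *\<^sub>R unit_mat 2 1 + inverse (exp_growth 5 k p) *\<^sub>R unit_mat 1 2)
     else if i = 6 then (2 * lam) *\<^sub>R (exp_growth 6 l p *\<^sub>R unit_mat 4 3 + inverse (exp_growth 6 l p) *\<^sub>R unit_mat 3 4) else 0)" for i :: 6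
  have "partial_mat i (\<lambda>q. limit_J (exp_growth 5 k q) (exp_growth 6 l q)) p = dJ i"
    unfolding vec_eq_iff forall_6
    by (simp add: partial_mat_def limit_J_def unit_mat_def dJ_def partial_const partial_exp_growth kl)
  moreover have "\<forall>i. dJ i + limit_christoffel (exp_growth 5 k p) (exp_growth 6 l p) i ** limit_J (exp_growth 5 k p) (exp_growth 6 l p)
      - limit_J (exp_growth 5 k p) (exp_growth 6 l p) ** limit_christoffel (exp_growth 5 k p) (exp_growth 6 l p) i
     = limit_cov (exp_growth 5 k p) (exp_growth 6 l p) i"
    unfolding forall_6
    by (simp add: dJ_def limit_J_def limit_christoffel_def limit_cov_def unit_mat_algebra nz)
       (simp add: vec_eq_iff forall_6 unit_mat_def nz)
  ultimately show ?thesis unfolding cov_def christoffel_limit by (simp only:)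
qed

text \<open>The matrix \<open>\<nabla>\<^sub>iJ\<close> is constant along the coordinate \<open>i\<close>, and the correction terms of the second covariant
  derivative only involve \<open>\<nabla>\<^sub>5J = \<nabla>\<^sub>6J = 0\<close>. What remains is the double commutator of the Christoffel matrices with \<open>J\<close>. The
  mixed terms \<open>\<Gamma>\<^sub>i J \<Gamma>\<^sub>i\<close> vanish because \<open>\<Gamma>\<^sub>i\<close> couples the coordinate \<open>i \<le> 4\<close> only with \<open>5\<close> or \<open>6\<close>, while \<open>J\<close> has
  no entry between these two coordinates and none on the diagonal.\<close>

lemma limit_rough_laplacian:
  "rough_laplacian (\<lambda>q. limit_g (exp_growth 5 k q) (exp_growth 6 l q)) (\<lambda>q. limit_J (exp_growth 5 k q) (exp_growth 6 l q)) p
     = (2 * lam\<^sup>2) *\<^sub>R ((unit_mat 1 1 + unit_mat 2 2 + unit_mat 3 3 + unit_mat 4 4 + 2 *\<^sub>R (unit_mat 5 5 + unit_mat 6 6)) ** limit_J (exp_growth 5 k p) (exp_growth 6 l p))"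
proof -
  let ?g = "\<lambda>q. limit_g (exp_growth 5 k q) (exp_growth 6 l q)" and ?J = "\<lambda>q. limit_J (exp_growth 5 k q) (exp_growth 6 l q)"
  let ?a = "exp_growth 5 k p" and ?b = "exp_growth 6 l p"
  have nz: "?a \<noteq> 0" "?b \<noteq> 0" using exp_growth_pos kl by (simp_all add: less_imp_neq[symmetric])
  have dcov: "partial_mat i (cov ?g ?J i) p = 0" for i
  proof -
    have "\<forall>i. limit_cov (exp_growth 5 k (p + h *\<^sub>R axis i 1)) (exp_growth 6 l (p + h *\<^sub>R axis i 1)) i = limit_cov ?a ?b i" for h
      unfolding forall_6 by (simp add: exp_growth_def axis_def limit_cov_def)
    then have "cov ?g ?J i (p + h *\<^sub>R axis i 1) = cov ?g ?J i p" for h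
      unfolding cov_limit by blast
    then show ?thesis by (simp add: partial_mat_def partial_def vec_eq_iff)
  qed
  have diag: "(\<Sum>n\<in>UNIV. limit_g (inverse ?a) (inverse ?b) $ m $ n *\<^sub>R f n) = limit_g (inverse ?a) (inverse ?b) $ m $ m *\<^sub>R f m"
    for m and f :: "6 \<Rightarrow> real^6^6"
    by (rule trans[OF sum.cong[OF refl, of _ _ "\<lambda>n. if m = n then limit_g (inverse ?a) (inverse ?b) $ m $ m *\<^sub>R f m else 0"]])
       (auto simp: limit_g_nth)
  have z: "limit_cov ?a ?b 5 = 0" "limit_cov ?a ?b 6 = 0"
    by (simp_all add: limit_cov_def vec_eq_iff)
  have "\<forall>i. (\<Sum>m\<in>UNIV. limit_christoffel ?a ?b i $ m $ i *\<^sub>R limit_cov ?a ?b m) = 0"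
    unfolding forall_6 by (simp add: sum_6 z limit_christoffel_def unit_mat_def)
  then have cross: "(\<Sum>m\<in>UNIV. limit_christoffel ?a ?b i $ m $ i *\<^sub>R limit_cov ?a ?b m) = 0" for i by blast
  have "rough_laplacian ?g ?J p = - (\<Sum>i\<in>UNIV. limit_g (inverse ?a) (inverse ?b) $ i $ i *\<^sub>R
      (limit_christoffel ?a ?b i ** limit_cov ?a ?b i - limit_cov ?a ?b i ** limit_christoffel ?a ?b i))"
    unfolding rough_laplacian_def matrix_inv_limit_g[OF nz] diag cov2_def dcov christoffel_limit cov_limit cross by simp
  also have "\<dots> = (2 * lam\<^sup>2) *\<^sub>R ((unit_mat 1 1 + unit_mat 2 2 + unit_mat 3 3 + unit_mat 4 4 + 2 *\<^sub>R (unit_mat 5 5 + unit_mat 6 6)) ** limit_J ?a ?b)"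
    by (simp add: sum_6 limit_J_def limit_christoffel_def limit_cov_def unit_mat_algebra mat_1_eq limit_g_nth)
       (simp add: vec_eq_iff forall_6 unit_mat_def nz power2_eq_square)
  finally show ?thesis .
qed

lemma harmonic_limit:
  "harmonic_acs (\<lambda>q. limit_g (exp_growth 5 k q) (exp_growth 6 l q)) (\<lambda>q. limit_J (exp_growth 5 k q) (exp_growth 6 l q))"
proof -
  have pos: "exp_growth 5 k p > 0" "exp_growth 6 l p > 0" for p using exp_growth_pos kl by simp_all
  have nz: "exp_growth 5 k p \<noteq> 0" "exp_growth 6 l p \<noteq> 0" for p using pos[of p] by simp_all
  have smooth: "smooth_mat (\<lambda>q. limit_g (exp_growth 5 k q) (exp_growth 6 l q))" "smooth_mat (\<lambda>q. limit_J (exp_growth 5 k q) (exp_growth 6 l q))"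
    unfolding smooth_mat_def forall_6 by (simp_all add: limit_g_nth limit_J_def unit_mat_def smooth_fun_simps)
  have sym: "transpose (limit_g a b) = limit_g a b" for a b
    by (auto simp: transpose_def limit_g_nth vec_eq_iff)
  have posdef: "v \<bullet> (limit_g (exp_growth 5 k p) (exp_growth 6 l p) *v v) > 0" if "v \<noteq> 0" for p v
  proof -
    define d where "d i = limit_g (exp_growth 5 k p) (exp_growth 6 l p) $ i $ i" for i
    have d: "d i > 0" for i using pos[of p] by (simp add: d_def limit_g_nth)
    have "v \<bullet> (limit_g (exp_growth 5 k p) (exp_growth 6 l p) *v v) = (\<Sum>i\<in>UNIV. d i * (v $ i)\<^sup>2)"
      by (simp add: inner_vec_def matrix_vector_mult_def sum_6 limit_g_nth d_def power2_eq_square mult_ac)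
    also obtain i where "v $ i \<noteq> 0" using \<open>v \<noteq> 0\<close> by (auto simp: vec_eq_iff)
    then have "(\<Sum>i\<in>UNIV. d i * (v $ i)\<^sup>2) > 0"
      using d by (intro sum_pos2[of _ i]) (auto simp: less_imp_le)
    finally show ?thesis .
  qed
  have orth: "limit_J a b ** limit_J a b = - mat 1" "transpose (limit_J a b) ** limit_g a b ** limit_J a b = limit_g a b"
    if "a \<noteq> 0" "b \<noteq> 0" for a b
  proof -
    have "transpose (limit_J a b) = a *\<^sub>R unit_mat 1 2 - inverse a *\<^sub>R unit_mat 2 1 + b *\<^sub>R unit_mat 3 4 - inverse b *\<^sub>R unit_mat 4 3
      + unit_mat 5 6 - unit_mat 6 5"
      by (auto simp: vec_eq_iff transpose_def limit_J_def unit_mat_def)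
    then show "limit_J a b ** limit_J a b = - mat 1" "transpose (limit_J a b) ** limit_g a b ** limit_J a b = limit_g a b"
      using that by (simp_all add: limit_J_def limit_g_def unit_mat_algebra mat_1_eq)
  qed
  have comm: "limit_J a b ** R - R ** limit_J a b = 0"
    if "R = c *\<^sub>R ((unit_mat 1 1 + unit_mat 2 2 + unit_mat 3 3 + unit_mat 4 4 + 2 *\<^sub>R (unit_mat 5 5 + unit_mat 6 6)) ** limit_J a b)" for R a b c
    unfolding that by (simp add: limit_J_def unit_mat_algebra mat_1_eq) (simp add: algebra_simps)
  show ?thesis
    unfolding harmonic_acs_def riemannian_metric_def orthogonal_acs_def
  proof (intro conjI allI impI)
    fix p
    show "limit_J (exp_growth 5 k p) (exp_growth 6 l p) ** rough_laplacian (\<lambda>q. limit_g (exp_growth 5 k q) (exp_growth 6 l q))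
          (\<lambda>q. limit_J (exp_growth 5 k q) (exp_growth 6 l q)) p
        - rough_laplacian (\<lambda>q. limit_g (exp_growth 5 k q) (exp_growth 6 l q)) (\<lambda>q. limit_J (exp_growth 5 k q) (exp_growth 6 l q)) p
          ** limit_J (exp_growth 5 k p) (exp_growth 6 l p) = 0"
      by (rule comm[OF limit_rough_laplacian])
  qed (use smooth sym posdef orth nz in simp_all)
qed

end

section \<open>Finite-time singularity and the rescaled limit\<close>

theorem proposition5p6:
  fixes M N \<alpha>0 \<beta>0 \<gamma>0 \<delta>0 \<mu> :: real
  assumes "\<mu> > 0"
    and "\<And>p. orbit_minus_plus \<mu> (omega p) (phi M N \<alpha>0 \<beta>0 \<gamma>0 \<delta>0 p)"
  shows "\<exists>T. max_existence_time M N \<alpha>0 \<beta>0 \<gamma>0 \<delta>0 T \<and>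
    (\<forall>\<alpha> \<beta> \<gamma> \<delta>. flow_solution_from M N \<alpha>0 \<beta>0 \<gamma>0 \<delta>0 T \<alpha> \<beta> \<gamma> \<delta> \<longrightarrow>
      (\<exists>\<phi>lim.
        smooth_limit (\<lambda>t p vs. inverse (\<alpha> t) * phi M N (\<alpha> t) (\<beta> t) (\<gamma> t) (\<delta> t) p vs) \<phi>lim (at_left T) \<and>
        (\<forall>p. Q_inv (omega p) (\<phi>lim p) < 0) \<and>
        harmonic_acs (\<lambda>p. g_metric (omega p) (\<phi>lim p)) (\<lambda>p. J_endo (omega p) (\<phi>lim p))))"
proof -
  have "orbit_minus_plus \<mu> (std_omega (coframe 0)) (ansatz M N \<alpha>0 \<beta>0 \<gamma>0 \<delta>0 (coframe 0))"
    using assms(2)[of 0] by (simp only: omega_eq phi_eq)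
  note con = orbit_constraints[OF coframe_basis_coframe assms(1) this]
  have sgn: "\<alpha>0 * \<delta>0 > 0" "\<beta>0 * \<gamma>0 > 0" "\<beta>0 / \<alpha>0 > 0" "\<gamma>0 / \<alpha>0 > 0"
    using con(1-3) by (auto simp: zero_less_mult_iff zero_less_divide_iff)
  define \<kappa> where "\<kappa> = sqrt (\<alpha>0 * \<delta>0 / (\<beta>0 * \<gamma>0))"
  have \<kappa>: "\<kappa> > 0" "\<kappa> * \<kappa> = \<alpha>0 * \<delta>0 / (\<beta>0 * \<gamma>0)"
    using sgn by (simp_all only: \<kappa>_def real_sqrt_gt_0_iff divide_pos_pos real_sqrt_mult_self abs_of_pos)
  \<comment> \<open>The coefficients of the limit are \<open>\<beta> = r\<^sup>2\<close>, \<open>\<gamma> = s\<^sup>2\<close> and \<open>\<delta> = r\<^sup>2 s\<^sup>2\<close>.\<close>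
  define r s where "r = sqrt (\<beta>0 / \<alpha>0 * \<kappa>)" and "s = sqrt (\<gamma>0 / \<alpha>0 * \<kappa>)"
  have rs: "r > 0" "s > 0"
    using sgn \<kappa> by (simp_all only: r_def s_def real_sqrt_gt_0_iff mult_pos_pos)
  have rs2: "r\<^sup>2 = \<beta>0 / \<alpha>0 * \<kappa>" "s\<^sup>2 = \<gamma>0 / \<alpha>0 * \<kappa>"
    using sgn \<kappa> by (simp_all only: r_def s_def real_sqrt_pow2 less_imp_le mult_pos_pos)
  have "r\<^sup>2 * s\<^sup>2 = (\<beta>0 / \<alpha>0) * (\<gamma>0 / \<alpha>0) * (\<kappa> * \<kappa>)" by (simp only: rs2 mult_ac)
  also have "\<dots> = \<delta>0 / \<alpha>0" unfolding \<kappa>(2) using sgn by (auto simp: divide_simps)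
  finally have delta: "r\<^sup>2 * s\<^sup>2 = \<delta>0 / \<alpha>0" .
  define \<psi> where "\<psi> p = ansatz 0 0 1 (r\<^sup>2) (s\<^sup>2) (r\<^sup>2 * s\<^sup>2) (coframe p)" for p
  have tensors: "Q_inv (omega p) (\<psi> p) < 0"
    "J_endo (omega p) (\<psi> p) = limit_J (exp_growth 5 (1 / s\<^sup>2) p) (exp_growth 6 (1 / r\<^sup>2) p)"
    "g_metric (omega p) (\<psi> p) = limit_g (exp_growth 5 (1 / s\<^sup>2) p) (exp_growth 6 (1 / r\<^sup>2) p)" for p
    using limit_tensors[OF rs \<psi>_def] by blast+
  have harmonic: "harmonic_acs (\<lambda>p. g_metric (omega p) (\<psi> p)) (\<lambda>p. J_endo (omega p) (\<psi> p))"
    unfolding tensors by (rule harmonic_limit) (use rs in simp_all)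
  obtain T where T: "max_existence_time M N \<alpha>0 \<beta>0 \<gamma>0 \<delta>0 T"
    and lim: "\<And>\<alpha> \<beta> \<gamma> \<delta>. flow_solution_from M N \<alpha>0 \<beta>0 \<gamma>0 \<delta>0 T \<alpha> \<beta> \<gamma> \<delta> \<Longrightarrow>
      ((\<lambda>t. inverse (\<alpha> t)) \<longlongrightarrow> 0) (at_left T) \<and>
      ((\<lambda>t. inverse (\<alpha> t) * \<alpha> t) \<longlongrightarrow> 1) (at_left T) \<and>
      ((\<lambda>t. inverse (\<alpha> t) * \<beta> t) \<longlongrightarrow> \<beta>0 / \<alpha>0 * \<kappa>) (at_left T) \<and>
      ((\<lambda>t. inverse (\<alpha> t) * \<gamma> t) \<longlongrightarrow> \<gamma>0 / \<alpha>0 * \<kappa>) (at_left T) \<and>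
      ((\<lambda>t. inverse (\<alpha> t) * \<delta> t) \<longlongrightarrow> \<delta>0 / \<alpha>0) (at_left T)"
    by (rule flow_blowup[OF con, folded \<kappa>_def]) (rule that; assumption)
  show ?thesis
  proof (intro exI[of _ T] conjI T allI impI)
    fix \<alpha> \<beta> \<gamma> \<delta> assume "flow_solution_from M N \<alpha>0 \<beta>0 \<gamma>0 \<delta>0 T \<alpha> \<beta> \<gamma> \<delta>"
    from lim[OF this] have l: "((\<lambda>t. inverse (\<alpha> t)) \<longlongrightarrow> 0) (at_left T)"
      "((\<lambda>t. inverse (\<alpha> t) * \<alpha> t) \<longlongrightarrow> 1) (at_left T)"
      "((\<lambda>t. inverse (\<alpha> t) * \<beta> t) \<longlongrightarrow> r\<^sup>2) (at_left T)"
      "((\<lambda>t. inverse (\<alpha> t) * \<gamma> t) \<longlongrightarrow> s\<^sup>2) (at_left T)"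
      "((\<lambda>t. inverse (\<alpha> t) * \<delta> t) \<longlongrightarrow> r\<^sup>2 * s\<^sup>2) (at_left T)"
      unfolding delta by (simp_all only: rs2)
    let ?i = "\<lambda>t. inverse (\<alpha> t)"
    \<comment> \<open>Each entry lists a coefficient of the rescaled form, its limit, and its monomial.\<close>
    define L where "L = [(\<lambda>t. ?i t * \<alpha> t, 1, [1,3,5::6]), (\<lambda>t. ?i t * \<alpha> t, 1, [1,3,6]),
      (\<lambda>t. ?i t * \<beta> t, r\<^sup>2, [1,4,5]), (\<lambda>t. - (?i t * \<beta> t), - (r\<^sup>2), [1,4,6]),
      (\<lambda>t. ?i t * \<gamma> t, s\<^sup>2, [2,3,5]), (\<lambda>t. - (?i t * \<gamma> t), - (s\<^sup>2), [2,3,6]),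
      (\<lambda>t. - (?i t * \<delta> t), - (r\<^sup>2 * s\<^sup>2), [2,4,5]), (\<lambda>t. - (?i t * \<delta> t), - (r\<^sup>2 * s\<^sup>2), [2,4,6]),
      (\<lambda>t. ?i t * M, 0 * M, [5,1,2]), (\<lambda>t. - (?i t * M), - (0 * M), [5,3,4]),
      (\<lambda>t. ?i t * N, 0 * N, [6,1,2]), (\<lambda>t. - (?i t * N), - (0 * N), [6,3,4])]"
    have conv: "\<forall>(a, b, is)\<in>set L. (a \<longlongrightarrow> b) (at_left T)"
      unfolding L_def list.set ball_simps prod.case by (intro conjI TrueI tendsto_minus l tendsto_mult_right)
    have "(\<lambda>t p vs. inverse (\<alpha> t) * phi M N (\<alpha> t) (\<beta> t) (\<gamma> t) (\<delta> t) p vs) =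
        (\<lambda>t p. lincomb (coframe p) (map (\<lambda>(a, b, is). (a t, is)) L))"
      by (simp add: fun_eq_iff phi_eq ansatz_def L_def lincomb_eval algebra_simps del: wedges.simps)
    moreover have "\<psi> = (\<lambda>p. lincomb (coframe p) (map (\<lambda>(a, b, is). (b, is)) L))"
      by (simp add: fun_eq_iff \<psi>_def ansatz_def L_def lincomb_eval del: wedges.simps)
    ultimately have "smooth_limit (\<lambda>t p vs. inverse (\<alpha> t) * phi M N (\<alpha> t) (\<beta> t) (\<gamma> t) (\<delta> t) p vs) \<psi> (at_left T)"
      using smooth_limit_lincomb[OF conv] by (simp only:)
    then show "\<exists>\<phi>lim.
        smooth_limit (\<lambda>t p vs. inverse (\<alpha> t) * phi M N (\<alpha> t) (\<beta> t) (\<gamma> t) (\<delta> t) p vs) \<phi>lim (at_left T) \<and>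
        (\<forall>p. Q_inv (omega p) (\<phi>lim p) < 0) \<and>
        harmonic_acs (\<lambda>p. g_metric (omega p) (\<phi>lim p)) (\<lambda>p. J_endo (omega p) (\<phi>lim p))"
      using tensors(1) harmonic by (intro exI[of _ \<psi>] conjI) blast+
  qed
qed

end
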